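(* Let $0\le\beta<\alpha<1$ and fix $\ell\in\{1,2,\ldots\}$. Let $W_1,\dots,W_\ell$ be independent with $W_i\sim\mathrm{Beta}(i\alpha-\beta,1-\alpha)$, and let $B_1,\dots,B_\ell$ be independent with $B_i\sim\mathrm{Beta}\big(\frac{\alpha-\beta+i-1}{\alpha},\frac{1-\alpha}{\alpha}\big)$. Let $(\prod_{i=1}^\ell W_{i,k}^\alpha)_{k\ge1}$ and $(\prod_{i=1}^\ell B_{i,k})_{k\ge1}$ be iid collections distributed as $\prod_{i=1}^\ell W_i^\alpha$ and $\prod_{i=1}^\ell B_i$ respectively, and, independent of all other variables, let $(Z^{(k)}_{\alpha,\ell\alpha-\beta})_{k\ge1}$ and $(Z^{(k)}_{\alpha,\ell-\beta})_{k\ge1}$ be iid collections with common laws $\mathrm{ML}(\alpha,\ell\alpha-\beta)$ and $\mathrm{ML}(\alpha,\ell-\beta)$ respectively. Then the following fixed point equations hold. (i) For $(\tilde P_{k,\beta})\sim\mathrm{GEM}(\beta,\ell\alpha-\beta)$, independent of the other variables, and $Z_{\alpha,\ell\alpha-\beta}\sim\mathrm{ML}(\alpha,\ell\alpha-\beta)$ (equivalent in distribution to the $\alpha$-diversity of $\mathrm{PD}(\alpha,\ell\alpha-\beta)$), $$Z_{\alpha,\ell\alpha-\beta}\overset{d}{=}\sum_{k=1}^\infty\tilde P_{k,\beta}^\alpha\Big(\prod_{i=1}^\ell W_{i,k}^\alpha\Big)Z^{(k)}_{\alpha,\ell\alpha-\beta},$$ and hence $\mathbb{E}\big[\sum_{k=1}^\infty\tilde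 P_{k,\beta}^\alpha\prod_{i=1}^\ell W_{i,k}^\alpha\big]=1$. (ii) For $(\tilde P_{k,\beta})\sim\mathrm{GEM}(\beta,\ell-\beta)$, independent of the other variables, and $Z_{\alpha,\ell-\beta}\sim\mathrm{ML}(\alpha,\ell-\beta)$ (equivalent in distribution to the $\alpha$-diversity of $\mathrm{PD}(\alpha,\ell-\beta)$), $$Z_{\alpha,\ell-\beta}\overset{d}{=}\sum_{k=1}^\infty\tilde P_{k,\beta}^\alpha\Big(\prod_{i=1}^\ell B_{i,k}\Big)Z^{(k)}_{\alpha,\ell-\beta},$$ and hence $\mathbb{E}\big[\sum_{k=1}^\infty\tilde P_{k,\beta}^\alpha\prod_{i=1}^\ell B_{i,k}\big]=1$.
   Context: For $\alpha\in(0,1)$, $T_\alpha$ is the positive $\alpha$-stable variable with $\mathbb{E}[e^{-\lambda T_\alpha}]=e^{-\lambda^\alpha}$ and density $f_\alpha$; $g_\alpha(s)=f_\alpha(s^{-1/\alpha})s^{-1/\alpha-1}/\alpha$ is the density of $T_\alpha^{-\alpha}$. $\mathrm{ML}(\alpha,\theta)$, $\theta>-\alpha$, is the law with density $s^{\theta/\alpha}g_\alpha(s)/\mathbb{E}[T_\alpha^{-\theta}]$, $s>0$. For $0\le\gamma<1$, $\theta>-\gamma$, $\mathrm{GEM}(\gamma,\theta)$ is the law of $(R_k\prod_{j=1}^{k-1}(1-R_j))_{k\ge1}$ with $R_k\sim\mathrm{Beta}(1-\gamma,\theta+k\gamma)$ independent, and $\mathrm{PD}(\gamma,\theta)$ is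 the law of its decreasing rearrangement. (So in (i) $R_k\sim\mathrm{Beta}(1-\beta,\ell\alpha+(k-1)\beta)$, and in (ii) $R_k\sim\mathrm{Beta}(1-\beta,\ell+(k-1)\beta)$.) The $\alpha$-diversity of a random mass partition $P$ is the a.s. limit of $n^{-\alpha}K_n$, where $K_n$ is the number of distinct values among $n$ indices sampled iid, given $P$, from the probabilities $P_i$. *)

theory Defs
  imports "HOL-Probability.Probability"
begin

abbreviation seq_space :: "(nat \<Rightarrow> real) measure" where
  "seq_space \<equiv> PiM UNIV (\<lambda>_. borel)"

definition has_law :: "'a measure \<Rightarrow> ('a \<Rightarrow> real) \<Rightarrow> real measure \<Rightarrow> bool" where
  "has_law M X \<mu> \<longleftrightarrow> X \<in> borel_measurable M \<and> distr M borel X = \<mu>"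

definition has_seq_law ::
    "'a measure \<Rightarrow> (nat \<Rightarrow> 'a \<Rightarrow> real) \<Rightarrow> (nat \<Rightarrow> real) measure \<Rightarrow> bool" where
  "has_seq_law M X \<mu> \<longleftrightarrow>
     (\<forall>k. X k \<in> borel_measurable M) \<and> distr M seq_space (\<lambda>\<omega> k. X k \<omega>) = \<mu>"

definition iid_with_law :: "'a measure \<Rightarrow> (nat \<Rightarrow> 'a \<Rightarrow> real) \<Rightarrow> real measure \<Rightarrow> bool" where
  "iid_with_law M X \<mu> \<longleftrightarrow>
     prob_space.indep_vars M (\<lambda>_. borel) X UNIV \<and> (\<forall>k. has_law M (X k) \<mu>)"

text \<open>Mutual independence of a finite list of random sequences, each regarded as one
  sequence-valued random variable; nothing is said about the entries within one sequence.\<close>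

definition indep_seqs :: "'a measure \<Rightarrow> (nat \<Rightarrow> 'a \<Rightarrow> real) list \<Rightarrow> bool" where
  "indep_seqs M Xs \<longleftrightarrow>
     prob_space.indep_vars M (\<lambda>_. seq_space) (\<lambda>j \<omega> k. (Xs ! j) k \<omega>) {..<length Xs}"

definition beta_law :: "real \<Rightarrow> real \<Rightarrow> real measure" where
  "beta_law a b = density lborel (\<lambda>x. ennreal
     (if 0 < x \<and> x < 1 then x powr (a - 1) * (1 - x) powr (b - 1) / Beta a b else 0))"

text \<open>\<open>f\<close> is (a version of) the density of the positive \<open>\<alpha>\<close>-stable variable. The case
  \<open>u = 0\<close> of the Laplace transform says that \<open>f\<close> has total mass 1.\<close>

definition stable_density :: "real \<Rightarrow> (real \<Rightarrow> real) \<Rightarrow> bool" where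
  "stable_density \<alpha> f \<longleftrightarrow>
     f \<in> borel_measurable borel \<and> (\<forall>t. 0 \<le> f t) \<and> (\<forall>t\<le>0. f t = 0) \<and>
     (\<forall>u\<ge>0. (\<integral>t. exp (- u * t) * f t \<partial>lborel) = exp (- (u powr \<alpha>)))"

text \<open>In the next two definitions \<open>f\<close> is to be a stable density \<open>f\<^sub>\<alpha>\<close>. The denominator in
  \<open>mittag_leffler_law\<close> is the expectation of the power \<open>-\<theta>\<close> of the stable variable.\<close>

definition g_density :: "(real \<Rightarrow> real) \<Rightarrow> real \<Rightarrow> real \<Rightarrow> real" where
  "g_density f \<alpha> s = f (s powr (- 1 / \<alpha>)) * s powr (- 1 / \<alpha> - 1) / \<alpha>"

definition mittag_leffler_law :: "(real \<Rightarrow> real) \<Rightarrow> real \<Rightarrow> real \<Rightarrow> real measure" where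
  "mittag_leffler_law f \<alpha> \<theta> = density lborel (\<lambda>s. ennreal
     (if 0 < s then s powr (\<theta> / \<alpha>) * g_density f \<alpha> s / (\<integral>t. t powr (- \<theta>) * f t \<partial>lborel)
      else 0))"

text \<open>Sequences are indexed from 0, so the stick-breaking factor with index \<open>k\<close> here is the
  \<open>(k + 1)\<close>-st factor \<open>R\<close> of the usual indexing.\<close>

definition stick_breaking :: "(nat \<Rightarrow> real) \<Rightarrow> nat \<Rightarrow> real" where
  "stick_breaking r k = r k * (\<Prod>j<k. 1 - r j)"

definition GEM :: "real \<Rightarrow> real \<Rightarrow> (nat \<Rightarrow> real) measure" where
  "GEM \<gamma> \<theta> =
     distr (PiM UNIV (\<lambda>k. beta_law (1 - \<gamma>) (\<theta> + real (Suc k) * \<gamma>))) seq_space stick_breaking"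

text \<open>The decreasing rearrangement of a nonnegative null sequence: entry \<open>n\<close> is the
  \<open>(n + 1)\<close>-st largest value of \<open>x\<close>, counted with multiplicity.\<close>

definition decreasing_rearrangement :: "(nat \<Rightarrow> real) \<Rightarrow> nat \<Rightarrow> real" where
  "decreasing_rearrangement x n =
     Inf {t. 0 \<le> t \<and> finite {i. t < x i} \<and> card {i. t < x i} \<le> n}"

definition PD :: "real \<Rightarrow> real \<Rightarrow> (nat \<Rightarrow> real) measure" where
  "PD \<gamma> \<theta> = distr (GEM \<gamma> \<theta>) seq_space decreasing_rearrangement"

text \<open>Given the random mass partition \<open>P\<close>, the indices \<open>I 0, I 1, \<dots>\<close> are iid with
  probabilities \<open>P i\<close>: the conditional probability, given \<open>P\<close>, that the first \<open>n\<close> indices are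
  \<open>i 0, \<dots>, i (n - 1)\<close> is the product of the \<open>P (i j)\<close>, written out through its integrals over
  the events determined by \<open>P\<close>. (Taking \<open>n = 1\<close>, this forces \<open>P\<close> to have total mass 1
  almost surely.)\<close>

definition iid_sampled ::
    "'a measure \<Rightarrow> (nat \<Rightarrow> 'a \<Rightarrow> real) \<Rightarrow> (nat \<Rightarrow> 'a \<Rightarrow> nat) \<Rightarrow> bool" where
  "iid_sampled M P I \<longleftrightarrow>
     (\<forall>k. P k \<in> borel_measurable M) \<and> (\<forall>j. I j \<in> measurable M (count_space UNIV)) \<and>
     (\<forall>n. \<forall>i :: nat \<Rightarrow> nat. \<forall>A\<in>sets seq_space.
        measure M {\<omega>\<in>space M. (\<lambda>k. P k \<omega>) \<in> A \<and> (\<forall>j<n. I j \<omega> = i j)} =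
        (\<integral>\<omega>. indicator A (\<lambda>k. P k \<omega>) * (\<Prod>j<n. P (i j) \<omega>) \<partial>M))"

text \<open>\<open>D\<close> is the \<open>\<alpha>\<close>-diversity of \<open>P\<close>. The cardinality is the number of distinct values among
  the first \<open>n\<close> sampled indices.\<close>

definition alpha_diversity ::
    "'a measure \<Rightarrow> real \<Rightarrow> (nat \<Rightarrow> 'a \<Rightarrow> real) \<Rightarrow> ('a \<Rightarrow> real) \<Rightarrow> bool" where
  "alpha_diversity M \<alpha> P D \<longleftrightarrow>
     D \<in> borel_measurable M \<and>
     (\<exists>I. iid_sampled M P I \<and>
        (AE \<omega> in M. (\<lambda>n. real n powr (- \<alpha>) * real (card ((\<lambda>j. I j \<omega>) ` {..<n})))
           \<longlonglongrightarrow> D \<omega>))"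

end

theory Submission
  imports Defs "HOL-Real_Asymp.Real_Asymp"
begin

text \<open>Both sides of each fixed point equation have the same moments, and these moments determine the law.
  Removing the first stick of \<open>GEM (\<beta>, \<theta>)\<close> leaves a scaled \<open>GEM (\<beta>, \<theta> + \<beta>)\<close>, and the beta moments of that stick
  turn the moments of the sum into those of \<open>ML (\<alpha>, \<theta>)\<close> times the probability that \<open>n\<close> samples from
  \<open>GEM (\<beta>/\<alpha>, \<theta>/\<alpha>)\<close> are exhausted by the sticks summed so far, which tends to 1. This needs only that the weight
  times a \<open>ML (\<alpha>, \<theta>)\<close> variable has the moments that the Gamma quotient for \<open>ML (\<alpha>, -\<beta>)\<close> gives,
  and the products of beta variables provide this by telescoping. The expectation of the weights is the
  first moment.

  For the \<open>\<alpha>\<close>-diversity, mark every index independently with probability \<open>s\<close> and sample at the times of a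
  Poisson process run for an independent Gamma time with shape \<open>\<theta>\<close> and rate \<open>c\<close>. Stick by stick, the
  probability that no marked index is sampled is found to be \<open>(1 - s + s (1 + 1 / c) powr \<alpha>) powr (- \<theta> / \<alpha>)\<close>,
  and it does not change under rearrangement of the mass partition. With \<open>c\<close> tending to 0 and
  \<open>s = l c\<^sup>\<alpha>\<close> this becomes \<open>E exp (- l Y\<^sup>\<alpha> D) = (1 + l) powr (- \<theta> / \<alpha>)\<close> for the diversity \<open>D\<close> and an
  independent Gamma variable \<open>Y\<close> of shape \<open>\<theta>\<close>. The Mittag-Leffler law satisfies
  the same identity, and dividing out the moments of \<open>Y\<close> identifies those of \<open>D\<close>.\<close>

section \<open>Stick-breaking laws and determinacy by moments\<close>

text \<open>Behind both equations stands one identity in law: if every stick of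
  \<open>GEM (\<beta>, \<theta>)\<close> is shattered by an independent
  \<open>PD (\<alpha>, - \<beta>)\<close>, the pieces form \<open>PD (\<alpha>, \<theta>)\<close>,
  and the diversities of the pieces add up, weighted by the \<alpha>-th powers of the stick lengths.
  Only its moments are used; \<open>ML (\<alpha>, - \<beta>)\<close> occurs merely as a sequence of
  numbers. The auxiliary \<open>GEM (\<beta>/\<alpha>, \<theta>/\<alpha>)\<close> comes from the
  Pochhammer symbols in these moments: their arguments are divided by \<alpha> and combine into
  beta-binomial weights. For the diversity the obstacle is a mismatch of shapes. A Gamma time splits
  independently along the first stick \<open>Beta (1 - \<alpha>, \<theta> + \<alpha>)\<close> if its
  shape is \<open>\<theta> + 1\<close>, but the closed form belongs to shape \<theta>. Integrating
  over the rate bridges the gap of one, so the transform solves an integral recursion linking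
  \<theta> to \<open>\<theta> + \<alpha>\<close>. The closed form solves the same recursion, and a
  contraction estimate identifies the two. In the final limit no dominating function for the
  discrete counts is at hand; Fatou's lemma is applied to a probability and to its complement
  instead.\<close>

lemma measurable_seq_spaceI:
  "(\<And>k. (\<lambda>x. f x k) \<in> borel_measurable M) \<Longrightarrow> f \<in> M \<rightarrow>\<^sub>M seq_space"
  by (rule measurable_PiM_single') auto

lemma measurable_case_nat_seq [measurable (raw)]:
  assumes [measurable]: "f \<in> borel_measurable M" "\<And>k. (\<lambda>x. g x k) \<in> borel_measurable M"
  shows "(\<lambda>x. case_nat (f x) (g x)) \<in> M \<rightarrow>\<^sub>M seq_space"
proof (rule measurable_seq_spaceI)
  fix k show "(\<lambda>x. case_nat (f x) (g x) k) \<in> borel_measurable M" by (cases k) simp_all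
qed

text \<open>The factors may differ between coordinates, as the stick-breaking factors do, so the
  tail is the product of the shifted family \<open>M (Suc n)\<close>. Measures on the product agree
  once they agree on boxes over finitely many coordinates.\<close>

lemma PiM_nat_unfold:
  fixes M :: "nat \<Rightarrow> real measure"
  assumes prob: "\<And>n. prob_space (M n)" and sets: "\<And>n. sets (M n) = sets borel"
  shows "distr (M 0 \<Otimes>\<^sub>M PiM UNIV (\<lambda>n. M (Suc n))) seq_space (\<lambda>(x, \<omega>). case_nat x \<omega>) = PiM UNIV M"
    (is "?D = _")
proof -
  interpret P: product_prob_space M "UNIV :: nat set"
    by (rule product_prob_spaceI) (rule prob)
  interpret P': product_prob_space "\<lambda>n. M (Suc n)" "UNIV :: nat set"
    by (rule product_prob_spaceI) (rule prob)
  have sets1: "sets (PiM UNIV M) = sets seq_space"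
    by (rule sets_PiM_cong) (auto simp: sets)
  have sets2: "sets (PiM UNIV (\<lambda>n. M (Suc n))) = sets seq_space"
    by (rule sets_PiM_cong) (auto simp: sets)
  have meas: "(\<lambda>(x, \<omega>). case_nat x \<omega>) \<in> (M 0 \<Otimes>\<^sub>M PiM UNIV (\<lambda>n. M (Suc n))) \<rightarrow>\<^sub>M seq_space"
    by (subst measurable_cong_sets[OF sets_pair_measure_cong[OF sets sets2] refl]) measurable
  have space: "space (M n) = UNIV" for n
    using sets_eq_imp_space_eq[OF sets] by simp
  show ?thesis
  proof (rule P.PiM_eq)
    show "sets ?D = sets (PiM UNIV M)" by (simp add: sets1)
  next
    fix J :: "nat set" and F assume J: "finite J" "J \<subseteq> UNIV" "\<And>j. j \<in> J \<Longrightarrow> F j \<in> sets (M j)"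
    let ?X = "prod_emb UNIV M J (\<Pi>\<^sub>E j\<in>J. F j)"
    \<comment> \<open>A box that does not constrain coordinate 0 leaves the first component of the
      pair free.\<close>
    let ?E = "if 0 \<in> J then F 0 else space (M 0)"
    let ?F = "prod_emb UNIV (\<lambda>n. M (Suc n)) (Suc -` J) (\<Pi>\<^sub>E j\<in>Suc -` J. F (Suc j))"
    have X: "?X \<in> sets seq_space"
      unfolding sets1[symmetric] using J by (intro sets_PiM_I) auto
    have F: "?F \<in> sets (PiM UNIV (\<lambda>n. M (Suc n)))"
      using J by (intro sets_PiM_I finite_vimageI) auto
    have *: "(\<lambda>(x, \<omega>). case_nat x \<omega>) -` ?X \<inter> space (M 0 \<Otimes>\<^sub>M PiM UNIV (\<lambda>n. M (Suc n))) = ?E \<times> ?F"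
      by (auto simp: space_pair_measure space_PiM PiE_iff prod_emb_def all_conj_distrib space
          split: nat.split nat.split_asm)
    have "emeasure ?D ?X = emeasure (M 0 \<Otimes>\<^sub>M PiM UNIV (\<lambda>n. M (Suc n))) (?E \<times> ?F)"
      by (subst emeasure_distr[OF meas X]) (simp only: *)
    also have "\<dots> = emeasure (M 0) ?E * emeasure (PiM UNIV (\<lambda>n. M (Suc n))) ?F"
      using J F by (intro P'.emeasure_pair_measure_Times) auto
    also have "emeasure (PiM UNIV (\<lambda>n. M (Suc n))) ?F = (\<Prod>j\<in>Suc -` J. emeasure (M (Suc j)) (F (Suc j)))"
      using J by (intro P'.emeasure_PiM_emb finite_vimageI) auto
    also have "\<dots> = (\<Prod>j\<in>J - {0}. emeasure (M j) (F j))"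
      by (rule prod.reindex_bij_witness[where i = "\<lambda>x. x - 1" and j = Suc]) auto
    also have "emeasure (M 0) ?E * \<dots> = (\<Prod>j\<in>J. emeasure (M j) (F j))"
      using prob_space.emeasure_space_1[OF prob, of 0] by (auto simp: prod.remove J)
    finally show "emeasure ?D ?X = (\<Prod>j\<in>J. emeasure (M j) (F j))" .
  qed
qed

text \<open>The form in which every stick-by-stick induction uses independence: one coordinate
  outside, the shifted product inside.\<close>

lemma nn_integral_PiM_nat_unfold:
  fixes M :: "nat \<Rightarrow> real measure"
  assumes prob: "\<And>n. prob_space (M n)" and sets: "\<And>n. sets (M n) = sets borel"
    and F: "F \<in> borel_measurable seq_space"
  shows "(\<integral>\<^sup>+\<omega>. F \<omega> \<partial>PiM UNIV M) =
    (\<integral>\<^sup>+x. \<integral>\<^sup>+\<omega>. F (case_nat x \<omega>) \<partial>PiM UNIV (\<lambda>n. M (Suc n)) \<partial>M 0)"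
proof -
  interpret P': product_prob_space "\<lambda>n. M (Suc n)" "UNIV :: nat set"
    by (rule product_prob_spaceI) (rule prob)
  have sets2: "sets (PiM UNIV (\<lambda>n. M (Suc n))) = sets seq_space"
    by (rule sets_PiM_cong) (auto simp: sets)
  have meas: "(\<lambda>(x, \<omega>). case_nat x \<omega>) \<in> (M 0 \<Otimes>\<^sub>M PiM UNIV (\<lambda>n. M (Suc n))) \<rightarrow>\<^sub>M seq_space"
    by (subst measurable_cong_sets[OF sets_pair_measure_cong[OF sets sets2] refl]) measurable
  note [measurable] = F meas
  have "(\<integral>\<^sup>+\<omega>. F \<omega> \<partial>PiM UNIV M) =
    (\<integral>\<^sup>+z. F ((\<lambda>(x, \<omega>). case_nat x \<omega>) z) \<partial>(M 0 \<Otimes>\<^sub>M PiM UNIV (\<lambda>n. M (Suc n))))"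
    by (subst PiM_nat_unfold[OF prob sets, symmetric], subst nn_integral_distr[OF meas]) (simp_all add: F)
  also have "\<dots> = (\<integral>\<^sup>+x. \<integral>\<^sup>+\<omega>. F (case_nat x \<omega>) \<partial>PiM UNIV (\<lambda>n. M (Suc n)) \<partial>M 0)"
    by (subst P'.nn_integral_fst[symmetric]) (auto intro: measurable_compose[OF meas F])
  finally show ?thesis .
qed

section \<open>Beta laws and their moments\<close>

lemma sets_beta_law [simp, measurable_cong]: "sets (beta_law a b) = sets borel"
  by (simp add: beta_law_def)

lemma space_beta_law [simp]: "space (beta_law a b) = UNIV"
  by (simp add: beta_law_def)

lemma nn_integral_beta_law:
  assumes [measurable]: "h \<in> borel_measurable borel" and a: "0 < a" "0 < b"
  shows "(\<integral>\<^sup>+x. h x \<partial>beta_law a b) =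
    (\<integral>\<^sup>+x. ennreal (indicator {0<..<1} x * x powr (a - 1) * (1 - x) powr (b - 1) / Beta a b) * h x \<partial>lborel)"
  unfolding beta_law_def
  by (subst nn_integral_density) (auto intro!: nn_integral_cong simp: indicator_def)

lemma Beta_real_pos: "0 < a \<Longrightarrow> 0 < b \<Longrightarrow> 0 < Beta a (b::real)"
  by (simp add: Beta_def Gamma_real_pos)

lemma nn_integral_Beta:
  assumes a: "0 < a" "0 < (b::real)"
  shows "(\<integral>\<^sup>+x. ennreal (indicator {0<..<1} x * x powr (a - 1) * (1 - x) powr (b - 1)) \<partial>lborel) = Beta a b"
proof -
  have "((\<lambda>t. t powr (a - 1) * (1 - t) powr (b - 1)) has_integral Beta a b) {0<..<1}"
    using has_integral_Beta_real[OF a] by (simp add: has_integral_Icc_iff_Ioo)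
  from nn_integral_has_integral_lebesgue[OF _ this] show ?thesis
    by (simp add: mult.assoc)
qed

lemma beta_law_powr_moment:
  assumes a: "0 < a" "0 < b" "0 < a + p" "0 < b + q"
  shows "(\<integral>\<^sup>+x. ennreal (x powr p * (1 - x) powr q) \<partial>beta_law a b) = ennreal (Beta (a + p) (b + q) / Beta a b)"
proof -
  have "(\<integral>\<^sup>+x. ennreal (x powr p * (1 - x) powr q) \<partial>beta_law a b) =
    (\<integral>\<^sup>+x. ennreal (1 / Beta a b) *
      ennreal (indicator {0<..<1} x * x powr (a + p - 1) * (1 - x) powr (b + q - 1)) \<partial>lborel)"
    using Beta_real_pos[OF a(1,2)] a
    by (subst nn_integral_beta_law)
      (auto intro!: nn_integral_cong simp: indicator_def ennreal_mult'[symmetric] powr_add powr_diff field_simps)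
  also have "\<dots> = ennreal (1 / Beta a b) * ennreal (Beta (a + p) (b + q))"
    using a nn_integral_Beta[of "a + p" "b + q"] by (subst nn_integral_cmult) simp_all
  also have "\<dots> = ennreal (Beta (a + p) (b + q) / Beta a b)"
    using Beta_real_pos[OF a(1,2)] by (simp add: ennreal_mult'[symmetric])
  finally show ?thesis .
qed

lemma prob_space_beta_law:
  assumes "0 < a" "0 < b"
  shows "prob_space (beta_law a b)"
proof
  have "emeasure (beta_law a b) (space (beta_law a b)) = (\<integral>\<^sup>+x. 1 \<partial>beta_law a b)"
    by simp
  also have "\<dots> = (\<integral>\<^sup>+x. ennreal (indicator {0<..<1} x * x powr (a - 1) * (1 - x) powr (b - 1) / Beta a b) \<partial>lborel)"
    using assms by (subst nn_integral_beta_law) auto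
  also have "\<dots> = ennreal (1 / Beta a b) * ennreal (Beta a b)"
    using nn_integral_Beta[OF assms] Beta_real_pos[OF assms]
    by (subst nn_integral_Beta[OF assms, symmetric], subst nn_integral_cmult[symmetric])
      (auto simp: ennreal_mult'[symmetric] field_simps)
  also have "\<dots> = 1"
    using Beta_real_pos[OF assms] by (simp add: ennreal_mult'[symmetric])
  finally show "emeasure (beta_law a b) (space (beta_law a b)) = 1" .
qed

lemma AE_beta_law: "0 < a \<Longrightarrow> 0 < b \<Longrightarrow> AE x in beta_law a b. 0 < x \<and> x < 1"
proof -
  assume "0 < a" "0 < b"
  have "(\<lambda>x. ennreal (if 0 < x \<and> x < 1 then x powr (a - 1) * (1 - x) powr (b - 1) / Beta a b else 0))
    \<in> borel_measurable lborel" by measurable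
  then show ?thesis
    unfolding beta_law_def by (subst AE_density) (auto intro!: AE_I2 split: if_splits)
qed

section \<open>Self-similarity of stick breaking\<close>

lemma stick_breaking_case_nat:
  "stick_breaking (case_nat r \<omega>) = case_nat r (\<lambda>k. (1 - r) * stick_breaking \<omega> k)"
proof
  fix k
  show "stick_breaking (case_nat r \<omega>) k = case_nat r (\<lambda>k. (1 - r) * stick_breaking \<omega> k) k"
    by (cases k) (simp_all add: stick_breaking_def prod.lessThan_Suc_shift del: prod.lessThan_Suc)
qed

lemma measurable_stick_breaking [measurable]: "stick_breaking \<in> seq_space \<rightarrow>\<^sub>M seq_space"
  unfolding stick_breaking_def[abs_def] by (rule measurable_PiM_single') auto

lemma sets_GEM [simp, measurable_cong]: "sets (GEM \<gamma> \<theta>) = sets seq_space"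
  by (simp add: GEM_def)

lemma space_GEM [simp]: "space (GEM \<gamma> \<theta>) = UNIV"
  by (simp add: GEM_def space_PiM)

lemma sets_PiM_beta [simp, measurable_cong]: "sets (PiM UNIV (\<lambda>k::nat. beta_law (a k) (b k))) = sets seq_space"
  by (rule sets_PiM_cong) auto

lemma nn_integral_GEM:
  assumes [measurable]: "F \<in> borel_measurable seq_space"
  shows "(\<integral>\<^sup>+p. F p \<partial>GEM \<gamma> \<theta>) =
    (\<integral>\<^sup>+r. F (stick_breaking r) \<partial>PiM UNIV (\<lambda>k. beta_law (1 - \<gamma>) (\<theta> + real (Suc k) * \<gamma>)))"
  unfolding GEM_def by (rule nn_integral_distr) auto

context
  fixes \<gamma> \<theta> :: real
  assumes \<gamma>: "0 \<le> \<gamma>" "\<gamma> < 1" and \<theta>: "- \<gamma> < \<theta>"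
begin

lemma GEM_param_pos: "0 < \<theta> + real (Suc k) * \<gamma>"
proof -
  \<comment> \<open>\<open>\<theta>\<close> may be negative; the smallest parameter, at
    \<open>k = 0\<close>, is \<open>\<theta> + \<gamma>\<close>.\<close>
  have "\<gamma> * 1 \<le> real (Suc k) * \<gamma>" using \<gamma> by (subst mult.commute) (intro mult_left_mono, auto)
  with \<theta> show ?thesis by simp
qed

lemma prob_space_GEM_factor: "prob_space (beta_law (1 - \<gamma>) (\<theta> + real (Suc k) * \<gamma>))"
  using \<gamma> GEM_param_pos by (intro prob_space_beta_law) auto

lemma prob_space_GEM: "prob_space (GEM \<gamma> \<theta>)"
  unfolding GEM_def
  by (intro prob_space.prob_space_distr prob_space_PiM prob_space_GEM_factor)
     (subst measurable_cong_sets[OF sets_PiM_beta refl], measurable)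

text \<open>Dropping the first stick shifts the index by one, and \<open>\<theta> + real (Suc (Suc
  k)) * \<gamma> = \<theta> + \<gamma> + real (Suc k) * \<gamma>\<close>. Hence what follows the
  first stick, rescaled by \<open>1 - r\<close>, is again of GEM type with the second parameter
  raised by \<open>\<gamma>\<close>.\<close>

lemma nn_integral_GEM_unfold:
  assumes F [measurable]: "F \<in> borel_measurable seq_space"
  shows "(\<integral>\<^sup>+p. F p \<partial>GEM \<gamma> \<theta>) =
    (\<integral>\<^sup>+r. \<integral>\<^sup>+p. F (case_nat r (\<lambda>k. (1 - r) * p k)) \<partial>GEM \<gamma> (\<theta> + \<gamma>) \<partial>beta_law (1 - \<gamma>) (\<theta> + \<gamma>))"
proof -
  have "(\<integral>\<^sup>+p. F p \<partial>GEM \<gamma> \<theta>) =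
    (\<integral>\<^sup>+r. \<integral>\<^sup>+\<omega>. F (stick_breaking (case_nat r \<omega>))
      \<partial>PiM UNIV (\<lambda>k. beta_law (1 - \<gamma>) (\<theta> + real (Suc (Suc k)) * \<gamma>)) \<partial>beta_law (1 - \<gamma>) (\<theta> + real (Suc 0) * \<gamma>))"
    unfolding nn_integral_GEM[OF F]
    by (rule nn_integral_PiM_nat_unfold[OF prob_space_GEM_factor]) simp_all
  also have "\<dots> = (\<integral>\<^sup>+r. \<integral>\<^sup>+p. F (case_nat r (\<lambda>k. (1 - r) * p k)) \<partial>GEM \<gamma> (\<theta> + \<gamma>) \<partial>beta_law (1 - \<gamma>) (\<theta> + \<gamma>))"
  proof -
    have eq: "\<theta> + real (Suc (Suc k)) * \<gamma> = \<theta> + \<gamma> + real (Suc k) * \<gamma>" for k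
      by (simp add: algebra_simps)
    have "(\<integral>\<^sup>+p. F (case_nat r (\<lambda>k. (1 - r) * p k)) \<partial>GEM \<gamma> (\<theta> + \<gamma>)) =
      (\<integral>\<^sup>+\<omega>. F (stick_breaking (case_nat r \<omega>))
      \<partial>PiM UNIV (\<lambda>k. beta_law (1 - \<gamma>) (\<theta> + real (Suc (Suc k)) * \<gamma>)))" for r
      unfolding eq by (subst nn_integral_GEM) (simp_all add: stick_breaking_case_nat)
    then show ?thesis by simp
  qed
  finally show ?thesis .
qed

lemma AE_GEM: "AE p in GEM \<gamma> \<theta>. (\<forall>k. 0 < p k) \<and> (\<forall>m. (\<Sum>k<m. p k) \<le> 1)"
proof -
  interpret product_prob_space "\<lambda>k. beta_law (1 - \<gamma>) (\<theta> + real (Suc k) * \<gamma>)" "UNIV :: nat set"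
    by (rule product_prob_spaceI) (rule prob_space_GEM_factor)
  let ?M = "PiM UNIV (\<lambda>k. beta_law (1 - \<gamma>) (\<theta> + real (Suc k) * \<gamma>))"
  have "AE r in ?M. \<forall>k. 0 < r k \<and> r k < 1"
  proof (subst AE_all_countable, intro allI)
    fix k
    have "AE x in beta_law (1 - \<gamma>) (\<theta> + real (Suc k) * \<gamma>). 0 < x \<and> x < 1"
      using \<gamma> GEM_param_pos by (intro AE_beta_law) auto
    then show "AE r in ?M. 0 < r k \<and> r k < 1"
      using AE_PiM_component[of UNIV _ k, OF prob_space_GEM_factor] by auto
  qed
  then have "AE r in ?M. (\<forall>k. 0 < stick_breaking r k) \<and> (\<forall>m. (\<Sum>k<m. stick_breaking r k) \<le> 1)"
  proof eventually_elim
    case (elim r)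
    \<comment> \<open>The part left over after \<open>m\<close> sticks is the product of the factors
      \<open>1 - r k\<close>, so its sign bounds the partial sums. That the sampled partitions have
      total mass 1 is read off later from the sampling.\<close>
    have "(\<Sum>k<m. stick_breaking r k) = 1 - (\<Prod>k<m. 1 - r k)" for m
      by (induction m) (auto simp: stick_breaking_def algebra_simps)
    moreover have "0 \<le> (\<Prod>k<m. 1 - r k)" for m
      using elim by (intro prod_nonneg) (auto intro: less_imp_le)
    moreover have "0 < stick_breaking r k" for k
      unfolding stick_breaking_def using elim by (intro mult_pos_pos prod_pos) auto
    ultimately show ?case by simp
  qed
  then show ?thesis
    unfolding GEM_def by (subst AE_distr_iff) auto
qed

end

text \<open>By \<open>1 - x \<le> exp (- x)\<close> the product is at most the exponential of minus
  a multiple of the harmonic numbers, which diverge. Products of this shape measure the error after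
  \<open>m\<close> sticks in both recursions: the samples not yet caught in the moment computation,
  and the distance to the closed form in the marked sampling.\<close>

lemma prod_tendsto_0_harmonic:
  fixes a b d :: real
  assumes "0 < a" "a \<le> b" "0 \<le> d"
  shows "(\<lambda>m. \<Prod>i<m. 1 - a / (b + real i * d)) \<longlonglongrightarrow> 0"
proof (rule tendsto_sandwich[of "\<lambda>_. 0" _ _ "\<lambda>m. exp (- (a / (b + d)) * harm m)"])
  have b: "0 < b + real i * d" "b \<le> b + real i * d" for i
    using assms by (auto intro: add_pos_nonneg)
  have ge: "0 \<le> 1 - a / (b + real i * d)" for i
    using b[of i] assms(1,2) by (simp add: divide_le_eq)
  show "\<forall>\<^sub>F m in sequentially. 0 \<le> (\<Prod>i<m. 1 - a / (b + real i * d))"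
    using ge by (intro always_eventually allI prod_nonneg) auto
  have "(\<Prod>i<m. 1 - a / (b + real i * d)) \<le> exp (- (a / (b + d)) * harm m)" for m
  proof -
    have *: "1 - a / (b + real i * d) \<le> exp (- (a / (b + d)) * inverse (real (Suc i)))" for i
    proof -
      \<comment> \<open>Bounds the denominators by a multiple of \<open>Suc i\<close>; this also
        covers \<open>d = 0\<close>.\<close>
      have "b + real i * d \<le> (b + d) * real (Suc i)"
        using assms by (simp add: algebra_simps)
      then have "a / ((b + d) * real (Suc i)) \<le> a / (b + real i * d)"
        using assms by (intro divide_left_mono mult_pos_pos b) auto
      then have "1 - a / (b + real i * d) \<le> 1 + (- (a / ((b + d) * real (Suc i))))" by simp
      also have "\<dots> \<le> exp (- (a / ((b + d) * real (Suc i))))" by (rule exp_ge_add_one_self)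
      finally show ?thesis by (simp add: field_simps)
    qed
    have "(\<Prod>i<m. 1 - a / (b + real i * d)) \<le> (\<Prod>i<m. exp (- (a / (b + d)) * inverse (real (Suc i))))"
      using * ge by (intro prod_mono) auto
    also have "\<dots> = exp (- (a / (b + d)) * harm m)"
      by (simp add: exp_sum[symmetric] harm_def sum_distrib_left sum_negf sum.atLeast1_atMost_eq)
    finally show ?thesis .
  qed
  then show "\<forall>\<^sub>F m in sequentially. (\<Prod>i<m. 1 - a / (b + real i * d)) \<le> exp (- (a / (b + d)) * harm m)"
    by simp
  have "filterlim (\<lambda>m. (a / (b + d)) * harm m :: real) at_top sequentially"
    using assms by (intro filterlim_tendsto_pos_mult_at_top[OF tendsto_const] harm_at_top) auto
  then have "filterlim (\<lambda>m. - (a / (b + d) * harm m :: real)) at_bot sequentially"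
    by (simp add: filterlim_uminus_at_top)
  then show "(\<lambda>m. exp (- (a / (b + d)) * harm m)) \<longlonglongrightarrow> 0"
    by (auto intro: filterlim_compose[OF exp_at_bot])
qed simp

text \<open>The Taylor polynomials of the characteristic function are built from the moments, and
  the remainder is at most \<open>2 * \<bar>t\<bar> ^ n / fact n\<close> times the absolute moment
  of order \<open>n\<close>. On the nonnegative half-line absolute moments are moments, so the
  growth condition sends the remainder to 0 for both laws, whose Taylor polynomials
  coincide.\<close>

lemma moment_determinacy:
  assumes M1: "real_distribution M1" and M2: "real_distribution M2"
    and int1: "\<And>n. integrable M1 (\<lambda>x. x ^ n)" and int2: "\<And>n. integrable M2 (\<lambda>x. x ^ n)"
    and eq: "\<And>n. (\<integral>x. x ^ n \<partial>M1) = (\<integral>x. x ^ n \<partial>M2)"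
    and pos: "AE x in M1. 0 \<le> x" "AE x in M2. 0 \<le> x"
    and small: "\<And>t. (\<lambda>n. t ^ n * (\<integral>x. x ^ n \<partial>M2) / fact n) \<longlonglongrightarrow> 0"
  shows "M1 = M2"
proof (rule Levy_uniqueness[OF M1 M2], rule ext)
  fix t :: real
  define A where "A n = (\<Sum>k\<le>n. ((\<i> * t) ^ k / fact k) * complex_of_real (\<integral>x. x ^ k \<partial>M2))" for n
  have abs: "(\<integral>x. \<bar>x\<bar> ^ n \<partial>M) = (\<integral>x. x ^ n \<partial>M)" if "AE x in M. 0 \<le> (x::real)" "sets M = sets borel" for M n
    using that by (intro integral_cong_AE) auto
  have lim: "A \<longlonglongrightarrow> char M t" if M: "real_distribution M" and int: "\<And>n. integrable M (\<lambda>x. x ^ n)"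
    and e: "\<And>n. (\<integral>x. x ^ n \<partial>M) = (\<integral>x. x ^ n \<partial>M2)" and p: "AE x in M. 0 \<le> x" for M
  proof -
    interpret real_distribution M by fact
    have "norm (A n - char M t) \<le> 2 * (\<bar>t\<bar> ^ n * (\<integral>x. x ^ n \<partial>M2) / fact n)" for n
      using char_approx1[of n t, OF int] abs[OF p events_eq_borel, of n]
      by (simp add: A_def e norm_minus_commute)
    then have "\<forall>\<^sub>F n in sequentially. norm (A n - char M t) \<le> 2 * (\<bar>t\<bar> ^ n * (\<integral>x. x ^ n \<partial>M2) / fact n)"
      by simp
    then have "(\<lambda>n. A n - char M t) \<longlonglongrightarrow> 0"
      by (rule Lim_null_comparison) (use tendsto_mult_right_zero[OF small] in blast)
    then show ?thesis by (simp add: LIM_zero_iff)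
  qed
  show "char M1 t = char M2 t"
    by (rule LIMSEQ_unique[OF lim[OF M1 int1 eq pos(1)] lim[OF M2 int2 refl pos(2)]])
qed

section \<open>Stable densities and Mittag-Leffler laws\<close>

lemma Gamma_real_plus1:
  assumes "0 < (x::real)"
  shows "Gamma (x + 1) = x * Gamma x"
proof -
  have "x \<notin> \<int>\<^sub>\<le>\<^sub>0" using assms nonpos_Ints_nonpos[of x] by force
  then show ?thesis by (rule Gamma_plus1)
qed

section \<open>Change of variables on the half-line and Gamma integrals\<close>

lemma nn_integral_incseq_UN:
  assumes [measurable]: "H \<in> borel_measurable M" "\<And>i. A i \<in> sets M" and "incseq A"
  shows "(\<integral>\<^sup>+x. H x * indicator (\<Union>i. A i) x \<partial>M) = (SUP i::nat. \<integral>\<^sup>+x. H x * indicator (A i) x \<partial>M)"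
proof -
  have "(\<integral>\<^sup>+x. H x * indicator (\<Union>i. A i) x \<partial>M) = emeasure (density M H) (\<Union>i. A i)"
    by (subst emeasure_density) auto
  also have "\<dots> = (SUP i. emeasure (density M H) (A i))"
    using assms by (intro SUP_emeasure_incseq[symmetric]) auto
  finally show ?thesis by (simp add: emeasure_density)
qed

lemma nn_integral_exp_subst:
  fixes H :: "real \<Rightarrow> ennreal"
  assumes [measurable]: "H \<in> borel_measurable borel"
  shows "(\<integral>\<^sup>+s. H s * indicator {0<..} s \<partial>lborel) = (\<integral>\<^sup>+x. H (exp x) * ennreal (exp x) \<partial>lborel)"
proof -
  have U1: "(\<Union>n. {exp (- real n)..exp (real n)}) = {0<..}"
  proof (intro set_eqI iffI)
    fix s :: real assume "s \<in> {0<..}"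
    moreover obtain n where "\<bar>ln s\<bar> \<le> real n" using real_arch_simple by blast
    ultimately have "exp (- real n) \<le> s \<and> s \<le> exp (real n)"
      by (metis abs_le_iff exp_le_cancel_iff exp_ln greaterThan_iff minus_le_iff)
    then show "s \<in> (\<Union>n. {exp (- real n)..exp (real n)})" by auto
  qed (auto intro: less_le_trans[OF exp_gt_zero])
  have U2: "(\<Union>n. {- real n..real n}) = UNIV"
  proof (intro set_eqI iffI)
    fix s :: real assume "s \<in> UNIV"
    obtain n where "\<bar>s\<bar> \<le> real n" using real_arch_simple by blast
    then show "s \<in> (\<Union>n. {- real n..real n})" by (auto intro!: exI[of _ n])
  qed auto
  have "(\<integral>\<^sup>+s. H s * indicator {0<..} s \<partial>lborel) =
    (SUP n. \<integral>\<^sup>+s. H s * indicator {exp (- real n)..exp (real n)} s \<partial>lborel)"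
    unfolding U1[symmetric] by (intro nn_integral_incseq_UN) (auto simp: incseq_def)
  also have "\<dots> = (SUP n. \<integral>\<^sup>+x. (H (exp x) * ennreal (exp x)) * indicator {- real n..real n} x \<partial>lborel)"
  proof (intro SUP_cong refl)
    fix n :: nat
    show "(\<integral>\<^sup>+s. H s * indicator {exp (- real n)..exp (real n)} s \<partial>lborel) =
      (\<integral>\<^sup>+x. (H (exp x) * ennreal (exp x)) * indicator {- real n..real n} x \<partial>lborel)"
    \<comment> \<open>For \<open>n = 0\<close> both intervals shrink to a point and both integrals
      vanish; the substitution rule is applied to proper intervals.\<close>
    proof (cases "n = 0")
      case True
      have "(\<integral>\<^sup>+x. G x * indicator {c..c::real} x \<partial>lborel) = (\<integral>\<^sup>+x. 0 \<partial>(lborel :: real measure))" for G c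
        by (rule nn_integral_cong_AE) (use AE_lborel_singleton[of c] in \<open>auto elim!: eventually_mono simp: indicator_def\<close>)
      with True show ?thesis by simp
    next
      case False
      then show ?thesis
        by (intro nn_integral_substitution_aux) (auto intro!: derivative_eq_intros continuous_intros)
    qed
  qed
  also have "\<dots> = (\<integral>\<^sup>+x. (H (exp x) * ennreal (exp x)) * indicator (\<Union>n. {- real n..real n}) x \<partial>lborel)"
    by (intro nn_integral_incseq_UN[symmetric]) (auto simp: incseq_def)
  finally show ?thesis by (simp add: U2)
qed

text \<open>In the coordinate \<open>ln s\<close> the power map is linear, so one affine
  substitution serves both signs of \<open>k\<close>. The negative sign is the one that carries a
  Mittag-Leffler law back to the stable density.\<close>

lemma nn_integral_powr_subst:
  fixes H :: "real \<Rightarrow> ennreal"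
  assumes [measurable]: "H \<in> borel_measurable borel" and k: "k \<noteq> 0"
  shows "(\<integral>\<^sup>+s. H s * indicator {0<..} s \<partial>lborel) =
    ennreal \<bar>k\<bar> * (\<integral>\<^sup>+w. H (w powr k) * ennreal (w powr (k - 1)) * indicator {0<..} w \<partial>lborel)"
proof -
  have "(\<integral>\<^sup>+s. H s * indicator {0<..} s \<partial>lborel) = (\<integral>\<^sup>+x. H (exp x) * ennreal (exp x) \<partial>lborel)"
    by (rule nn_integral_exp_subst) simp
  also have "\<dots> = ennreal \<bar>k\<bar> * (\<integral>\<^sup>+x. H (exp (0 + k * x)) * ennreal (exp (0 + k * x)) \<partial>lborel)"
    by (rule nn_integral_real_affine) (use k in auto)
  also have "(\<integral>\<^sup>+x. H (exp (0 + k * x)) * ennreal (exp (0 + k * x)) \<partial>lborel) =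
    (\<integral>\<^sup>+x. (H (exp x powr k) * ennreal (exp x powr (k - 1))) * ennreal (exp x) \<partial>lborel)"
  proof (intro nn_integral_cong)
    fix x :: real
    have "ennreal (exp (k * x)) = ennreal (exp ((k - 1) * x)) * ennreal (exp x)"
      by (simp add: ennreal_mult'[symmetric] exp_add[symmetric] algebra_simps)
    then show "H (exp (0 + k * x)) * ennreal (exp (0 + k * x)) =
      (H (exp x powr k) * ennreal (exp x powr (k - 1))) * ennreal (exp x)"
      by (simp add: powr_def mult.assoc)
  qed
  also have "\<dots> = (\<integral>\<^sup>+w. H (w powr k) * ennreal (w powr (k - 1)) * indicator {0<..} w \<partial>lborel)"
    by (rule nn_integral_exp_subst[symmetric]) simp
  finally show ?thesis .
qed

lemma nn_integral_scale_subst: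
  fixes H :: "real \<Rightarrow> ennreal"
  assumes [measurable]: "H \<in> borel_measurable borel" and c: "0 < c"
  shows "(\<integral>\<^sup>+s. H s * indicator {0<..} s \<partial>lborel) = ennreal c * (\<integral>\<^sup>+w. H (c * w) * indicator {0<..} w \<partial>lborel)"
proof -
  have "(\<integral>\<^sup>+s. H s * indicator {0<..} s \<partial>lborel) =
    ennreal \<bar>c\<bar> * (\<integral>\<^sup>+w. H (0 + c * w) * indicator {0<..} (0 + c * w) \<partial>lborel)"
    by (rule nn_integral_real_affine) (use c in auto)
  also have "(\<integral>\<^sup>+w. H (0 + c * w) * indicator {0<..} (0 + c * w) \<partial>lborel) =
    (\<integral>\<^sup>+w. H (c * w) * indicator {0<..} w \<partial>lborel)"
    using c by (intro nn_integral_cong) (simp add: indicator_def zero_less_mult_iff)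
  finally show ?thesis using c by simp
qed

lemma nn_integral_Gamma_scaled:
  assumes a: "0 < a" and c: "0 < (c::real)"
  shows "(\<integral>\<^sup>+t. ennreal (t powr (a - 1) * exp (- c * t)) * indicator {0<..} t \<partial>lborel) = ennreal (Gamma a * c powr (- a))"
    (is "?I c = _")
proof -
  have 1: "?I 1 = ennreal (Gamma a)"
    unfolding Gamma_conv_nn_integral_real[OF a]
    using AE_lborel_singleton[of 0]
    by (intro nn_integral_cong_AE) (auto elim!: eventually_mono simp: indicator_def exp_minus field_simps)
  have "?I 1 = ennreal c * (\<integral>\<^sup>+t. ennreal ((c * t) powr (a - 1) * exp (- 1 * (c * t))) * indicator {0<..} t \<partial>lborel)"
    by (rule nn_integral_scale_subst) (use c in auto)
  also have "\<dots> = (\<integral>\<^sup>+t. ennreal c * (ennreal ((c * t) powr (a - 1) * exp (- 1 * (c * t))) * indicator {0<..} t) \<partial>lborel)"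
    by (rule nn_integral_cmult[symmetric]) simp
  also have "\<dots> = (\<integral>\<^sup>+t. ennreal (c powr a) * (ennreal (t powr (a - 1) * exp (- c * t)) * indicator {0<..} t) \<partial>lborel)"
    using c by (intro nn_integral_cong)
      (auto simp: ennreal_mult'[symmetric] indicator_def powr_mult powr_diff field_simps)
  also have "\<dots> = ennreal (c powr a) * ?I c"
    by (rule nn_integral_cmult) simp
  finally have "ennreal (c powr (- a)) * ennreal (Gamma a) = ennreal (c powr (- a)) * (ennreal (c powr a) * ?I c)"
    using 1 by simp
  also have "\<dots> = ?I c"
    using c by (simp add: mult.assoc[symmetric] ennreal_mult'[symmetric] powr_add[symmetric])
  finally show ?thesis using a by (simp add: ennreal_mult'[symmetric] mult.commute)
qed

text \<open>The substitution \<open>t = w powr a\<close> produces a Gamma integral. It evaluates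
  what the Laplace transform of a stable density leaves behind.\<close>

lemma nn_integral_Weibull:
  assumes q: "0 < q" and a: "0 < a" and c: "0 < (c::real)"
  shows "(\<integral>\<^sup>+w. ennreal (w powr (q - 1) * exp (- c * w powr a)) * indicator {0<..} w \<partial>lborel) =
    ennreal (Gamma (q / a) * c powr (- (q / a)) / a)" (is "?I = _")
proof -
  have "ennreal (Gamma (q / a) * c powr (- (q / a))) =
    (\<integral>\<^sup>+t. ennreal (t powr (q / a - 1) * exp (- c * t)) * indicator {0<..} t \<partial>lborel)"
    using assms by (intro nn_integral_Gamma_scaled[symmetric]) auto
  also have "\<dots> = ennreal \<bar>a\<bar> * (\<integral>\<^sup>+w. ennreal ((w powr a) powr (q / a - 1) * exp (- c * w powr a))
      * ennreal (w powr (a - 1)) * indicator {0<..} w \<partial>lborel)"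
    by (rule nn_integral_powr_subst[of "\<lambda>t. ennreal (t powr (q / a - 1) * exp (- c * t))"]) (use a in auto)
  also have "(\<integral>\<^sup>+w. ennreal ((w powr a) powr (q / a - 1) * exp (- c * w powr a))
      * ennreal (w powr (a - 1)) * indicator {0<..} w \<partial>lborel) = ?I"
  proof (intro nn_integral_cong)
    fix w :: real
    have "(w powr a) powr (q / a - 1) * w powr (a - 1) = w powr (q - 1)"
      using a by (simp add: powr_powr powr_add[symmetric] algebra_simps)
    then show "ennreal ((w powr a) powr (q / a - 1) * exp (- c * w powr a)) * ennreal (w powr (a - 1))
        * indicator {0<..} w = ennreal (w powr (q - 1) * exp (- c * w powr a)) * indicator {0<..} w"
      by (simp add: ennreal_mult'[symmetric] indicator_def mult_ac)
  qed
  finally have "ennreal (1 / a) * ennreal (Gamma (q / a) * c powr (- (q / a))) = ennreal (1 / a) * (ennreal \<bar>a\<bar> * ?I)"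
    by simp
  also have "\<dots> = ?I"
    using a by (simp add: mult.assoc[symmetric] ennreal_mult'[symmetric])
  finally show ?thesis using a by (simp add: ennreal_mult'[symmetric])
qed

text \<open>The moment of order \<open>n\<close> of \<open>ML (\<alpha>, \<theta>)\<close>: the
  quotient of the negative moments of orders \<open>\<theta> + real n * \<alpha>\<close> and
  \<open>\<theta>\<close> of the stable variable, with one quotient of Gamma values written as a
  Pochhammer symbol. At \<open>\<theta> = - \<beta>\<close> it serves as a plain number, without any
  law attached to it.\<close>

definition ml_moment :: "real \<Rightarrow> real \<Rightarrow> nat \<Rightarrow> real" where
  "ml_moment \<alpha> \<theta> n = pochhammer (\<theta> / \<alpha> + 1) n * Gamma (\<theta> + 1) / Gamma (\<theta> + real n * \<alpha> + 1)"

lemma ml_moment_0: "- 1 < \<theta> \<Longrightarrow> ml_moment \<alpha> \<theta> 0 = 1"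
  using Gamma_real_pos[of "\<theta> + 1"] by (auto simp: ml_moment_def Gamma_eq_zero_iff)

lemma ml_moment_pos:
  assumes "0 < \<alpha>" "- \<alpha> < \<theta>" "- 1 < \<theta>"
  shows "0 < ml_moment \<alpha> \<theta> n"
proof -
  have "0 < \<theta> / \<alpha> + 1" using assms by (simp add: field_simps)
  moreover have "0 < Gamma (\<theta> + real n * \<alpha> + 1)"
  proof (rule Gamma_real_pos)
    have "0 \<le> real n * \<alpha>" using assms by simp
    then show "0 < \<theta> + real n * \<alpha> + 1" using assms by linarith
  qed
  moreover have "0 < Gamma (\<theta> + 1)" using assms by (intro Gamma_real_pos) simp
  ultimately show ?thesis
    unfolding ml_moment_def by (intro divide_pos_pos mult_pos_pos pochhammer_pos)
qed

text \<open>Log-convexity of Gamma along \<open>x - 1 < x < x + a\<close>, combined with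
  \<open>Gamma x = (x - 1) * Gamma (x - 1)\<close>.\<close>

lemma Gamma_ratio_bound:
  assumes a: "0 < a" and x: "1 < (x::real)"
  shows "Gamma x / Gamma (x + a) \<le> (x - 1) powr (- a)"
proof -
  \<comment> \<open>The weight for which \<open>x\<close> is the convex combination of
    \<open>x - 1\<close> and \<open>x + a\<close>.\<close>
  define t where "t = 1 / (1 + a)"
  have t: "0 \<le> t" "t \<le> 1" using a by (auto simp: t_def)
  have gp: "0 < Gamma x" "0 < Gamma (x + a)" using x a by (auto intro!: Gamma_real_pos)
  have "(ln \<circ> Gamma) ((1 - t) *\<^sub>R (x - 1) + t *\<^sub>R (x + a)) \<le> (1 - t) * (ln \<circ> Gamma) (x - 1) + t * (ln \<circ> Gamma) (x + a)"
    using a x t by (intro convex_onD[OF log_convex_Gamma_real]) auto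
  also have "(1 - t) *\<^sub>R (x - 1) + t *\<^sub>R (x + a) = x"
  proof -
    have "(1 + a) * t = 1" using a by (simp add: t_def)
    then show ?thesis by (simp add: algebra_simps)
  qed
  finally have "ln (Gamma x) \<le> (1 - t) * ln (Gamma (x - 1)) + t * ln (Gamma (x + a))" by simp
  moreover have x1: "0 < x - 1" using x by simp
  have "Gamma x = (x - 1) * Gamma (x - 1)"
    using Gamma_real_plus1[of "x - 1"] x by simp
  then have "ln (Gamma (x - 1)) = ln (Gamma x) - ln (x - 1)"
    using x Gamma_real_pos[OF x1] by (simp add: ln_mult_pos)
  ultimately have "(1 + a) * ln (Gamma x) \<le> (1 + a) * ((1 - t) * (ln (Gamma x) - ln (x - 1)) + t * ln (Gamma (x + a)))"
    using a by (intro mult_left_mono) auto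
  also have "\<dots> = a * (ln (Gamma x) - ln (x - 1)) + ln (Gamma (x + a))"
  proof -
    have t1: "(1 + a) * (1 - t) = a" "(1 + a) * t = 1" using a by (simp_all add: t_def field_simps)
    show ?thesis by (simp only: distrib_left mult.assoc[symmetric] t1 mult_1)
  qed
  finally have "ln (Gamma x) - ln (Gamma (x + a)) \<le> - a * ln (x - 1)"
    by (simp add: algebra_simps)
  then have "ln (Gamma x / Gamma (x + a)) \<le> - a * ln (x - 1)"
    using gp by (simp add: ln_divide_pos)
  then have "exp (ln (Gamma x / Gamma (x + a))) \<le> exp (- a * ln (x - 1))" by simp
  then show ?thesis
    using x gp by (simp add: powr_def)
qed

text \<open>The Pochhammer symbol grows like the factorial below it, while the remaining Gamma value
  grows faster than any geometric sequence. The ratio test makes this precise: consecutive terms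
  have a ratio tending to 0.\<close>

lemma ml_moment_exp_small:
  assumes a: "0 < \<alpha>" "\<alpha> < 1" and \<theta>: "0 < \<theta>"
  shows "(\<lambda>n. t ^ n * ml_moment \<alpha> \<theta> n / fact n) \<longlonglongrightarrow> 0"
proof -
  let ?x = "\<lambda>n. t ^ n * ml_moment \<alpha> \<theta> n / fact n"
  have Gp: "0 < Gamma (\<theta> + real n * \<alpha> + 1)" for n
    using a \<theta> by (intro Gamma_real_pos) (simp add: add_pos_nonneg)
  \<comment> \<open>An upper bound for the ratio of consecutive terms: the quotient from the
    Pochhammer symbol and the factorial tends to 1, and the last factor, from
    \<open>Gamma_ratio_bound\<close>, tends to 0.\<close>
  define r where "r n = \<bar>t\<bar> * ((\<theta> / \<alpha> + 1 + real n) / real (Suc n)) * (\<theta> + real n * \<alpha>) powr (- \<alpha>)" for n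
  have step: "norm (?x (Suc n)) \<le> r n * norm (?x n)" for n
  proof -
    have shift: "Gamma (\<theta> + real (Suc n) * \<alpha> + 1) = Gamma (\<theta> + real n * \<alpha> + 1 + \<alpha>)"
      by (simp add: algebra_simps)
    have m: "ml_moment \<alpha> \<theta> (Suc n) = ml_moment \<alpha> \<theta> n * (\<theta> / \<alpha> + 1 + real n) *
      (Gamma (\<theta> + real n * \<alpha> + 1) / Gamma (\<theta> + real n * \<alpha> + 1 + \<alpha>))"
      unfolding ml_moment_def shift using Gp[of n] by (simp add: pochhammer_Suc)
    have "Gamma (\<theta> + real n * \<alpha> + 1) / Gamma (\<theta> + real n * \<alpha> + 1 + \<alpha>) \<le> (\<theta> + real n * \<alpha> + 1 - 1) powr (- \<alpha>)"
      using a \<theta> by (intro Gamma_ratio_bound) (auto simp: add_pos_nonneg)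
    then have "ml_moment \<alpha> \<theta> (Suc n) \<le> ml_moment \<alpha> \<theta> n * (\<theta> / \<alpha> + 1 + real n) * (\<theta> + real n * \<alpha>) powr (- \<alpha>)"
      unfolding m using ml_moment_pos[of \<alpha> \<theta> n] a \<theta>
      by (intro mult_left_mono mult_nonneg_nonneg) (auto simp: field_simps)
    then have "norm (?x (Suc n)) \<le> \<bar>t\<bar> ^ Suc n * (ml_moment \<alpha> \<theta> n * (\<theta> / \<alpha> + 1 + real n) * (\<theta> + real n * \<alpha>) powr (- \<alpha>)) / fact (Suc n)"
      using ml_moment_pos[of \<alpha> \<theta> "Suc n"] a \<theta>
      by (simp add: abs_mult power_abs divide_right_mono mult_left_mono del: fact_Suc power_Suc)
    also have "\<dots> = r n * norm (?x n)"
      using ml_moment_pos[of \<alpha> \<theta> n] a \<theta> by (simp add: r_def abs_mult power_abs field_simps)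
    finally show ?thesis .
  qed
  have "filterlim (\<lambda>n. \<theta> + real n * \<alpha>) at_top sequentially"
    using a by (intro filterlim_tendsto_add_at_top[OF tendsto_const]
      filterlim_at_top_mult_tendsto_pos[OF tendsto_const] filterlim_real_sequentially)
  then have "(\<lambda>n. (\<theta> + real n * \<alpha>) powr (- \<alpha>)) \<longlonglongrightarrow> 0"
    using a by (intro tendsto_neg_powr) auto
  moreover have "(\<lambda>n. (\<theta> / \<alpha> + 1 + real n) / real (Suc n)) \<longlonglongrightarrow> 1"
    by real_asymp
  ultimately have "r \<longlonglongrightarrow> \<bar>t\<bar> * 1 * 0"
    unfolding r_def by (intro tendsto_intros)
  then have "\<forall>\<^sub>F n in sequentially. r n < 1 / 2"
    by (intro order_tendstoD) auto
  then obtain N where N: "\<And>n. N \<le> n \<Longrightarrow> r n < 1 / 2"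
    by (auto simp: eventually_sequentially)
  have "norm (?x (Suc n)) \<le> (1 / 2) * norm (?x n)" if "N \<le> n" for n
    using step[of n] N[OF that] by (meson less_imp_le mult_right_mono norm_ge_zero order_trans)
  then have "summable ?x"
    by (intro summable_ratio_test[where c = "1 / 2" and N = N]) auto
  then show ?thesis by (rule summable_LIMSEQ_zero)
qed

lemma sets_mittag_leffler [simp, measurable_cong]: "sets (mittag_leffler_law f \<alpha> \<theta>) = sets borel"
  and space_mittag_leffler [simp]: "space (mittag_leffler_law f \<alpha> \<theta>) = UNIV"
  by (simp_all add: mittag_leffler_law_def)

section \<open>Integrals against a stable density\<close>

context
  fixes \<alpha> :: real and f :: "real \<Rightarrow> real"
  assumes \<alpha>: "0 < \<alpha>" "\<alpha> < 1" and f: "stable_density \<alpha> f"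
begin

lemma stable_density_measurable: "f \<in> borel_measurable borel"
  and stable_density_nonneg: "0 \<le> f t"
  and stable_density_nonpos: "t \<le> 0 \<Longrightarrow> f t = 0"
  using f by (auto simp: stable_density_def)

lemma stable_density_Laplace:
  assumes "0 \<le> u"
  shows "(\<integral>\<^sup>+t. ennreal (exp (- u * t) * f t) * indicator {0<..} t \<partial>lborel) = ennreal (exp (- (u powr \<alpha>)))"
proof -
  note stable_density_measurable [measurable]
  have eq: "(\<integral>t. exp (- u * t) * f t \<partial>lborel) = exp (- (u powr \<alpha>))"
    using f assms by (simp add: stable_density_def)
  \<comment> \<open>A non-integrable function has integral 0 by convention, and the prescribed value
    is never 0; so the Laplace identity itself yields integrability.\<close>
  then have "integrable lborel (\<lambda>t. exp (- u * t) * f t)"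
    using not_integrable_integral_eq[of lborel "\<lambda>t. exp (- u * t) * f t"] by (metis exp_not_eq_zero)
  then have "(\<integral>\<^sup>+t. ennreal (exp (- u * t) * f t) \<partial>lborel) = ennreal (exp (- (u powr \<alpha>)))"
    using stable_density_nonneg by (subst nn_integral_eq_integral) (simp_all only: eq, simp_all)
  moreover have "(\<integral>\<^sup>+t. ennreal (exp (- u * t) * f t) * indicator {0<..} t \<partial>lborel) =
    (\<integral>\<^sup>+t. ennreal (exp (- u * t) * f t) \<partial>lborel)"
    using stable_density_nonpos by (intro nn_integral_cong) (auto simp: indicator_def not_less)
  ultimately show ?thesis by simp
qed

text \<open>Substituting \<open>y = t * w\<close> turns
  \<open>y powr \<alpha> * t powr (- \<alpha>)\<close> into \<open>w powr \<alpha>\<close>, and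
  \<open>t powr (- q)\<close> absorbs all powers of \<open>t\<close> that arise. After exchanging
  the integrals, the one over \<open>t\<close> is the Laplace transform
  \<open>exp (- (w powr \<alpha>))\<close>, and a Weibull integral with rate
  \<open>1 + \<mu>\<close> remains. Thus a single computation gives the negative moments
  (\<open>\<mu> = 0\<close>) and the Gamma mixture of the Mittag-Leffler laws.\<close>

lemma stable_density_Gamma_mix:
  assumes q: "0 < q" and l: "0 \<le> \<mu>"
  shows "(\<integral>\<^sup>+t. ennreal (t powr (- q) * f t) * indicator {0<..} t *
     (\<integral>\<^sup>+y. ennreal (y powr (q - 1) * exp (- y) * exp (- \<mu> * (y powr \<alpha> * t powr (- \<alpha>)))) * indicator {0<..} y \<partial>lborel) \<partial>lborel) =
    ennreal (Gamma (q / \<alpha>) * (1 + \<mu>) powr (- (q / \<alpha>)) / \<alpha>)"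
proof -
  note stable_density_measurable [measurable]
  let ?W = "\<lambda>w. ennreal (w powr (q - 1) * exp (- \<mu> * w powr \<alpha>)) * indicator {0<..} w"
  have inner: "ennreal (t powr (- q) * f t) * indicator {0<..} t *
     (\<integral>\<^sup>+y. ennreal (y powr (q - 1) * exp (- y) * exp (- \<mu> * (y powr \<alpha> * t powr (- \<alpha>)))) * indicator {0<..} y \<partial>lborel)
    = (\<integral>\<^sup>+w. ?W w * (ennreal (exp (- w * t) * f t) * indicator {0<..} t) \<partial>lborel)" (is "?l = ?r") for t
  proof (cases "0 < t")
    case True
    have "(\<integral>\<^sup>+y. ennreal (y powr (q - 1) * exp (- y) * exp (- \<mu> * (y powr \<alpha> * t powr (- \<alpha>)))) * indicator {0<..} y \<partial>lborel)
      = ennreal t * (\<integral>\<^sup>+w. ennreal ((t * w) powr (q - 1) * exp (- (t * w)) * exp (- \<mu> * ((t * w) powr \<alpha> * t powr (- \<alpha>)))) * indicator {0<..} w \<partial>lborel)"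
      by (rule nn_integral_scale_subst[of "\<lambda>y. ennreal (y powr (q - 1) * exp (- y) * exp (- \<mu> * (y powr \<alpha> * t powr (- \<alpha>))))"]) (use True in auto)
    then have "?l = ennreal (t powr (- q) * f t) * (ennreal t * (\<integral>\<^sup>+w. ennreal ((t * w) powr (q - 1) * exp (- (t * w)) * exp (- \<mu> * ((t * w) powr \<alpha> * t powr (- \<alpha>)))) * indicator {0<..} w \<partial>lborel))"
      using True by simp
    also have "\<dots> = (\<integral>\<^sup>+w. ennreal (t powr (- q) * f t) * (ennreal t * (ennreal ((t * w) powr (q - 1) * exp (- (t * w)) * exp (- \<mu> * ((t * w) powr \<alpha> * t powr (- \<alpha>)))) * indicator {0<..} w)) \<partial>lborel)"
      by (simp add: nn_integral_cmult)
    also have "\<dots> = ?r"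
    proof (intro nn_integral_cong)
      fix w :: real
      show "ennreal (t powr (- q) * f t) * (ennreal t * (ennreal ((t * w) powr (q - 1) * exp (- (t * w)) * exp (- \<mu> * ((t * w) powr \<alpha> * t powr (- \<alpha>)))) * indicator {0<..} w))
        = ?W w * (ennreal (exp (- w * t) * f t) * indicator {0<..} t)"
      proof (cases "0 < w")
        case w: True
        have 1: "(t * w) powr \<alpha> * t powr (- \<alpha>) = w powr \<alpha>"
          using True w by (simp add: powr_mult powr_minus)
        have 2: "t powr (- q) * (t * (t * w) powr (q - 1)) = w powr (q - 1)"
          using True w by (simp add: powr_mult powr_minus powr_diff field_simps)
        have "t powr (- q) * f t * (t * ((t * w) powr (q - 1) * exp (- (t * w)) * exp (- \<mu> * w powr \<alpha>))) =
          (t powr (- q) * (t * (t * w) powr (q - 1))) * exp (- \<mu> * w powr \<alpha>) * (exp (- w * t) * f t)"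
          by (simp add: mult_ac)
        then show ?thesis
          using True w stable_density_nonneg[of t] unfolding 1 2
          by (simp add: ennreal_mult'[symmetric] ennreal_mult''[symmetric] mult_ac)
      qed simp
    qed
    finally show ?thesis .
  qed simp
  have "(\<integral>\<^sup>+t. \<integral>\<^sup>+w. ?W w * (ennreal (exp (- w * t) * f t) * indicator {0<..} t) \<partial>lborel \<partial>lborel) =
    (\<integral>\<^sup>+w. \<integral>\<^sup>+t. ?W w * (ennreal (exp (- w * t) * f t) * indicator {0<..} t) \<partial>lborel \<partial>lborel)"
    by (rule lborel_pair.Fubini') simp
  also have "\<dots> = (\<integral>\<^sup>+w. ?W w * ennreal (exp (- (w powr \<alpha>))) \<partial>lborel)"
  proof (intro nn_integral_cong)
    fix w :: real
    have "(\<integral>\<^sup>+t. ?W w * (ennreal (exp (- w * t) * f t) * indicator {0<..} t) \<partial>lborel) =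
      ?W w * (\<integral>\<^sup>+t. ennreal (exp (- w * t) * f t) * indicator {0<..} t \<partial>lborel)"
      by (rule nn_integral_cmult) simp
    then show "(\<integral>\<^sup>+t. ?W w * (ennreal (exp (- w * t) * f t) * indicator {0<..} t) \<partial>lborel) =
      ?W w * ennreal (exp (- (w powr \<alpha>)))"
      using stable_density_Laplace[of w] by (cases "0 < w") simp_all
  qed
  also have "\<dots> = (\<integral>\<^sup>+w. ennreal (w powr (q - 1) * exp (- (1 + \<mu>) * w powr \<alpha>)) * indicator {0<..} w \<partial>lborel)"
    by (intro nn_integral_cong)
      (simp add: ennreal_mult'[symmetric] exp_add[symmetric] indicator_def algebra_simps)
  also have "\<dots> = ennreal (Gamma (q / \<alpha>) * (1 + \<mu>) powr (- (q / \<alpha>)) / \<alpha>)"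
    using q l \<alpha> by (intro nn_integral_Weibull) auto
  finally show ?thesis by (simp only: inner)
qed

text \<open>For \<open>\<mu> = 0\<close> the inner integral of
  \<open>stable_density_Gamma_mix\<close> is the constant \<open>Gamma q\<close>, which is divided
  out.\<close>

lemma stable_density_neg_moment:
  assumes q: "0 < q"
  shows "(\<integral>\<^sup>+t. ennreal (t powr (- q) * f t) * indicator {0<..} t \<partial>lborel) = ennreal (Gamma (q / \<alpha> + 1) / Gamma (q + 1))"
proof -
  note stable_density_measurable [measurable]
  have Gq: "0 < Gamma q" using q by (rule Gamma_real_pos)
  have "(\<integral>\<^sup>+t. ennreal (t powr (- q) * f t) * indicator {0<..} t \<partial>lborel) * ennreal (Gamma q) =
     ennreal (Gamma (q / \<alpha>) / \<alpha>)"
    using stable_density_Gamma_mix[OF q, of 0] nn_integral_Gamma_scaled[OF q, of 1]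
    by (simp add: nn_integral_multc)
  then have "(\<integral>\<^sup>+t. ennreal (t powr (- q) * f t) * indicator {0<..} t \<partial>lborel) * ennreal (Gamma q) * ennreal (1 / Gamma q) =
     ennreal (Gamma (q / \<alpha>) / \<alpha>) * ennreal (1 / Gamma q)"
    by simp
  then have "(\<integral>\<^sup>+t. ennreal (t powr (- q) * f t) * indicator {0<..} t \<partial>lborel) = ennreal (Gamma (q / \<alpha>) / \<alpha> / Gamma q)"
    using Gq \<alpha> Gamma_real_pos[of "q / \<alpha>"] q
    by (simp add: mult.assoc ennreal_mult'[symmetric] ennreal_mult''[symmetric])
  also have "Gamma (q / \<alpha>) / \<alpha> / Gamma q = Gamma (q / \<alpha> + 1) / Gamma (q + 1)"
    using q \<alpha> Gq by (simp add: Gamma_real_plus1)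
  finally show ?thesis .
qed

lemma integral_stable_density_neg_moment:
  assumes q: "0 < q"
  shows "(\<integral>t. t powr (- q) * f t \<partial>lborel) = Gamma (q / \<alpha> + 1) / Gamma (q + 1)"
proof -
  note stable_density_measurable [measurable]
  have "(\<integral>\<^sup>+t. ennreal (t powr (- q) * f t) \<partial>lborel) =
    (\<integral>\<^sup>+t. ennreal (t powr (- q) * f t) * indicator {0<..} t \<partial>lborel)"
    using stable_density_nonpos by (intro nn_integral_cong) (auto simp: indicator_def not_less)
  also note stable_density_neg_moment[OF q]
  finally show ?thesis
    using \<alpha> q stable_density_nonneg
    by (subst integral_eq_nn_integral) (auto simp: add_pos_pos intro!: divide_nonneg_nonneg less_imp_le[OF Gamma_real_pos])
qed

section \<open>Mittag-Leffler laws with positive parameter\<close>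

context
  fixes \<theta> :: real
  assumes \<theta>: "0 < \<theta>"
begin

text \<open>The substitution \<open>s = t powr (- \<alpha>)\<close> undoes \<open>g_density\<close>:
  the law is the image under this map of the stable density reweighted by
  \<open>t powr (- \<theta>)\<close>.\<close>

lemma nn_integral_mittag_leffler:
  assumes [measurable]: "h \<in> borel_measurable borel"
  shows "(\<integral>\<^sup>+s. h s \<partial>mittag_leffler_law f \<alpha> \<theta>) = ennreal (Gamma (\<theta> + 1) / Gamma (\<theta> / \<alpha> + 1)) *
    (\<integral>\<^sup>+t. ennreal (t powr (- \<theta>) * f t) * indicator {0<..} t * h (t powr (- \<alpha>)) \<partial>lborel)"
proof -
  note stable_density_measurable [measurable]
  define c where "c = Gamma (\<theta> / \<alpha> + 1) / Gamma (\<theta> + 1)"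
  have c: "0 < c" using \<theta> \<alpha> by (auto simp: c_def intro!: divide_pos_pos Gamma_real_pos add_pos_pos)
  have ceq: "(\<integral>t. t powr (- \<theta>) * f t \<partial>lborel) = c"
    unfolding c_def by (rule integral_stable_density_neg_moment[OF \<theta>])
  define G where "G s = ennreal (s powr (\<theta> / \<alpha>) * g_density f \<alpha> s / c) * h s" for s
  have [measurable]: "G \<in> borel_measurable borel" unfolding G_def g_density_def by measurable
  have [measurable]: "(\<lambda>s. if 0 < s then s powr (\<theta> / \<alpha>) * g_density f \<alpha> s / (\<integral>t. t powr (- \<theta>) * f t \<partial>lborel) else 0)
    \<in> borel_measurable borel"
    unfolding g_density_def by measurable
  have "(\<integral>\<^sup>+s. h s \<partial>mittag_leffler_law f \<alpha> \<theta>) = (\<integral>\<^sup>+s. G s * indicator {0<..} s \<partial>lborel)"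
    unfolding mittag_leffler_law_def
    by (subst nn_integral_density) (auto intro!: nn_integral_cong simp: G_def indicator_def ceq)
  also have "\<dots> = ennreal \<bar>- \<alpha>\<bar> * (\<integral>\<^sup>+w. G (w powr (- \<alpha>)) * ennreal (w powr (- \<alpha> - 1)) * indicator {0<..} w \<partial>lborel)"
    by (rule nn_integral_powr_subst) (use \<alpha> in auto)
  also have "\<dots> = (\<integral>\<^sup>+w. ennreal \<alpha> * (G (w powr (- \<alpha>)) * ennreal (w powr (- \<alpha> - 1)) * indicator {0<..} w) \<partial>lborel)"
    using \<alpha> by (simp add: nn_integral_cmult)
  also have "\<dots> = (\<integral>\<^sup>+t. ennreal (1 / c) * (ennreal (t powr (- \<theta>) * f t) * indicator {0<..} t * h (t powr (- \<alpha>))) \<partial>lborel)"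
  proof (intro nn_integral_cong)
    fix t :: real
    show "ennreal \<alpha> * (G (t powr (- \<alpha>)) * ennreal (t powr (- \<alpha> - 1)) * indicator {0<..} t) =
      ennreal (1 / c) * (ennreal (t powr (- \<theta>) * f t) * indicator {0<..} t * h (t powr (- \<alpha>)))"
    proof (cases "0 < t")
      case True
      have 1: "(t powr (- \<alpha>)) powr (\<theta> / \<alpha>) = t powr (- \<theta>)"
        using \<alpha> by (simp add: powr_powr)
      have 2: "g_density f \<alpha> (t powr (- \<alpha>)) = f t * t powr (1 + \<alpha>) / \<alpha>"
        using \<alpha> True by (simp add: g_density_def powr_powr algebra_simps)
      have "\<alpha> * (t powr (- \<theta>) * (f t * t powr (1 + \<alpha>) / \<alpha>) / c * t powr (- \<alpha> - 1)) =
        (t powr (1 + \<alpha>) * t powr (- \<alpha> - 1)) * (1 / c * (t powr (- \<theta>) * f t))"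
        using \<alpha> by (simp add: field_simps)
      also have "t powr (1 + \<alpha>) * t powr (- \<alpha> - 1) = 1"
        using True by (simp add: powr_add[symmetric])
      finally have 3: "\<alpha> * (t powr (- \<theta>) * (f t * t powr (1 + \<alpha>) / \<alpha>) / c * t powr (- \<alpha> - 1)) =
        1 / c * (t powr (- \<theta>) * f t)" by simp
      define A where "A = t powr (- \<theta>) * (f t * t powr (1 + \<alpha>) / \<alpha>) / c"
      have "0 \<le> A" using \<alpha> c stable_density_nonneg[of t] by (simp add: A_def)
      then have "ennreal \<alpha> * (G (t powr (- \<alpha>)) * ennreal (t powr (- \<alpha> - 1))) =
        ennreal (\<alpha> * (A * t powr (- \<alpha> - 1))) * h (t powr (- \<alpha>))"
        using \<alpha> unfolding G_def 1 2 A_def[symmetric] by (simp add: ennreal_mult mult_ac)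
      then show ?thesis
        using True c stable_density_nonneg[of t] unfolding A_def 3
        by (simp only: mult_1_right indicator_simps greaterThan_iff mult.assoc[symmetric] ennreal_mult'[symmetric])
          (simp add: ennreal_mult''[symmetric] mult_ac)
    qed simp
  qed
  also have "\<dots> = ennreal (1 / c) * (\<integral>\<^sup>+t. ennreal (t powr (- \<theta>) * f t) * indicator {0<..} t * h (t powr (- \<alpha>)) \<partial>lborel)"
    by (rule nn_integral_cmult) simp
  finally show ?thesis by (simp add: c_def)
qed

lemma mittag_leffler_moment: "(\<integral>\<^sup>+s. ennreal (s ^ n) \<partial>mittag_leffler_law f \<alpha> \<theta>) = ennreal (ml_moment \<alpha> \<theta> n)"
proof -
  note stable_density_measurable [measurable]
  have pos: "0 < \<theta> / \<alpha> + 1" using \<theta> \<alpha> by (simp add: add_pos_pos)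
  have q: "0 < \<theta> + real n * \<alpha>" using \<theta> \<alpha> by (simp add: add_pos_nonneg)
  have "(\<integral>\<^sup>+s. ennreal (s ^ n) \<partial>mittag_leffler_law f \<alpha> \<theta>) = ennreal (Gamma (\<theta> + 1) / Gamma (\<theta> / \<alpha> + 1)) *
    (\<integral>\<^sup>+t. ennreal (t powr (- \<theta>) * f t) * indicator {0<..} t * ennreal ((t powr (- \<alpha>)) ^ n) \<partial>lborel)"
    by (rule nn_integral_mittag_leffler) simp
  also have "(\<integral>\<^sup>+t. ennreal (t powr (- \<theta>) * f t) * indicator {0<..} t * ennreal ((t powr (- \<alpha>)) ^ n) \<partial>lborel) =
    (\<integral>\<^sup>+t. ennreal (t powr (- (\<theta> + real n * \<alpha>)) * f t) * indicator {0<..} t \<partial>lborel)"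
    by (intro nn_integral_cong)
      (auto simp: indicator_def ennreal_mult''[symmetric] powr_power powr_diff powr_minus field_simps)
  also have "\<dots> = ennreal (Gamma ((\<theta> + real n * \<alpha>) / \<alpha> + 1) / Gamma (\<theta> + real n * \<alpha> + 1))"
    by (rule stable_density_neg_moment[OF q])
  also have "(\<theta> + real n * \<alpha>) / \<alpha> + 1 = \<theta> / \<alpha> + 1 + real n"
    using \<alpha> by (simp add: field_simps)
  also have "Gamma (\<theta> / \<alpha> + 1 + real n) = pochhammer (\<theta> / \<alpha> + 1) n * Gamma (\<theta> / \<alpha> + 1)"
  proof -
    have "\<theta> / \<alpha> + 1 \<notin> \<int>\<^sub>\<le>\<^sub>0" using nonpos_Ints_nonpos[of "\<theta> / \<alpha> + 1"] pos by force
    then show ?thesis by (simp add: pochhammer_Gamma Gamma_eq_zero_iff)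
  qed
  finally show ?thesis
    using \<theta> Gamma_real_pos[OF pos] Gamma_real_pos[of "\<theta> + 1"]
    by (auto simp: ennreal_mult'[symmetric] ml_moment_def mult_ac)
qed

lemma prob_space_mittag_leffler: "prob_space (mittag_leffler_law f \<alpha> \<theta>)"
  using mittag_leffler_moment[of 0] \<theta> by (intro prob_spaceI) (simp add: ml_moment_0)

lemma AE_mittag_leffler_pos: "AE s in mittag_leffler_law f \<alpha> \<theta>. 0 < s"
proof -
  note stable_density_measurable [measurable]
  have [measurable]: "(\<lambda>s. if 0 < s then s powr (\<theta> / \<alpha>) * g_density f \<alpha> s / (\<integral>t. t powr (- \<theta>) * f t \<partial>lborel) else 0)
    \<in> borel_measurable borel"
    unfolding g_density_def by measurable
  show ?thesis
    unfolding mittag_leffler_law_def by (subst AE_density) (auto intro!: AE_I2 split: if_splits)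
qed

text \<open>After division by \<open>Gamma \<theta>\<close> the right-hand side is the Laplace
  transform of a Gamma variable of shape \<open>\<theta> / \<alpha>\<close>: this is the law of
  \<open>Y powr \<alpha> * S\<close> for independent \<open>Y\<close> of Gamma shape
  \<open>\<theta>\<close> and \<open>S\<close> of law
  \<open>ML (\<alpha>, \<theta>)\<close>.\<close>

lemma mittag_leffler_Gamma_mix:
  assumes l: "0 \<le> \<mu>"
  shows "(\<integral>\<^sup>+s. \<integral>\<^sup>+y. ennreal (y powr (\<theta> - 1) * exp (- y) * exp (- \<mu> * (y powr \<alpha> * s))) * indicator {0<..} y
      \<partial>lborel \<partial>mittag_leffler_law f \<alpha> \<theta>) = ennreal (Gamma \<theta> * (1 + \<mu>) powr (- (\<theta> / \<alpha>)))"
proof -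
  note stable_density_measurable [measurable]
  have "0 < \<theta> / \<alpha>" using \<theta> \<alpha> by simp
  then have G: "Gamma (\<theta> + 1) = \<theta> * Gamma \<theta>" "Gamma (\<theta> / \<alpha> + 1) = \<theta> / \<alpha> * Gamma (\<theta> / \<alpha>)" "0 < Gamma (\<theta> / \<alpha>)" "0 < Gamma \<theta>"
    using \<theta> by (auto simp: Gamma_real_plus1 intro!: Gamma_real_pos)
  have "(\<integral>\<^sup>+s. \<integral>\<^sup>+y. ennreal (y powr (\<theta> - 1) * exp (- y) * exp (- \<mu> * (y powr \<alpha> * s))) * indicator {0<..} y
      \<partial>lborel \<partial>mittag_leffler_law f \<alpha> \<theta>) = ennreal (Gamma (\<theta> + 1) / Gamma (\<theta> / \<alpha> + 1)) *
      ennreal (Gamma (\<theta> / \<alpha>) * (1 + \<mu>) powr (- (\<theta> / \<alpha>)) / \<alpha>)"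
    by (subst nn_integral_mittag_leffler) (simp_all only: stable_density_Gamma_mix[OF \<theta> l], measurable)
  then show ?thesis
    using \<theta> \<alpha> G by (simp add: ennreal_mult'[symmetric])
qed

end

end

section \<open>Moments of weighted stick-breaking sums\<close>

text \<open>The beta-binomial law: the probability that exactly \<open>k\<close> of \<open>n\<close>
  samples fall into a stick of random length \<open>Beta (a, b)\<close>.\<close>

definition polya_weight :: "real \<Rightarrow> real \<Rightarrow> nat \<Rightarrow> nat \<Rightarrow> real" where
  "polya_weight a b n k = real (n choose k) * pochhammer a k * pochhammer b (n - k) / pochhammer (a + b) n"

lemma polya_weight_nonneg: "0 < a \<Longrightarrow> 0 < b \<Longrightarrow> 0 \<le> polya_weight a b n k"
  unfolding polya_weight_def by (intro divide_nonneg_nonneg mult_nonneg_nonneg less_imp_le[OF pochhammer_pos]) auto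

lemma sum_polya_weight:
  assumes "0 < a" "0 < b"
  shows "(\<Sum>k\<le>n. polya_weight a b n k) = 1"
  using pochhammer_pos[of "a + b" n] assms
  by (simp add: polya_weight_def sum_divide_distrib[symmetric] pochhammer_binomial_sum[symmetric])

text \<open>\<open>n - k\<close> counts the samples that miss the stick. Absorbing it into the
  binomial coefficient leaves another Vandermonde sum, with \<open>b\<close> raised by one.\<close>

lemma mean_polya_weight:
  assumes "0 < a" "0 < b"
  shows "(\<Sum>k\<le>n. polya_weight a b n k * real (n - k)) = real n * (b / (a + b))"
proof (cases n)
  case (Suc m)
  have "(\<Sum>k\<le>n. real (n choose k) * pochhammer a k * pochhammer b (n - k) * real (n - k)) =
    (\<Sum>k\<le>m. real (n choose k) * pochhammer a k * pochhammer b (n - k) * real (n - k))"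
    by (simp add: Suc)
  also have "\<dots> = (\<Sum>k\<le>m. real n * b * (real (m choose k) * pochhammer a k * pochhammer (b + 1) (m - k)))"
  proof (intro sum.cong refl)
    fix k assume "k \<in> {..m}"
    then have k: "n - k = Suc (m - k)" "k \<le> m" by (auto simp: Suc)
    have "(n - k) * (n choose k) = n * (m choose k)"
      using binomial_absorb_comp[of n k] by (simp add: Suc)
    then have "real (n choose k) * real (n - k) = real n * real (m choose k)"
      by (metis mult.commute of_nat_mult)
    moreover have "pochhammer b (n - k) = b * pochhammer (b + 1) (m - k)"
      unfolding k by (simp add: pochhammer_rec)
    ultimately show "real (n choose k) * pochhammer a k * pochhammer b (n - k) * real (n - k) =
      real n * b * (real (m choose k) * pochhammer a k * pochhammer (b + 1) (m - k))"
      by (simp add: mult_ac)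
  qed
  also have "\<dots> = real n * b * pochhammer (a + (b + 1)) m"
    by (simp add: sum_distrib_left[symmetric] pochhammer_binomial_sum)
  finally have "(\<Sum>k\<le>n. polya_weight a b n k * real (n - k)) =
    real n * b * pochhammer (a + b + 1) m / pochhammer (a + b) n"
    by (simp add: polya_weight_def sum_divide_distrib[symmetric] add.assoc)
  then show ?thesis
    using assms pochhammer_pos[of "a + b + 1" m] by (simp add: Suc pochhammer_rec)
qed simp

text \<open>The left-hand side is the \<open>k\<close>-th term in the binomial expansion of the
  \<open>n\<close>-th moment of \<open>r powr \<alpha> * X + (1 - r) powr \<alpha> * Y\<close>, with
  \<open>r\<close> the first stick, \<open>X\<close> having the moments for parameter
  \<open>- \<beta>\<close> and \<open>Y\<close> those for \<open>\<theta> + \<beta>\<close>. The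
  Gamma values that depend on \<open>k\<close> cancel between the beta moment and the denominators
  of the two moments. What survives are Pochhammer symbols at \<open>1 - \<beta> / \<alpha>\<close>
  and \<open>(\<theta> + \<beta>) / \<alpha>\<close>, the parameters of the first stick of
  \<open>GEM (\<beta>/\<alpha>, \<theta>/\<alpha>)\<close>.\<close>

lemma GEM_step_moment:
  assumes \<beta>: "0 \<le> \<beta>" "\<beta> < \<alpha>" "\<alpha> < 1" and \<theta>: "0 < \<theta>" and k: "k \<le> n"
  shows "real (n choose k) * (Beta (1 - \<beta> + real k * \<alpha>) (\<theta> + \<beta> + real (n - k) * \<alpha>) / Beta (1 - \<beta>) (\<theta> + \<beta>)) *
      ml_moment \<alpha> (- \<beta>) k * ml_moment \<alpha> (\<theta> + \<beta>) (n - k) =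
    ml_moment \<alpha> \<theta> n * polya_weight (1 - \<beta> / \<alpha>) ((\<theta> + \<beta>) / \<alpha>) n k"
proof -
  define m where "m = n - k"
  have n: "n = k + m" using k by (simp add: m_def)
  define x where "x = \<theta> + \<beta>"
  have x: "0 < x" using \<theta> \<beta> by (simp add: x_def)
  have a: "0 < \<alpha>" using \<beta> by simp
  have g1: "0 < Gamma (1 - \<beta> + real k * \<alpha>)" "0 < Gamma (1 - \<beta>)" "0 < Gamma x" "0 < Gamma (x + real m * \<alpha>)"
    "0 < Gamma (1 + \<theta>)" "0 < Gamma (1 + \<theta> + real n * \<alpha>)"
    using \<beta> a \<theta> x by (auto intro!: Gamma_real_pos add_pos_nonneg)
  have g2: "Gamma (x + 1) = x * Gamma x" "Gamma (x + real m * \<alpha> + 1) = (x + real m * \<alpha>) * Gamma (x + real m * \<alpha>)"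
    using x a by (auto intro!: Gamma_real_plus1 add_pos_nonneg)
  have xm: "0 < x + real m * \<alpha>" using x a by (auto intro!: add_pos_nonneg)
  \<comment> \<open>The two ways of splitting a factor off
    \<open>pochhammer (x / \<alpha>) (Suc m)\<close>. This turns the argument
    \<open>x / \<alpha> + 1\<close> of the moment into the argument \<open>x / \<alpha>\<close> of
    the weight.\<close>
  have p: "x / \<alpha> * pochhammer (x / \<alpha> + 1) m = pochhammer (x / \<alpha>) m * (x / \<alpha> + real m)"
    using pochhammer_rec[of "x / \<alpha>" m] pochhammer_Suc[of "x / \<alpha>" m] by simp
  have p': "x * pochhammer (x / \<alpha> + 1) m / (x + real m * \<alpha>) = pochhammer (x / \<alpha>) m"
  proof -
    have "x * pochhammer (x / \<alpha> + 1) m = \<alpha> * (x / \<alpha> * pochhammer (x / \<alpha> + 1) m)" using a by simp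
    also have "\<dots> = pochhammer (x / \<alpha>) m * (x + real m * \<alpha>)" unfolding p using a by (simp add: field_simps)
    finally show ?thesis using xm by simp
  qed
  have s1: "1 - \<beta> + real k * \<alpha> + (x + real m * \<alpha>) = 1 + \<theta> + real n * \<alpha>" "1 - \<beta> + x = 1 + \<theta>"
    "1 - \<beta> / \<alpha> + x / \<alpha> = \<theta> / \<alpha> + 1" "- \<beta> + real k * \<alpha> + 1 = 1 - \<beta> + real k * \<alpha>" "- \<beta> / \<alpha> + 1 = 1 - \<beta> / \<alpha>"
    "- \<beta> + 1 = 1 - \<beta>" "\<theta> + 1 = 1 + \<theta>" "\<theta> + real n * \<alpha> + 1 = 1 + \<theta> + real n * \<alpha>"
    using a by (simp_all add: x_def n field_simps)
  have pq: "0 < pochhammer (\<theta> / \<alpha> + 1) n" using \<theta> a by (intro pochhammer_pos) (simp add: add_pos_pos)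
  have "real (n choose k) * (Beta (1 - \<beta> + real k * \<alpha>) (x + real m * \<alpha>) / Beta (1 - \<beta>) x) *
      ml_moment \<alpha> (- \<beta>) k * ml_moment \<alpha> x m =
    real (n choose k) * pochhammer (1 - \<beta> / \<alpha>) k * (x * pochhammer (x / \<alpha> + 1) m / (x + real m * \<alpha>)) * Gamma (1 + \<theta>) / Gamma (1 + \<theta> + real n * \<alpha>)"
  proof -
    \<comment> \<open>The Gamma values enter as opaque nonzero numbers, so the cancellation is a
      field identity.\<close>
    have alg: "N * ((a * c / g) / (b * d / e)) * (P * b / a) * (Q * (x * d) / (xm * c)) = N * P * (x * Q / xm) * e / g"
      if "a \<noteq> 0" "b \<noteq> 0" "c \<noteq> 0" "d \<noteq> 0" "e \<noteq> 0" "g \<noteq> 0" "xm \<noteq> 0" for N a b c d e g P Q xm :: real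
      using that by (simp add: field_simps)
    show ?thesis
      unfolding Beta_def ml_moment_def g2 s1 using g1 xm by (intro alg; linarith)
  qed
  also have "\<dots> = ml_moment \<alpha> \<theta> n * polya_weight (1 - \<beta> / \<alpha>) (x / \<alpha>) n k"
    unfolding p' ml_moment_def polya_weight_def s1 m_def[symmetric] using pq by simp
  finally show ?thesis by (simp add: x_def m_def)
qed

text \<open>The probability that, under \<open>GEM (\<beta>/\<alpha>, \<theta>/\<alpha>)\<close>, all of \<open>n\<close> samples fall into the first
  \<open>m\<close> sticks.\<close>

primrec stick_hit :: "real \<Rightarrow> real \<Rightarrow> nat \<Rightarrow> nat \<Rightarrow> real \<Rightarrow> real" where
  "stick_hit \<alpha> \<beta> 0 n \<theta> = (if n = 0 then 1 else 0)"
| "stick_hit \<alpha> \<beta> (Suc m) n \<theta> =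
    (\<Sum>k\<le>n. polya_weight (1 - \<beta> / \<alpha>) ((\<theta> + \<beta>) / \<alpha>) n k * stick_hit \<alpha> \<beta> m (n - k) (\<theta> + \<beta>))"

text \<open>The lower bound is a union bound over the samples: each one misses the first
  \<open>m\<close> sticks with a probability equal to the mean remaining mass, which is the product
  displayed. In the induction it comes from the mean of the beta-binomial law.\<close>

lemma stick_hit_bounds:
  assumes \<beta>: "0 \<le> \<beta>" "\<beta> < \<alpha>" and \<theta>: "0 < \<theta>"
  shows "0 \<le> stick_hit \<alpha> \<beta> m n \<theta>" "stick_hit \<alpha> \<beta> m n \<theta> \<le> 1"
    "1 - real n * (\<Prod>i<m. 1 - (\<alpha> - \<beta>) / (\<theta> + \<alpha> + real i * \<beta>)) \<le> stick_hit \<alpha> \<beta> m n \<theta>"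
proof -
  have "0 \<le> stick_hit \<alpha> \<beta> m n \<theta> \<and> stick_hit \<alpha> \<beta> m n \<theta> \<le> 1 \<and>
    1 - real n * (\<Prod>i<m. 1 - (\<alpha> - \<beta>) / (\<theta> + \<alpha> + real i * \<beta>)) \<le> stick_hit \<alpha> \<beta> m n \<theta>"
    using \<theta>
  proof (induction m arbitrary: n \<theta>)
    case (Suc m)
    let ?w = "polya_weight (1 - \<beta> / \<alpha>) ((\<theta> + \<beta>) / \<alpha>) n"
    let ?q = "\<lambda>m \<theta>. \<Prod>i<m. 1 - (\<alpha> - \<beta>) / (\<theta> + \<alpha> + real i * \<beta>)"
    have a: "0 < 1 - \<beta> / \<alpha>" "0 < (\<theta> + \<beta>) / \<alpha>" using \<beta> Suc.prems by (auto simp: field_simps)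
    have \<theta>': "0 < \<theta> + \<beta>" using Suc.prems \<beta> by simp
    note IH = Suc.IH[OF \<theta>']
    have w: "0 \<le> ?w k" for k using a by (rule polya_weight_nonneg)
    have 1: "0 \<le> stick_hit \<alpha> \<beta> (Suc m) n \<theta>"
      using w IH by (auto intro!: sum_nonneg mult_nonneg_nonneg)
    have "stick_hit \<alpha> \<beta> (Suc m) n \<theta> \<le> (\<Sum>k\<le>n. ?w k * 1)"
      unfolding stick_hit.simps using w IH by (intro sum_mono mult_left_mono) auto
    then have 2: "stick_hit \<alpha> \<beta> (Suc m) n \<theta> \<le> 1" by (simp add: sum_polya_weight[OF a])
    have "(\<Sum>k\<le>n. ?w k * (1 - real (n - k) * ?q m (\<theta> + \<beta>))) \<le> stick_hit \<alpha> \<beta> (Suc m) n \<theta>"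
      unfolding stick_hit.simps by (intro sum_mono mult_left_mono) (use w IH in blast)+
    also have "(\<Sum>k\<le>n. ?w k * (1 - real (n - k) * ?q m (\<theta> + \<beta>))) =
      (\<Sum>k\<le>n. ?w k) - (\<Sum>k\<le>n. ?w k * real (n - k)) * ?q m (\<theta> + \<beta>)"
    proof -
      have "(\<Sum>k\<le>n. w k * (1 - g k * c)) = (\<Sum>k\<le>n. w k) - (\<Sum>k\<le>n. w k * g k) * c" for w g :: "nat \<Rightarrow> real" and c
        by (simp add: sum_subtractf sum_distrib_right right_diff_distrib mult.assoc)
      then show ?thesis .
    qed
    also have "\<dots> = 1 - real n * (((\<theta> + \<beta>) / \<alpha> / (1 - \<beta> / \<alpha> + (\<theta> + \<beta>) / \<alpha>)) * ?q m (\<theta> + \<beta>))"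
      by (simp only: sum_polya_weight[OF a] mean_polya_weight[OF a] mult.assoc)
    \<comment> \<open>The mean of what the first stick of
      \<open>GEM (\<beta>/\<alpha>, \<theta>/\<alpha>)\<close> leaves over, in the form of the
      factor with index 0.\<close>
    also have "(\<theta> + \<beta>) / \<alpha> / (1 - \<beta> / \<alpha> + (\<theta> + \<beta>) / \<alpha>) = 1 - (\<alpha> - \<beta>) / (\<theta> + \<alpha> + real 0 * \<beta>)"
    proof -
      have e: "1 - \<beta> / \<alpha> + (\<theta> + \<beta>) / \<alpha> = (\<theta> + \<alpha>) / \<alpha>" using \<beta> by (simp add: field_simps)
      have "(\<theta> + \<beta>) / \<alpha> / ((\<theta> + \<alpha>) / \<alpha>) = (\<theta> + \<beta>) / (\<theta> + \<alpha>)" using \<beta> by simp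
      moreover have "\<theta> + \<alpha> \<noteq> 0" using \<beta> Suc.prems by simp
      then have "1 - (\<alpha> - \<beta>) / (\<theta> + \<alpha>) = (\<theta> + \<beta>) / (\<theta> + \<alpha>)" by (simp add: divide_simps)
      ultimately show ?thesis unfolding e by simp
    qed
    also have "\<dots> * ?q m (\<theta> + \<beta>) = ?q (Suc m) \<theta>"
      by (subst prod.lessThan_Suc_shift) (simp add: algebra_simps)
    finally show ?case using 1 2 by blast
  qed auto
  then show "0 \<le> stick_hit \<alpha> \<beta> m n \<theta>" "stick_hit \<alpha> \<beta> m n \<theta> \<le> 1"
    "1 - real n * (\<Prod>i<m. 1 - (\<alpha> - \<beta>) / (\<theta> + \<alpha> + real i * \<beta>)) \<le> stick_hit \<alpha> \<beta> m n \<theta>" by auto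
qed

lemma stick_hit_tendsto:
  assumes \<beta>: "0 \<le> \<beta>" "\<beta> < \<alpha>" and \<theta>: "0 < \<theta>"
  shows "(\<lambda>m. stick_hit \<alpha> \<beta> m n \<theta>) \<longlonglongrightarrow> 1"
proof (rule tendsto_sandwich[OF _ _ _ tendsto_const])
  show "\<forall>\<^sub>F m in sequentially. 1 - real n * (\<Prod>i<m. 1 - (\<alpha> - \<beta>) / (\<theta> + \<alpha> + real i * \<beta>)) \<le> stick_hit \<alpha> \<beta> m n \<theta>"
    "\<forall>\<^sub>F m in sequentially. stick_hit \<alpha> \<beta> m n \<theta> \<le> 1"
    using stick_hit_bounds[OF assms] by auto
  have "(\<lambda>m. 1 - real n * (\<Prod>i<m. 1 - (\<alpha> - \<beta>) / (\<theta> + \<alpha> + real i * \<beta>))) \<longlonglongrightarrow> 1 - real n * 0"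
    using assms by (intro tendsto_intros prod_tendsto_0_harmonic) auto
  then show "(\<lambda>m. 1 - real n * (\<Prod>i<m. 1 - (\<alpha> - \<beta>) / (\<theta> + \<alpha> + real i * \<beta>))) \<longlonglongrightarrow> 1" by simp
qed

text \<open>Valued in \<open>ennreal\<close>, so that powers can be expanded and integrated term by
  term without integrability conditions. Negative entries would count as 0; in the application all
  entries are almost surely nonnegative.\<close>

definition weighted_sum :: "real \<Rightarrow> nat \<Rightarrow> (nat \<Rightarrow> real) \<Rightarrow> (nat \<Rightarrow> real) \<Rightarrow> (nat \<Rightarrow> real) \<Rightarrow> ennreal" where
  "weighted_sum \<alpha> m p v z = (\<Sum>k<m. ennreal (p k powr \<alpha>) * (ennreal (v k) * ennreal (z k)))"

lemma measurable_weighted_sum [measurable (raw)]: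
  assumes [measurable]: "\<And>k. (\<lambda>x. f x k) \<in> borel_measurable M" "\<And>k. (\<lambda>x. g x k) \<in> borel_measurable M"
    "\<And>k. (\<lambda>x. h x k) \<in> borel_measurable M"
  shows "(\<lambda>x. weighted_sum \<alpha> m (f x) (g x) (h x)) \<in> borel_measurable M"
  unfolding weighted_sum_def by measurable

lemma weighted_sum_case_nat:
  "weighted_sum \<alpha> (Suc m) (case_nat a p) (case_nat x v) (case_nat w z) =
    ennreal (a powr \<alpha>) * (ennreal x * ennreal w) + weighted_sum \<alpha> m p v z"
  by (simp add: weighted_sum_def sum.lessThan_Suc_shift del: sum.lessThan_Suc)

lemma weighted_sum_scale:
  assumes "0 \<le> c" "\<And>k. 0 \<le> p k"
  shows "weighted_sum \<alpha> m (\<lambda>k. c * p k) v z = ennreal (c powr \<alpha>) * weighted_sum \<alpha> m p v z"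
  using assms by (simp add: weighted_sum_def sum_distrib_left powr_mult ennreal_mult mult.assoc)

lemma nn_integral_sum_cmult:
  assumes [measurable]: "\<And>k. k \<in> I \<Longrightarrow> g k \<in> borel_measurable M"
  shows "(\<integral>\<^sup>+x. (\<Sum>k\<in>I. c k * g k x) \<partial>M) = (\<Sum>k\<in>I. c k * (\<integral>\<^sup>+x. g k x \<partial>M))"
  by (subst nn_integral_sum) (auto intro!: sum.cong nn_integral_cmult)

text \<open>Weights and limit variables stay two separate iid sequences, as in the claim, yet only
  the products of their moments are prescribed; this is where the weight and the Mittag-Leffler
  variable merge into one.\<close>

locale two_sequences =
  fixes \<mu> \<nu> :: "real measure" and y :: "nat \<Rightarrow> real"
  assumes prob_\<mu>: "prob_space \<mu>" and prob_\<nu>: "prob_space \<nu>"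
    and sets_\<mu> [measurable_cong, simp]: "sets \<mu> = sets borel" and sets_\<nu> [measurable_cong, simp]: "sets \<nu> = sets borel"
    and y_nonneg: "\<And>n. 0 \<le> y n"
    and moments: "\<And>n. (\<integral>\<^sup>+x. ennreal x ^ n \<partial>\<mu>) * (\<integral>\<^sup>+w. ennreal w ^ n \<partial>\<nu>) = ennreal (y n)"
begin

sublocale \<mu>: prob_space \<mu> by (rule prob_\<mu>)
sublocale \<nu>: prob_space \<nu> by (rule prob_\<nu>)
sublocale V: product_prob_space "\<lambda>_. \<mu>" "UNIV :: nat set" by (rule product_prob_spaceI) (rule prob_\<mu>)
sublocale Z: product_prob_space "\<lambda>_. \<nu>" "UNIV :: nat set" by (rule product_prob_spaceI) (rule prob_\<nu>)

abbreviation "Vs \<equiv> PiM (UNIV :: nat set) (\<lambda>_. \<mu>)"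
abbreviation "Zs \<equiv> PiM (UNIV :: nat set) (\<lambda>_. \<nu>)"

lemma sets_Vs [measurable_cong, simp]: "sets Vs = sets seq_space"
  and sets_Zs [measurable_cong, simp]: "sets Zs = sets seq_space"
  by (auto intro!: sets_PiM_cong)

lemma measurable_coordinate [measurable]:
  "(\<lambda>v. v k) \<in> borel_measurable Vs" "(\<lambda>z. z k) \<in> borel_measurable Zs"
  by (simp_all add: measurable_cong_sets[OF sets_Vs refl] measurable_cong_sets[OF sets_Zs refl])

lemma measurable_ennreal_power:
  "(\<lambda>x. ennreal x ^ k) \<in> borel_measurable \<mu>" "(\<lambda>x. ennreal x ^ k) \<in> borel_measurable \<nu>"
  by (simp_all add: measurable_cong_sets[OF sets_\<mu> refl] measurable_cong_sets[OF sets_\<nu> refl])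

lemma measurable_weighted_sum_power:
  "(\<lambda>z. weighted_sum \<alpha> m p v z ^ n) \<in> borel_measurable Zs"
  "(\<lambda>v. \<integral>\<^sup>+z. weighted_sum \<alpha> m p v z ^ n \<partial>Zs) \<in> borel_measurable Vs"
proof -
  have [measurable]: "(\<lambda>(v, z). weighted_sum \<alpha> m p v z ^ n) \<in> borel_measurable (Vs \<Otimes>\<^sub>M Zs)"
    by measurable
  show "(\<lambda>z. weighted_sum \<alpha> m p v z ^ n) \<in> borel_measurable Zs" by measurable
  show "(\<lambda>v. \<integral>\<^sup>+z. weighted_sum \<alpha> m p v z ^ n \<partial>Zs) \<in> borel_measurable Vs"
    by (rule Z.P.borel_measurable_nn_integral) measurable
qed

text \<open>The conditional moment of the truncated sum, given the stick lengths
  \<open>p\<close>.\<close>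

definition power_mean :: "real \<Rightarrow> nat \<Rightarrow> nat \<Rightarrow> (nat \<Rightarrow> real) \<Rightarrow> ennreal" where
  "power_mean \<alpha> m n p = (\<integral>\<^sup>+v. \<integral>\<^sup>+z. weighted_sum \<alpha> m p v z ^ n \<partial>Zs \<partial>Vs)"

lemma measurable_power_mean [measurable (raw)]:
  assumes [measurable]: "f \<in> M \<rightarrow>\<^sub>M seq_space"
  shows "(\<lambda>x. power_mean \<alpha> m n (f x)) \<in> borel_measurable M"
  unfolding power_mean_def by measurable

lemma power_mean_scale:
  assumes "0 \<le> c" "\<And>k. 0 \<le> p k"
  shows "power_mean \<alpha> m n (\<lambda>k. c * p k) = ennreal (c powr \<alpha>) ^ n * power_mean \<alpha> m n p"
  unfolding power_mean_def weighted_sum_scale[OF assms] power_mult_distrib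
  by (simp add: nn_integral_cmult measurable_weighted_sum_power)

text \<open>The first weight \<open>x\<close> and the first variable \<open>w\<close> are
  independent of the rest, so after binomial expansion every integral acts on one factor only. The
  integrals are removed from the inside outwards, and the two single moments multiply to
  \<open>y k\<close>.\<close>

lemma power_mean_Suc:
  "power_mean \<alpha> (Suc m) n (case_nat a p) =
    (\<Sum>k\<le>n. of_nat (n choose k) * (ennreal (a powr \<alpha>) ^ k * ennreal (y k) * power_mean \<alpha> m (n - k) p))"
proof -
  let ?A = "ennreal (a powr \<alpha>)"
  let ?S = "weighted_sum \<alpha> m p" and ?S' = "weighted_sum \<alpha> (Suc m) (case_nat a p)"
  let ?J = "\<lambda>j v. \<integral>\<^sup>+z. ?S v z ^ j \<partial>Zs"
  let ?E = "\<lambda>k. \<integral>\<^sup>+w. ennreal w ^ k \<partial>\<nu>"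
  let ?C = "\<lambda>k. of_nat (n choose k) :: ennreal"
  note meas [measurable] = measurable_weighted_sum_power
  have m1: "(\<lambda>z. ?S' v z ^ n) \<in> borel_measurable seq_space" for v
    using meas(1) unfolding measurable_cong_sets[OF sets_Zs refl] .
  have m2: "(\<lambda>v. \<integral>\<^sup>+z. ?S' v z ^ n \<partial>Zs) \<in> borel_measurable seq_space"
    using meas(2) unfolding measurable_cong_sets[OF sets_Vs refl] .
  have "power_mean \<alpha> (Suc m) n (case_nat a p) = (\<integral>\<^sup>+x. \<integral>\<^sup>+v. \<integral>\<^sup>+z. ?S' (case_nat x v) z ^ n \<partial>Zs \<partial>Vs \<partial>\<mu>)"
    unfolding power_mean_def using prob_\<mu> by (intro nn_integral_PiM_nat_unfold m2) auto
  also have "\<dots> = (\<integral>\<^sup>+x. \<integral>\<^sup>+v. \<integral>\<^sup>+w. \<integral>\<^sup>+z. ?S' (case_nat x v) (case_nat w z) ^ n \<partial>Zs \<partial>\<nu> \<partial>Vs \<partial>\<mu>)"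
    using prob_\<nu> by (intro nn_integral_cong nn_integral_PiM_nat_unfold m1) auto
  also have "\<dots> = (\<integral>\<^sup>+x. \<integral>\<^sup>+v. \<integral>\<^sup>+w. (\<Sum>k\<le>n. ?C k * ?A ^ k * ennreal x ^ k * ?J (n - k) v * ennreal w ^ k) \<partial>\<nu> \<partial>Vs \<partial>\<mu>)"
  proof (intro nn_integral_cong)
    fix x w v
    have "(\<integral>\<^sup>+z. ?S' (case_nat x v) (case_nat w z) ^ n \<partial>Zs) =
      (\<integral>\<^sup>+z. (\<Sum>k\<le>n. (?C k * ?A ^ k * ennreal x ^ k * ennreal w ^ k) * ?S v z ^ (n - k)) \<partial>Zs)"
      by (simp add: weighted_sum_case_nat binomial_ring power_mult_distrib mult_ac)
    also have "\<dots> = (\<Sum>k\<le>n. (?C k * ?A ^ k * ennreal x ^ k * ennreal w ^ k) * ?J (n - k) v)"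
      by (rule nn_integral_sum_cmult) (rule meas)
    finally show "(\<integral>\<^sup>+z. ?S' (case_nat x v) (case_nat w z) ^ n \<partial>Zs) =
      (\<Sum>k\<le>n. ?C k * ?A ^ k * ennreal x ^ k * ?J (n - k) v * ennreal w ^ k)"
      by (simp add: mult_ac)
  qed
  also have "\<dots> = (\<integral>\<^sup>+x. \<integral>\<^sup>+v. (\<Sum>k\<le>n. ?C k * ?A ^ k * ennreal x ^ k * ?J (n - k) v * ?E k) \<partial>Vs \<partial>\<mu>)"
    by (intro nn_integral_cong nn_integral_sum_cmult measurable_ennreal_power)
  also have "\<dots> = (\<integral>\<^sup>+x. \<integral>\<^sup>+v. (\<Sum>k\<le>n. (?C k * ?A ^ k * ennreal x ^ k * ?E k) * ?J (n - k) v) \<partial>Vs \<partial>\<mu>)"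
    by (simp only: mult_ac)
  also have "\<dots> = (\<integral>\<^sup>+x. (\<Sum>k\<le>n. (?C k * ?A ^ k * ennreal x ^ k * ?E k) * power_mean \<alpha> m (n - k) p) \<partial>\<mu>)"
    unfolding power_mean_def by (intro nn_integral_cong nn_integral_sum_cmult meas)
  also have "\<dots> = (\<integral>\<^sup>+x. (\<Sum>k\<le>n. (?C k * ?A ^ k * ?E k * power_mean \<alpha> m (n - k) p) * ennreal x ^ k) \<partial>\<mu>)"
    by (simp only: mult_ac)
  also have "\<dots> = (\<Sum>k\<le>n. (?C k * ?A ^ k * ?E k * power_mean \<alpha> m (n - k) p) * (\<integral>\<^sup>+x. ennreal x ^ k \<partial>\<mu>))"
    by (rule nn_integral_sum_cmult) (rule measurable_ennreal_power)
  also have "\<dots> = (\<Sum>k\<le>n. ?C k * (?A ^ k * ennreal (y k) * power_mean \<alpha> m (n - k) p))"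
    by (simp add: moments[symmetric] mult_ac)
  finally show ?thesis .
qed

text \<open>Induction on the number of sticks, with \<open>\<theta>\<close> arbitrary because the
  sticks after the first belong to \<open>\<theta> + \<beta>\<close>. The moments for
  \<open>\<theta>\<close> factor out by \<open>GEM_step_moment\<close>, and the remaining
  beta-binomial recursion is the one that defines \<open>stick_hit\<close>.\<close>

lemma GEM_power_mean:
  assumes \<beta>: "0 \<le> \<beta>" "\<beta> < \<alpha>" "\<alpha> < 1" and y: "\<And>n. y n = ml_moment \<alpha> (- \<beta>) n" and \<theta>: "0 < \<theta>"
  shows "(\<integral>\<^sup>+p. power_mean \<alpha> m n p \<partial>GEM \<beta> \<theta>) = ennreal (ml_moment \<alpha> \<theta> n * stick_hit \<alpha> \<beta> m n \<theta>)"
  using \<theta>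
proof (induction m arbitrary: n \<theta>)
  case 0
  interpret prob_space "GEM \<beta> \<theta>" using \<beta> 0 by (intro prob_space_GEM) auto
  \<comment> \<open>The empty sum has \<open>n\<close>-th power 1 or 0 according to whether
    \<open>n = 0\<close>, like \<open>stick_hit\<close> with no sticks.\<close>
  have "power_mean \<alpha> 0 n p = 0 ^ n" for p
    by (simp add: power_mean_def weighted_sum_def power_0_left V.P.emeasure_space_1 Z.P.emeasure_space_1)
  then show ?case using 0 ml_moment_0[of \<theta> \<alpha>] emeasure_space_1 by (simp add: power_0_left)
next
  case (Suc m)
  have \<theta>': "0 < \<theta> + \<beta>" using Suc.prems \<beta> by simp
  have AE_p: "AE p in GEM \<beta> (\<theta> + \<beta>). \<forall>k. 0 < p k"
    using AE_GEM[of \<beta> "\<theta> + \<beta>"] \<beta> \<theta>' by (auto elim!: eventually_mono)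
  have AE_r: "AE r in beta_law (1 - \<beta>) (\<theta> + \<beta>). 0 < r \<and> r < 1"
    using \<beta> \<theta>' by (intro AE_beta_law) auto
  let ?w = "\<lambda>k r. ennreal (r powr (real k * \<alpha>) * (1 - r) powr (real (n - k) * \<alpha>))"
  have "(\<integral>\<^sup>+p. power_mean \<alpha> (Suc m) n p \<partial>GEM \<beta> \<theta>) =
    (\<integral>\<^sup>+r. \<integral>\<^sup>+p. power_mean \<alpha> (Suc m) n (case_nat r (\<lambda>k. (1 - r) * p k)) \<partial>GEM \<beta> (\<theta> + \<beta>) \<partial>beta_law (1 - \<beta>) (\<theta> + \<beta>))"
    using \<beta> Suc.prems by (intro nn_integral_GEM_unfold) auto
  also have "\<dots> = (\<integral>\<^sup>+r. \<integral>\<^sup>+p. (\<Sum>k\<le>n. (of_nat (n choose k) * ennreal (y k) * ?w k r) * power_mean \<alpha> m (n - k) p)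
      \<partial>GEM \<beta> (\<theta> + \<beta>) \<partial>beta_law (1 - \<beta>) (\<theta> + \<beta>))"
    using AE_r
  proof (intro nn_integral_cong_AE, eventually_elim)
    case (elim r)
    have pw: "ennreal (r powr \<alpha>) ^ k * ennreal ((1 - r) powr \<alpha>) ^ j = ennreal (r powr (real k * \<alpha>) * (1 - r) powr (real j * \<alpha>))" for k j
      using elim by (simp add: ennreal_power powr_power ennreal_mult)
    show ?case using AE_p
    proof (intro nn_integral_cong_AE, eventually_elim)
      case (elim p)
      have sc: "power_mean \<alpha> m j (\<lambda>k. (1 - r) * p k) = ennreal ((1 - r) powr \<alpha>) ^ j * power_mean \<alpha> m j p" for j
        using elim \<open>0 < r \<and> r < 1\<close> by (intro power_mean_scale) (auto intro: less_imp_le)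
      show ?case
        unfolding power_mean_Suc sc pw[symmetric] by (simp only: mult_ac)
    qed
  qed
  also have "\<dots> = (\<Sum>k\<le>n. of_nat (n choose k) * ennreal (y k) * (\<integral>\<^sup>+r. ?w k r \<partial>beta_law (1 - \<beta>) (\<theta> + \<beta>)) *
      (\<integral>\<^sup>+p. power_mean \<alpha> m (n - k) p \<partial>GEM \<beta> (\<theta> + \<beta>)))"
  proof -
    let ?P = "\<lambda>k. \<integral>\<^sup>+p. power_mean \<alpha> m (n - k) p \<partial>GEM \<beta> (\<theta> + \<beta>)"
    have "(\<integral>\<^sup>+r. \<integral>\<^sup>+p. (\<Sum>k\<le>n. (of_nat (n choose k) * ennreal (y k) * ?w k r) * power_mean \<alpha> m (n - k) p)
      \<partial>GEM \<beta> (\<theta> + \<beta>) \<partial>beta_law (1 - \<beta>) (\<theta> + \<beta>)) =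
      (\<integral>\<^sup>+r. (\<Sum>k\<le>n. (of_nat (n choose k) * ennreal (y k) * ?w k r) * ?P k) \<partial>beta_law (1 - \<beta>) (\<theta> + \<beta>))"
      by (intro nn_integral_cong nn_integral_sum_cmult) measurable
    also have "\<dots> = (\<integral>\<^sup>+r. (\<Sum>k\<le>n. (of_nat (n choose k) * ennreal (y k) * ?P k) * ?w k r) \<partial>beta_law (1 - \<beta>) (\<theta> + \<beta>))"
      by (simp only: mult_ac)
    also have "\<dots> = (\<Sum>k\<le>n. (of_nat (n choose k) * ennreal (y k) * ?P k) * (\<integral>\<^sup>+r. ?w k r \<partial>beta_law (1 - \<beta>) (\<theta> + \<beta>)))"
      by (rule nn_integral_sum_cmult) (simp add: measurable_cong_sets[OF sets_beta_law refl])
    finally show ?thesis by (simp only: mult_ac)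
  qed
  also have "\<dots> = (\<Sum>k\<le>n. ennreal (ml_moment \<alpha> \<theta> n * (polya_weight (1 - \<beta> / \<alpha>) ((\<theta> + \<beta>) / \<alpha>) n k * stick_hit \<alpha> \<beta> m (n - k) (\<theta> + \<beta>))))"
  proof (intro sum.cong refl)
    fix k assume k: "k \<in> {..n}"
    let ?B = "Beta (1 - \<beta> + real k * \<alpha>) (\<theta> + \<beta> + real (n - k) * \<alpha>) / Beta (1 - \<beta>) (\<theta> + \<beta>)"
    have gen: "of_nat c * ennreal a * ennreal b * ennreal (d * e) = ennreal ((real c * b * a * d) * e)"
      if "0 \<le> a" "0 \<le> b" "0 \<le> d" "0 \<le> e" for a b d e :: real and c :: nat
      using that by (simp add: ennreal_mult mult_ac flip: ennreal_of_nat_eq_real_of_nat)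
    have B: "0 \<le> ?B"
      using \<beta> \<theta>' Suc.prems by (intro divide_nonneg_nonneg less_imp_le[OF Beta_real_pos] add_pos_nonneg) auto
    have "(\<integral>\<^sup>+r. ?w k r \<partial>beta_law (1 - \<beta>) (\<theta> + \<beta>)) = ennreal ?B"
      using \<beta> \<theta>' Suc.prems by (intro beta_law_powr_moment add_pos_nonneg) auto
    moreover have "0 \<le> ml_moment \<alpha> (\<theta> + \<beta>) (n - k)" using \<beta> \<theta>' by (intro less_imp_le[OF ml_moment_pos]) auto
    moreover have "0 \<le> stick_hit \<alpha> \<beta> m (n - k) (\<theta> + \<beta>)" using \<beta> \<theta>' by (intro stick_hit_bounds)
    ultimately have "of_nat (n choose k) * ennreal (y k) * (\<integral>\<^sup>+r. ?w k r \<partial>beta_law (1 - \<beta>) (\<theta> + \<beta>)) *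
      (\<integral>\<^sup>+p. power_mean \<alpha> m (n - k) p \<partial>GEM \<beta> (\<theta> + \<beta>)) =
      ennreal ((real (n choose k) * ?B * y k * ml_moment \<alpha> (\<theta> + \<beta>) (n - k)) * stick_hit \<alpha> \<beta> m (n - k) (\<theta> + \<beta>))"
      using B y_nonneg[of k] by (simp only: Suc.IH[OF \<theta>', of "n - k"] gen)
    then show "of_nat (n choose k) * ennreal (y k) * (\<integral>\<^sup>+r. ?w k r \<partial>beta_law (1 - \<beta>) (\<theta> + \<beta>)) *
      (\<integral>\<^sup>+p. power_mean \<alpha> m (n - k) p \<partial>GEM \<beta> (\<theta> + \<beta>)) =
      ennreal (ml_moment \<alpha> \<theta> n * (polya_weight (1 - \<beta> / \<alpha>) ((\<theta> + \<beta>) / \<alpha>) n k * stick_hit \<alpha> \<beta> m (n - k) (\<theta> + \<beta>)))"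
      using GEM_step_moment[OF \<beta> Suc.prems, of k n] k unfolding y by (simp only: mult.assoc[symmetric] atMost_iff)
  qed
  also have "\<dots> = ennreal (ml_moment \<alpha> \<theta> n * stick_hit \<alpha> \<beta> (Suc m) n \<theta>)"
    unfolding stick_hit.simps sum_distrib_left using \<beta> Suc.prems \<theta>'
    by (intro sum_ennreal mult_nonneg_nonneg less_imp_le[OF ml_moment_pos] polya_weight_nonneg stick_hit_bounds)
      (simp_all add: field_simps)
  finally show ?case .
qed

end

text \<open>Mutual independence of three sequences becomes an iterated integral by separating the
  index 0 from \<open>{1, 2}\<close>, and then 1 from 2.\<close>

lemma indep_seqs3_nn_integral:
  assumes "prob_space M" and ind: "indep_seqs M [P, V, Z]"
    and F [measurable]: "F \<in> borel_measurable (seq_space \<Otimes>\<^sub>M (seq_space \<Otimes>\<^sub>M seq_space))"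
  shows "(\<integral>\<^sup>+\<omega>. F (\<lambda>k. P k \<omega>, \<lambda>k. V k \<omega>, \<lambda>k. Z k \<omega>) \<partial>M) =
    (\<integral>\<^sup>+p. \<integral>\<^sup>+v. \<integral>\<^sup>+z. F (p, v, z) \<partial>distr M seq_space (\<lambda>\<omega> k. Z k \<omega>) \<partial>distr M seq_space (\<lambda>\<omega> k. V k \<omega>)
      \<partial>distr M seq_space (\<lambda>\<omega> k. P k \<omega>))"
proof -
  interpret prob_space M by fact
  define X where "X j \<omega> = (\<lambda>k. ([P, V, Z] ! j) k \<omega>)" for j \<omega>
  have iv: "indep_vars (\<lambda>_. seq_space) X {..<3}"
    using ind by (simp add: indep_seqs_def X_def[abs_def] numeral_3_eq_3)
  have X: "X 0 = (\<lambda>\<omega> k. P k \<omega>)" "X 1 = (\<lambda>\<omega> k. V k \<omega>)" "X 2 = (\<lambda>\<omega> k. Z k \<omega>)"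
    by (simp_all add: X_def[abs_def])
  have rv: "random_variable seq_space (X j)" if "j < 3" for j
    using iv that by (auto simp: indep_vars_def)
  have [measurable]: "random_variable seq_space (X 0)" "random_variable seq_space (X 1)" "random_variable seq_space (X (Suc 0))" "random_variable seq_space (X 2)"
    by (simp_all add: rv)
  define R where "R A \<omega> = restrict (\<lambda>i. X i \<omega>) A" for A \<omega>
  have R [measurable]: "R A \<in> M \<rightarrow>\<^sub>M PiM A (\<lambda>_. seq_space)" if "A \<subseteq> {..<3}" for A
    unfolding R_def[abs_def] using that rv by (intro measurable_restrict) auto
  \<comment> \<open>Disjoint groups of an independent family are independent, so a second,
    independent copy of the sample point may be used for the second group.\<close>
  have split: "(\<integral>\<^sup>+\<omega>. G (R A \<omega>, R C \<omega>) \<partial>M) = (\<integral>\<^sup>+\<omega>. \<integral>\<^sup>+\<omega>'. G (R A \<omega>, R C \<omega>') \<partial>M \<partial>M)"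
    if AC: "A \<inter> C = {}" "A \<subseteq> {..<3}" "C \<subseteq> {..<3}"
      and [measurable]: "G \<in> borel_measurable (PiM A (\<lambda>_. seq_space) \<Otimes>\<^sub>M PiM C (\<lambda>_. seq_space))" for A C G
  proof -
    let ?A = "PiM A (\<lambda>_. seq_space)" and ?C = "PiM C (\<lambda>_. seq_space)"
    note [measurable] = R[OF AC(2)] R[OF AC(3)]
    have eq: "distr M ?A (R A) \<Otimes>\<^sub>M distr M ?C (R C) = distr M (?A \<Otimes>\<^sub>M ?C) (\<lambda>\<omega>. (R A \<omega>, R C \<omega>))"
      using indep_var_restrict[OF iv AC] unfolding R_def[abs_def] by (simp add: indep_var_distribution_eq)
    interpret DC: prob_space "distr M ?C (R C)" by (rule prob_space_distr) simp
    have "(\<integral>\<^sup>+\<omega>. G (R A \<omega>, R C \<omega>) \<partial>M) = (\<integral>\<^sup>+x. G x \<partial>(distr M ?A (R A) \<Otimes>\<^sub>M distr M ?C (R C)))"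
      unfolding eq by (subst nn_integral_distr) simp_all
    also have "\<dots> = (\<integral>\<^sup>+a. \<integral>\<^sup>+c. G (a, c) \<partial>distr M ?C (R C) \<partial>distr M ?A (R A))"
      by (rule DC.nn_integral_fst[symmetric]) measurable
    also have "\<dots> = (\<integral>\<^sup>+\<omega>. \<integral>\<^sup>+c. G (R A \<omega>, c) \<partial>distr M ?C (R C) \<partial>M)"
      by (rule nn_integral_distr) measurable
    also have "\<dots> = (\<integral>\<^sup>+\<omega>. \<integral>\<^sup>+\<omega>'. G (R A \<omega>, R C \<omega>') \<partial>M \<partial>M)"
      using R[OF AC(2), THEN measurable_space] by (intro nn_integral_cong nn_integral_distr) simp_all
    finally show ?thesis .
  qed
  have "(\<integral>\<^sup>+\<omega>. F (X 0 \<omega>, X 1 \<omega>, X 2 \<omega>) \<partial>M) = (\<integral>\<^sup>+\<omega>. (\<lambda>(f, g). F (f 0, g 1, g 2)) (R {0} \<omega>, R {1, 2} \<omega>) \<partial>M)"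
    by (simp add: R_def)
  also have "\<dots> = (\<integral>\<^sup>+\<omega>. \<integral>\<^sup>+\<omega>'. (\<lambda>(f, g). F (f 0, g 1, g 2)) (R {0} \<omega>, R {1, 2} \<omega>') \<partial>M \<partial>M)"
    by (rule split) (auto simp: split_beta')
  also have "\<dots> = (\<integral>\<^sup>+\<omega>. \<integral>\<^sup>+\<omega>'. (\<lambda>(f, g). F (X 0 \<omega>, f 1, g 2)) (R {1} \<omega>', R {2} \<omega>') \<partial>M \<partial>M)"
    by (simp add: R_def)
  also have "\<dots> = (\<integral>\<^sup>+\<omega>. \<integral>\<^sup>+\<omega>'. \<integral>\<^sup>+\<omega>''. (\<lambda>(f, g). F (X 0 \<omega>, f 1, g 2)) (R {1} \<omega>', R {2} \<omega>'') \<partial>M \<partial>M \<partial>M)"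
  proof (rule nn_integral_cong)
    fix \<omega> assume "\<omega> \<in> space M"
    have [simp]: "x \<in> space seq_space" for x by (simp add: space_PiM)
    have "(\<lambda>(f, g). F (X 0 \<omega>, f 1, g 2)) \<in> borel_measurable (PiM {1} (\<lambda>_. seq_space) \<Otimes>\<^sub>M PiM {2} (\<lambda>_. seq_space))"
      by (simp add: split_beta')
    then show "(\<integral>\<^sup>+\<omega>'. (\<lambda>(f, g). F (X 0 \<omega>, f 1, g 2)) (R {1} \<omega>', R {2} \<omega>') \<partial>M) =
      (\<integral>\<^sup>+\<omega>'. \<integral>\<^sup>+\<omega>''. (\<lambda>(f, g). F (X 0 \<omega>, f 1, g 2)) (R {1} \<omega>', R {2} \<omega>'') \<partial>M \<partial>M)"
      by (intro split) auto
  qed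
  also have "\<dots> = (\<integral>\<^sup>+\<omega>. \<integral>\<^sup>+\<omega>'. \<integral>\<^sup>+\<omega>''. F (X 0 \<omega>, X 1 \<omega>', X 2 \<omega>'') \<partial>M \<partial>M \<partial>M)"
    by (simp add: R_def)
  also have "\<dots> = (\<integral>\<^sup>+p. \<integral>\<^sup>+\<omega>'. \<integral>\<^sup>+\<omega>''. F (p, X 1 \<omega>', X 2 \<omega>'') \<partial>M \<partial>M \<partial>distr M seq_space (X 0))"
    by (rule nn_integral_distr[symmetric]) measurable
  also have "\<dots> = (\<integral>\<^sup>+p. \<integral>\<^sup>+v. \<integral>\<^sup>+\<omega>''. F (p, v, X 2 \<omega>'') \<partial>M \<partial>distr M seq_space (X 1) \<partial>distr M seq_space (X 0))"
    by (intro nn_integral_cong nn_integral_distr[symmetric]) (auto simp: space_PiM)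
  also have "\<dots> = (\<integral>\<^sup>+p. \<integral>\<^sup>+v. \<integral>\<^sup>+z. F (p, v, z) \<partial>distr M seq_space (X 2) \<partial>distr M seq_space (X 1) \<partial>distr M seq_space (X 0))"
    by (intro nn_integral_cong nn_integral_distr[symmetric]) (auto simp: space_PiM)
  finally show ?thesis by (simp only: X)
qed

lemma iid_with_law_distr:
  assumes "prob_space M" and iid: "iid_with_law M V \<mu>"
  shows "distr M seq_space (\<lambda>\<omega> k. V k \<omega>) = PiM UNIV (\<lambda>_. \<mu>)"
proof -
  interpret prob_space M by fact
  from iid have "indep_vars (\<lambda>_. borel) V UNIV" "\<And>k. distr M borel (V k) = \<mu>" "\<And>k. V k \<in> borel_measurable M"
    by (auto simp: iid_with_law_def has_law_def)
  then show ?thesis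
    using indep_vars_iff_distr_eq_PiM'[of UNIV V "\<lambda>_. borel"] by (simp add: restrict_UNIV)
qed

text \<open>Truncation after \<open>m\<close> sticks costs exactly the factor
  \<open>stick_hit\<close> in each moment. Since this factor is at most 1, the first moments stay
  bounded and the series converges almost surely; since it tends to 1, monotone convergence gives
  the moments of the full sum.\<close>

lemma stick_sum_moments:
  assumes M: "prob_space M" and \<beta>: "0 \<le> \<beta>" "\<beta> < \<alpha>" "\<alpha> < 1" and \<theta>: "0 < \<theta>"
    and P: "has_seq_law M P (GEM \<beta> \<theta>)"
    and V: "iid_with_law M V \<mu>" and Z: "iid_with_law M Z \<nu>"
    and ind: "indep_seqs M [P, V, Z]"
    and pos: "AE x in \<mu>. 0 \<le> x" "AE x in \<nu>. 0 \<le> x"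
    and moments: "\<And>n. (\<integral>\<^sup>+x. ennreal (x ^ n) \<partial>\<mu>) * (\<integral>\<^sup>+w. ennreal (w ^ n) \<partial>\<nu>) = ennreal (ml_moment \<alpha> (- \<beta>) n)"
  shows "AE \<omega> in M. (\<forall>k. 0 < P k \<omega> \<and> 0 \<le> V k \<omega> \<and> 0 \<le> Z k \<omega>)"
    and "AE \<omega> in M. summable (\<lambda>k. P k \<omega> powr \<alpha> * V k \<omega> * Z k \<omega>)"
    and "\<And>n. integrable M (\<lambda>\<omega>. (\<Sum>k. P k \<omega> powr \<alpha> * V k \<omega> * Z k \<omega>) ^ n)"
    and "\<And>n. (\<integral>\<omega>. (\<Sum>k. P k \<omega> powr \<alpha> * V k \<omega> * Z k \<omega>) ^ n \<partial>M) = ml_moment \<alpha> \<theta> n"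
proof -
  interpret prob_space M by fact
  have Pm [measurable]: "P k \<in> borel_measurable M" for k using P by (simp add: has_seq_law_def)
  have Vl: "V k \<in> borel_measurable M" "distr M borel (V k) = \<mu>" for k
    using V by (auto simp: iid_with_law_def has_law_def)
  have Zl: "Z k \<in> borel_measurable M" "distr M borel (Z k) = \<nu>" for k
    using Z by (auto simp: iid_with_law_def has_law_def)
  note [measurable] = Vl(1) Zl(1)
  have Pmeas: "(\<lambda>\<omega> k. P k \<omega>) \<in> M \<rightarrow>\<^sub>M seq_space" by (rule measurable_seq_spaceI) simp
  have AEP: "AE \<omega> in M. \<forall>k. 0 < P k \<omega>"
  proof -
    have "AE p in GEM \<beta> \<theta>. \<forall>k. 0 < p k"
      using AE_GEM[of \<beta> \<theta>] \<beta> \<theta> by (auto elim!: eventually_mono)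
    moreover have PG: "distr M seq_space (\<lambda>\<omega> k. P k \<omega>) = GEM \<beta> \<theta>" using P by (simp add: has_seq_law_def)
    ultimately have "AE p in distr M seq_space (\<lambda>\<omega> k. P k \<omega>). \<forall>k. 0 < p k"
      by (simp only: PG)
    then show ?thesis by (subst (asm) AE_distr_iff[OF Pmeas]) auto
  qed
  have AEV: "AE \<omega> in M. \<forall>k. 0 \<le> V k \<omega>"
  proof (subst AE_all_countable, intro allI)
    fix k
    have "AE x in distr M borel (V k). 0 \<le> x" using pos(1) unfolding Vl(2) .
    then show "AE \<omega> in M. 0 \<le> V k \<omega>" by (subst (asm) AE_distr_iff) auto
  qed
  have AEZ: "AE \<omega> in M. \<forall>k. 0 \<le> Z k \<omega>"
  proof (subst AE_all_countable, intro allI)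
    fix k
    have "AE x in distr M borel (Z k). 0 \<le> x" using pos(2) unfolding Zl(2) .
    then show "AE \<omega> in M. 0 \<le> Z k \<omega>" by (subst (asm) AE_distr_iff) auto
  qed
  show AEpos: "AE \<omega> in M. (\<forall>k. 0 < P k \<omega> \<and> 0 \<le> V k \<omega> \<and> 0 \<le> Z k \<omega>)"
    using AEP AEV AEZ by eventually_elim auto
  have "sets \<mu> = sets borel" "sets \<nu> = sets borel" using Vl(2)[of 0] Zl(2)[of 0] by auto
  have mom_eq: "(\<integral>\<^sup>+x. ennreal x ^ n \<partial>D) = (\<integral>\<^sup>+x. ennreal (x ^ n) \<partial>D)" if "AE x in D. 0 \<le> x" for D n
    using that by (intro nn_integral_cong_AE) (auto elim!: eventually_mono simp: ennreal_power)
  interpret two_sequences \<mu> \<nu> "ml_moment \<alpha> (- \<beta>)"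
  proof (rule two_sequences.intro)
    show "prob_space \<mu>" "prob_space \<nu>"
      using prob_space_distr[OF Vl(1), of 0] prob_space_distr[OF Zl(1), of 0] Vl(2) Zl(2) by auto
    show "0 \<le> ml_moment \<alpha> (- \<beta>) n" for n
      using \<beta> by (intro less_imp_le[OF ml_moment_pos]) auto
  qed (use pos mom_eq moments in \<open>simp_all add: \<open>sets \<mu> = sets borel\<close> \<open>sets \<nu> = sets borel\<close>\<close>)
  define X where "X m \<omega> = (\<Sum>k<m. P k \<omega> powr \<alpha> * V k \<omega> * Z k \<omega>)" for m \<omega>
  have [measurable]: "X m \<in> borel_measurable M" for m unfolding X_def by measurable
  have XW: "AE \<omega> in M. ennreal (X m \<omega> ^ n) = weighted_sum \<alpha> m (\<lambda>k. P k \<omega>) (\<lambda>k. V k \<omega>) (\<lambda>k. Z k \<omega>) ^ n" for m n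
    using AEpos
  proof eventually_elim
    case (elim \<omega>)
    then have "weighted_sum \<alpha> m (\<lambda>k. P k \<omega>) (\<lambda>k. V k \<omega>) (\<lambda>k. Z k \<omega>) = ennreal (X m \<omega>)"
      by (simp add: weighted_sum_def X_def ennreal_mult'[symmetric] mult.assoc)
    moreover have "0 \<le> X m \<omega>" using elim by (auto simp: X_def intro!: sum_nonneg mult_nonneg_nonneg)
    ultimately show ?case by (simp add: ennreal_power)
  qed
  have Xmom: "(\<integral>\<^sup>+\<omega>. ennreal (X m \<omega> ^ n) \<partial>M) = ennreal (ml_moment \<alpha> \<theta> n * stick_hit \<alpha> \<beta> m n \<theta>)" for m n
  proof -
    have "(\<integral>\<^sup>+\<omega>. ennreal (X m \<omega> ^ n) \<partial>M) = (\<integral>\<^sup>+\<omega>. (\<lambda>(p, v, z). weighted_sum \<alpha> m p v z ^ n) (\<lambda>k. P k \<omega>, \<lambda>k. V k \<omega>, \<lambda>k. Z k \<omega>) \<partial>M)"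
      using XW by (intro nn_integral_cong_AE) simp
    also have "\<dots> = (\<integral>\<^sup>+p. \<integral>\<^sup>+v. \<integral>\<^sup>+z. weighted_sum \<alpha> m p v z ^ n \<partial>Zs \<partial>Vs \<partial>GEM \<beta> \<theta>)"
      using P iid_with_law_distr[OF M V] iid_with_law_distr[OF M Z]
      by (subst indep_seqs3_nn_integral[OF M ind]) (simp_all add: has_seq_law_def)
    also have "\<dots> = ennreal (ml_moment \<alpha> \<theta> n * stick_hit \<alpha> \<beta> m n \<theta>)"
      using GEM_power_mean[OF \<beta> refl \<theta>] by (simp add: power_mean_def)
    finally show ?thesis .
  qed
  have mono: "AE \<omega> in M. mono (\<lambda>m. X m \<omega>)" and nonneg: "AE \<omega> in M. \<forall>m. 0 \<le> X m \<omega>"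
    using AEpos by (eventually_elim, auto simp: X_def intro!: monoI sum_mono2 sum_nonneg)+
  have lim: "(\<lambda>m. ml_moment \<alpha> \<theta> n * stick_hit \<alpha> \<beta> m n \<theta>) \<longlonglongrightarrow> ml_moment \<alpha> \<theta> n" for n
    using tendsto_mult_left[OF stick_hit_tendsto[OF \<beta>(1,2) \<theta>, of n], of "ml_moment \<alpha> \<theta> n"] by simp
  have nn: "0 \<le> ml_moment \<alpha> \<theta> n * stick_hit \<alpha> \<beta> m n \<theta>" "ml_moment \<alpha> \<theta> n * stick_hit \<alpha> \<beta> m n \<theta> \<le> ml_moment \<alpha> \<theta> n" for m n
    using stick_hit_bounds(1,2)[OF \<beta>(1,2) \<theta>, of m n] ml_moment_pos[of \<alpha> \<theta> n] \<beta> \<theta>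
    by (auto intro!: mult_nonneg_nonneg mult_left_le)
  show summ: "AE \<omega> in M. summable (\<lambda>k. P k \<omega> powr \<alpha> * V k \<omega> * Z k \<omega>)"
  proof -
    \<comment> \<open>Almost sure summability precedes any statement about the real series: the
      \<open>ennreal\<close> series has a finite integral, hence finite values almost
      everywhere.\<close>
    have "(\<integral>\<^sup>+\<omega>. (\<Sum>k. ennreal (P k \<omega> powr \<alpha> * V k \<omega> * Z k \<omega>)) \<partial>M) =
      (\<Sum>k. \<integral>\<^sup>+\<omega>. ennreal (P k \<omega> powr \<alpha> * V k \<omega> * Z k \<omega>) \<partial>M)"
      by (rule nn_integral_suminf) simp
    also have "\<dots> = (SUP m. \<Sum>k<m. \<integral>\<^sup>+\<omega>. ennreal (P k \<omega> powr \<alpha> * V k \<omega> * Z k \<omega>) \<partial>M)"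
      by (rule suminf_eq_SUP)
    also have "\<dots> \<le> ennreal (ml_moment \<alpha> \<theta> 1)"
    proof (rule SUP_least)
      fix m
      have "(\<Sum>k<m. \<integral>\<^sup>+\<omega>. ennreal (P k \<omega> powr \<alpha> * V k \<omega> * Z k \<omega>) \<partial>M) =
        (\<integral>\<^sup>+\<omega>. (\<Sum>k<m. ennreal (P k \<omega> powr \<alpha> * V k \<omega> * Z k \<omega>)) \<partial>M)"
        by (rule nn_integral_sum[symmetric]) simp
      also have "\<dots> = (\<integral>\<^sup>+\<omega>. ennreal (X m \<omega> ^ 1) \<partial>M)"
        using AEpos by (intro nn_integral_cong_AE) (auto elim!: eventually_mono simp: X_def)
      also have "\<dots> \<le> ennreal (ml_moment \<alpha> \<theta> 1)"
        unfolding Xmom using nn by (intro ennreal_leI)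
      finally show "(\<Sum>k<m. \<integral>\<^sup>+\<omega>. ennreal (P k \<omega> powr \<alpha> * V k \<omega> * Z k \<omega>) \<partial>M) \<le> ennreal (ml_moment \<alpha> \<theta> 1)" .
    qed
    finally have "(\<integral>\<^sup>+\<omega>. (\<Sum>k. ennreal (P k \<omega> powr \<alpha> * V k \<omega> * Z k \<omega>)) \<partial>M) \<noteq> \<infinity>"
      by (auto simp: top_unique)
    then have "AE \<omega> in M. (\<Sum>k. ennreal (P k \<omega> powr \<alpha> * V k \<omega> * Z k \<omega>)) \<noteq> \<infinity>"
      by (intro nn_integral_PInf_AE) simp_all
    with AEpos show ?thesis
      by eventually_elim (auto intro!: summable_suminf_not_top)
  qed
  let ?S = "\<lambda>\<omega>. \<Sum>k. P k \<omega> powr \<alpha> * V k \<omega> * Z k \<omega>"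
  have "has_bochner_integral M (\<lambda>\<omega>. ?S \<omega> ^ n) (ml_moment \<alpha> \<theta> n)" for n
  proof (rule has_bochner_integral_monotone_convergence[where f = "\<lambda>m \<omega>. X m \<omega> ^ n"])
    have hb: "has_bochner_integral M (\<lambda>\<omega>. X m \<omega> ^ n) (ml_moment \<alpha> \<theta> n * stick_hit \<alpha> \<beta> m n \<theta>)" for m
      using nn Xmom nonneg by (intro has_bochner_integral_nn_integral) (auto elim!: eventually_mono)
    show "integrable M (\<lambda>\<omega>. X m \<omega> ^ n)" for m using hb by (rule integrable.intros)
    show "AE \<omega> in M. mono (\<lambda>m. X m \<omega> ^ n)"
      using mono nonneg by eventually_elim (auto intro!: monoI power_mono dest: monoD)
    show "AE \<omega> in M. (\<lambda>m. X m \<omega> ^ n) \<longlonglongrightarrow> ?S \<omega> ^ n"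
      using summ unfolding X_def by eventually_elim (auto intro!: tendsto_power summable_LIMSEQ)
    show "(\<lambda>m. \<integral>\<omega>. X m \<omega> ^ n \<partial>M) \<longlonglongrightarrow> ml_moment \<alpha> \<theta> n"
      using lim by (simp add: has_bochner_integral_integral_eq[OF hb])
  qed simp
  then show "integrable M (\<lambda>\<omega>. ?S \<omega> ^ n)" "(\<integral>\<omega>. ?S \<omega> ^ n \<partial>M) = ml_moment \<alpha> \<theta> n" for n
    by (auto simp: has_bochner_integral_iff)
qed

text \<open>By independence the mean of the full sum is the mean of the weights times the mean
  \<open>c\<close> of one Mittag-Leffler variable. It equals \<open>c\<close> by the fixed point
  equation, and \<open>c\<close> is finite and positive, so it can be divided out.\<close>

lemma mean_stick_weight:
  assumes M: "prob_space M" and P: "has_seq_law M P G"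
    and V: "iid_with_law M V \<mu>" and Z: "iid_with_law M Z \<nu>" and ind: "indep_seqs M [P, V, Z]"
    and pos: "AE \<omega> in M. \<forall>k. 0 \<le> P k \<omega> \<and> 0 \<le> V k \<omega> \<and> 0 \<le> Z k \<omega>"
    and summ: "AE \<omega> in M. summable (\<lambda>k. P k \<omega> powr \<alpha> * V k \<omega> * Z k \<omega>)"
    and mean: "integrable M (\<lambda>\<omega>. \<Sum>k. P k \<omega> powr \<alpha> * V k \<omega> * Z k \<omega>)"
      "(\<integral>\<omega>. (\<Sum>k. P k \<omega> powr \<alpha> * V k \<omega> * Z k \<omega>) \<partial>M) = c"
    and Zmean: "(\<integral>\<^sup>+w. ennreal w \<partial>\<nu>) = ennreal c" and c: "0 < c"
  shows "AE \<omega> in M. summable (\<lambda>k. P k \<omega> powr \<alpha> * V k \<omega>)"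
    and "(\<integral>\<omega>. (\<Sum>k. P k \<omega> powr \<alpha> * V k \<omega>) \<partial>M) = 1"
proof -
  interpret prob_space M by fact
  have [measurable]: "P k \<in> borel_measurable M" "V k \<in> borel_measurable M" "Z k \<in> borel_measurable M" for k
    using P V Z by (auto simp: has_seq_law_def iid_with_law_def has_law_def)
  have [measurable]: "(\<lambda>\<omega> k. P k \<omega>) \<in> M \<rightarrow>\<^sub>M seq_space" "(\<lambda>\<omega> k. V k \<omega>) \<in> M \<rightarrow>\<^sub>M seq_space"
    "(\<lambda>\<omega> k. Z k \<omega>) \<in> M \<rightarrow>\<^sub>M seq_space"
    by (auto intro!: measurable_seq_spaceI)
  let ?DP = "distr M seq_space (\<lambda>\<omega> k. P k \<omega>)" and ?DV = "distr M seq_space (\<lambda>\<omega> k. V k \<omega>)"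
    and ?DZ = "distr M seq_space (\<lambda>\<omega> k. Z k \<omega>)"
  interpret DV: prob_space ?DV by (rule prob_space_distr) simp
  interpret DZ: prob_space ?DZ by (rule prob_space_distr) simp
  have Zc: "(\<integral>\<^sup>+z. ennreal (z k) \<partial>?DZ) = ennreal c" for k
  proof -
    have "(\<integral>\<^sup>+z. ennreal (z k) \<partial>?DZ) = (\<integral>\<^sup>+\<omega>. ennreal (Z k \<omega>) \<partial>M)"
      by (subst nn_integral_distr) simp_all
    also have "\<dots> = (\<integral>\<^sup>+w. ennreal w \<partial>distr M borel (Z k))"
      by (subst nn_integral_distr) simp_all
    also have "distr M borel (Z k) = \<nu>" using Z by (simp add: iid_with_law_def has_law_def)
    finally show ?thesis using Zmean by simp
  qed
  have trm: "(\<integral>\<^sup>+\<omega>. ennreal (P k \<omega> powr \<alpha>) * ennreal (V k \<omega>) * ennreal (Z k \<omega>) \<partial>M) =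
    (\<integral>\<^sup>+\<omega>. ennreal (P k \<omega> powr \<alpha>) * ennreal (V k \<omega>) \<partial>M) * ennreal c" for k
  proof -
    have "(\<integral>\<^sup>+\<omega>. ennreal (P k \<omega> powr \<alpha>) * ennreal (V k \<omega>) * ennreal (Z k \<omega>) \<partial>M) =
      (\<integral>\<^sup>+p. \<integral>\<^sup>+v. \<integral>\<^sup>+z. ennreal (p k powr \<alpha>) * ennreal (v k) * ennreal (z k) \<partial>?DZ \<partial>?DV \<partial>?DP)"
      using indep_seqs3_nn_integral[OF M ind, of "\<lambda>(p, v, z). ennreal (p k powr \<alpha>) * ennreal (v k) * ennreal (z k)"] by simp
    also have "\<dots> = (\<integral>\<^sup>+p. \<integral>\<^sup>+v. ennreal c * (ennreal (p k powr \<alpha>) * ennreal (v k)) \<partial>?DV \<partial>?DP)"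
    proof -
      have "(\<integral>\<^sup>+z. a * ennreal (z k) \<partial>?DZ) = ennreal c * a" for a
        by (subst nn_integral_cmult) (simp_all add: Zc mult.commute)
      then show ?thesis by simp
    qed
    also have "\<dots> = (\<integral>\<^sup>+p. ennreal c * (\<integral>\<^sup>+v. ennreal (p k powr \<alpha>) * ennreal (v k) \<partial>?DV) \<partial>?DP)"
      by (intro nn_integral_cong nn_integral_cmult) simp
    also have "\<dots> = ennreal c * (\<integral>\<^sup>+p. \<integral>\<^sup>+v. ennreal (p k powr \<alpha>) * ennreal (v k) \<partial>?DV \<partial>?DP)"
      by (rule nn_integral_cmult) measurable
    also have "(\<integral>\<^sup>+p. \<integral>\<^sup>+v. ennreal (p k powr \<alpha>) * ennreal (v k) \<partial>?DV \<partial>?DP) =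
      (\<integral>\<^sup>+\<omega>. ennreal (P k \<omega> powr \<alpha>) * ennreal (V k \<omega>) \<partial>M)"
      using indep_seqs3_nn_integral[OF M ind, of "\<lambda>(p, v, z). ennreal (p k powr \<alpha>) * ennreal (v k)"]
      by (simp add: DZ.emeasure_space_1[simplified])
    finally show ?thesis by (simp add: mult.commute)
  qed
  have "ennreal c = (\<integral>\<^sup>+\<omega>. ennreal (\<Sum>k. P k \<omega> powr \<alpha> * V k \<omega> * Z k \<omega>) \<partial>M)"
    using mean summ pos
    by (subst nn_integral_eq_integral) (auto elim!: eventually_elim2 intro!: suminf_nonneg)
  also have "\<dots> = (\<integral>\<^sup>+\<omega>. (\<Sum>k. ennreal (P k \<omega> powr \<alpha>) * ennreal (V k \<omega>) * ennreal (Z k \<omega>)) \<partial>M)"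
    using summ pos
  proof (intro nn_integral_cong_AE, eventually_elim)
    case (elim \<omega>)
    then show ?case by (subst suminf_ennreal2[symmetric]) (auto simp: ennreal_mult)
  qed
  also have "\<dots> = (\<Sum>k. (\<integral>\<^sup>+\<omega>. ennreal (P k \<omega> powr \<alpha>) * ennreal (V k \<omega>) \<partial>M) * ennreal c)"
    by (simp add: nn_integral_suminf trm)
  also have "\<dots> = (\<integral>\<^sup>+\<omega>. (\<Sum>k. ennreal (P k \<omega> powr \<alpha>) * ennreal (V k \<omega>)) \<partial>M) * ennreal c"
    by (simp add: nn_integral_suminf)
  \<comment> \<open>Division in \<open>ennreal\<close> is done by multiplying with
    \<open>1 / c\<close>.\<close>
  finally have "ennreal c * ennreal (1 / c) =
    (\<integral>\<^sup>+\<omega>. (\<Sum>k. ennreal (P k \<omega> powr \<alpha>) * ennreal (V k \<omega>)) \<partial>M) * ennreal c * ennreal (1 / c)" by simp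
  then have one: "(\<integral>\<^sup>+\<omega>. (\<Sum>k. ennreal (P k \<omega> powr \<alpha>) * ennreal (V k \<omega>)) \<partial>M) = 1"
    using c by (simp add: mult.assoc ennreal_mult'[symmetric])
  then have "AE \<omega> in M. (\<Sum>k. ennreal (P k \<omega> powr \<alpha>) * ennreal (V k \<omega>)) \<noteq> \<infinity>"
    by (intro nn_integral_PInf_AE) simp_all
  with pos show summ': "AE \<omega> in M. summable (\<lambda>k. P k \<omega> powr \<alpha> * V k \<omega>)"
    by eventually_elim (auto intro!: summable_suminf_not_top simp: ennreal_mult)
  have "(\<integral>\<^sup>+\<omega>. ennreal (\<Sum>k. P k \<omega> powr \<alpha> * V k \<omega>) \<partial>M) = 1"
    unfolding one[symmetric] using summ' pos
  proof (intro nn_integral_cong_AE, eventually_elim)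
    case (elim \<omega>)
    then show ?case by (subst suminf_ennreal2[symmetric]) (auto simp: ennreal_mult)
  qed
  moreover have "AE \<omega> in M. 0 \<le> (\<Sum>k. P k \<omega> powr \<alpha> * V k \<omega>)"
    using summ' pos by eventually_elim (auto intro!: suminf_nonneg)
  ultimately show "(\<integral>\<omega>. (\<Sum>k. P k \<omega> powr \<alpha> * V k \<omega>) \<partial>M) = 1"
    by (subst integral_eq_nn_integral) simp_all
qed

section \<open>The fixed point equation\<close>

text \<open>In terms of moments, \<open>W powr \<alpha>\<close> times an independent
  \<open>ML (\<alpha>, \<theta> + \<alpha>)\<close> variable is
  \<open>ML (\<alpha>, \<theta>)\<close> when \<open>W\<close> has law
  \<open>Beta (\<theta> + \<alpha>, 1 - \<alpha>)\<close>. With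
  \<open>\<theta> = (i - 1) * \<alpha> - \<beta>\<close> this is the law of the factor
  \<open>W i\<close>.\<close>

lemma ml_moment_shift_alpha:
  assumes a: "0 < \<alpha>" "\<alpha> < 1" and \<theta>: "- \<alpha> < \<theta>"
  shows "Beta (\<theta> + \<alpha> + real n * \<alpha>) (1 - \<alpha>) / Beta (\<theta> + \<alpha>) (1 - \<alpha>) * ml_moment \<alpha> (\<theta> + \<alpha>) n = ml_moment \<alpha> \<theta> n"
proof -
  define x where "x = \<theta> + \<alpha>"
  define c where "c = \<theta> / \<alpha> + 1"
  have x: "0 < x" using \<theta> by (simp add: x_def)
  have c: "0 < c" "x = \<alpha> * c" using a \<theta> by (auto simp: c_def x_def field_simps)
  have xn: "0 < x + real n * \<alpha>" using x a by (auto intro!: add_pos_nonneg)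
  have s: "x + real n * \<alpha> + (1 - \<alpha>) = \<theta> + real n * \<alpha> + 1" "x + (1 - \<alpha>) = \<theta> + 1" "x / \<alpha> = c"
    using a by (auto simp: x_def c_def field_simps)
  have g: "0 < Gamma (x + real n * \<alpha>)" "0 < Gamma x" "0 < Gamma (1 - \<alpha>)" "0 < Gamma (\<theta> + 1)" "0 < Gamma (\<theta> + real n * \<alpha> + 1)"
    using a x xn \<theta> by (intro Gamma_real_pos; simp add: x_def; linarith)+
  have pc: "c * pochhammer (c + 1) n = pochhammer c n * (c + real n)"
    using pochhammer_rec[of c n] pochhammer_Suc[of c n] by simp
  have alg: "(A * H / E) / (C * H / D) * (Q * (x * C) / (y * A)) = (x * Q / y) * D / E"
    if "A \<noteq> 0" "H \<noteq> 0" "C \<noteq> 0" "D \<noteq> 0" "E \<noteq> 0" "y \<noteq> 0" for A H C D E Q x y :: real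
    using that by (simp add: field_simps)
  have "Beta (x + real n * \<alpha>) (1 - \<alpha>) / Beta x (1 - \<alpha>) * ml_moment \<alpha> x n =
    (x * pochhammer (c + 1) n / (x + real n * \<alpha>)) * Gamma (\<theta> + 1) / Gamma (\<theta> + real n * \<alpha> + 1)"
    unfolding Beta_def ml_moment_def s Gamma_real_plus1[OF x] Gamma_real_plus1[OF xn]
    using g xn by (intro alg; linarith)
  also have "x * pochhammer (c + 1) n / (x + real n * \<alpha>) = pochhammer c n"
  proof -
    have "x * pochhammer (c + 1) n = pochhammer c n * (x + real n * \<alpha>)"
      using arg_cong[OF pc, of "\<lambda>z. \<alpha> * z"] by (simp add: c(2) algebra_simps)
    then show ?thesis using xn by simp
  qed
  finally show ?thesis by (simp add: x_def c_def ml_moment_def)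
qed

text \<open>The analogue with a shift by 1: a variable of law \<open>Beta ((\<theta> + \<alpha>) /
  \<alpha>, (1 - \<alpha>) / \<alpha>)\<close> times an independent
  \<open>ML (\<alpha>, \<theta> + 1)\<close> variable has the moments of
  \<open>ML (\<alpha>, \<theta>)\<close>. With \<open>\<theta> = i - 1 - \<beta>\<close> this is the
  law of the factor \<open>B i\<close>, used here without a power.\<close>

lemma ml_moment_shift_one:
  assumes a: "0 < \<alpha>" "\<alpha> < 1" and \<theta>: "- \<alpha> < \<theta>"
  shows "Beta ((\<theta> + \<alpha>) / \<alpha> + real n) ((1 - \<alpha>) / \<alpha>) / Beta ((\<theta> + \<alpha>) / \<alpha>) ((1 - \<alpha>) / \<alpha>) * ml_moment \<alpha> (\<theta> + 1) n =
    ml_moment \<alpha> \<theta> n"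
proof -
  define c where "c = \<theta> / \<alpha> + 1"
  \<comment> \<open>The sum of the two beta parameters, and at the same time the parameter in the
    Pochhammer symbol for \<open>\<theta> + 1\<close> before the shift by one.\<close>
  define d where "d = (\<theta> + 1) / \<alpha>"
  have c: "0 < c" "(\<theta> + \<alpha>) / \<alpha> = c" using a \<theta> by (auto simp: c_def field_simps)
  have d: "0 < d" "(1 - \<alpha>) / \<alpha> = d - c" "\<alpha> * d = \<theta> + 1" "0 < d - c"
    using a \<theta> by (auto simp: c_def d_def field_simps)
  have y: "0 < \<theta> + 1" "0 < \<theta> + real n * \<alpha> + 1"
  proof -
    have "0 \<le> real n * \<alpha>" using a by simp
    then show "0 < \<theta> + 1" "0 < \<theta> + real n * \<alpha> + 1" using a \<theta> by linarith+
  qed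
  have g: "0 < Gamma c" "0 < Gamma (d - c)" "0 < Gamma d" "0 < Gamma (\<theta> + 1)" "0 < Gamma (\<theta> + real n * \<alpha> + 1)"
    using c d y by (auto intro!: Gamma_real_pos)
  have pn: "pochhammer c n = Gamma (c + real n) / Gamma c" "pochhammer d n = Gamma (d + real n) / Gamma d"
    using c d nonpos_Ints_nonpos[of c] nonpos_Ints_nonpos[of d] by (auto intro!: pochhammer_Gamma)
  have gn: "0 < Gamma (c + real n)" "0 < Gamma (d + real n)" using c d by (auto intro!: Gamma_real_pos add_pos_nonneg)
  have pd: "d * pochhammer (d + 1) n = pochhammer d n * (d + real n)"
    using pochhammer_rec[of d n] pochhammer_Suc[of d n] by simp
  have pd': "(\<theta> + 1) * pochhammer (d + 1) n / (\<theta> + real n * \<alpha> + 1) = pochhammer d n"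
  proof -
    have "(\<theta> + 1) * pochhammer (d + 1) n = pochhammer d n * (\<theta> + real n * \<alpha> + 1)"
    proof -
      have "\<theta> + real n * \<alpha> + 1 = \<alpha> * (d + real n)" using d(3) by (simp add: algebra_simps)
      then show ?thesis using pd unfolding d(3)[symmetric] by (simp add: mult.assoc)
    qed
    then show ?thesis using y by simp
  qed
  have alg: "(A * H / E) / (C * H / D) * (Q * (x * F) / (y * G)) = A / C * (D / E) * (x * Q / y) * F / G"
    if "A \<noteq> 0" "H \<noteq> 0" "C \<noteq> 0" "D \<noteq> 0" "E \<noteq> 0" "y \<noteq> 0" "G \<noteq> 0" for A H C D E Q x y F G :: real
    using that by (simp add: field_simps)
  have s: "c + real n + (d - c) = d + real n" "c + (d - c) = d" "(\<theta> + 1) / \<alpha> = d" "\<theta> + 1 + real n * \<alpha> + 1 = (\<theta> + real n * \<alpha> + 1) + 1"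
    by (auto simp: d_def)
  have "Beta (c + real n) (d - c) / Beta c (d - c) * ml_moment \<alpha> (\<theta> + 1) n =
    Gamma (c + real n) / Gamma c * (Gamma d / Gamma (d + real n)) *
    ((\<theta> + 1) * pochhammer (d + 1) n / (\<theta> + real n * \<alpha> + 1)) * Gamma (\<theta> + 1) / Gamma (\<theta> + real n * \<alpha> + 1)"
    unfolding Beta_def ml_moment_def s Gamma_real_plus1[OF y(1)] Gamma_real_plus1[OF y(2)]
    using g y gn by (intro alg; linarith)
  also have "\<dots> = pochhammer c n * Gamma (\<theta> + 1) / Gamma (\<theta> + real n * \<alpha> + 1)"
    unfolding pd' pn using g gn by simp
  finally show ?thesis by (simp add: c(2) d(2) c_def ml_moment_def)
qed

lemma nn_integral_beta_law_power:
  assumes "0 < a" "0 < b" "0 < p"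
  shows "(\<integral>\<^sup>+x. ennreal ((x powr p) ^ n) \<partial>beta_law a b) = ennreal (Beta (a + real n * p) b / Beta a b)"
proof -
  have "(\<integral>\<^sup>+x. ennreal ((x powr p) ^ n) \<partial>beta_law a b) = (\<integral>\<^sup>+x. ennreal (x powr (real n * p) * (1 - x) powr 0) \<partial>beta_law a b)"
    using AE_beta_law[OF assms(1,2)]
    by (intro nn_integral_cong_AE, eventually_elim) (simp add: powr_power mult.commute)
  also have "\<dots> = ennreal (Beta (a + real n * p) (b + 0) / Beta a b)"
    using assms by (intro beta_law_powr_moment) (auto intro!: add_pos_nonneg)
  finally show ?thesis by simp
qed

text \<open>\<open>g\<close> is the \<alpha>-th power for the factors \<open>W i\<close> and the
  identity for the factors \<open>B i\<close>.\<close>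

lemma product_moment:
  assumes "prob_space M" and ind: "prob_space.indep_vars M (\<lambda>_. borel) X I" and I: "finite I"
    and law: "\<And>i. i \<in> I \<Longrightarrow> has_law M (X i) (D i)"
    and mom: "\<And>i. i \<in> I \<Longrightarrow> (\<integral>\<^sup>+x. ennreal (g x ^ n) \<partial>D i) = ennreal (m i)"
    and [measurable]: "g \<in> borel_measurable borel"
    and pos: "\<And>i. i \<in> I \<Longrightarrow> AE x in D i. 0 \<le> g x" and m: "\<And>i. i \<in> I \<Longrightarrow> 0 \<le> m i"
  shows "(\<integral>\<^sup>+x. ennreal (x ^ n) \<partial>distr M borel (\<lambda>\<omega>. \<Prod>i\<in>I. g (X i \<omega>))) = ennreal (\<Prod>i\<in>I. m i)"
    and "AE x in distr M borel (\<lambda>\<omega>. \<Prod>i\<in>I. g (X i \<omega>)). 0 \<le> x"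
proof -
  interpret prob_space M by fact
  have X [measurable]: "X i \<in> borel_measurable M" if "i \<in> I" for i
    using law[OF that] by (simp add: has_law_def)
  have D: "distr M borel (X i) = D i" if "i \<in> I" for i
    using law[OF that] by (simp add: has_law_def)
  have AEg: "AE \<omega> in M. \<forall>i\<in>I. 0 \<le> g (X i \<omega>)"
  proof (rule AE_finite_allI[OF I])
    fix i assume i: "i \<in> I"
    have "AE x in distr M borel (X i). 0 \<le> g x" using pos[OF i] unfolding D[OF i] .
    then show "AE \<omega> in M. 0 \<le> g (X i \<omega>)"
      by (subst (asm) AE_distr_iff) (use i in auto)
  qed
  have [measurable]: "(\<lambda>\<omega>. \<Prod>i\<in>I. g (X i \<omega>)) \<in> borel_measurable M" by simp
  show "AE x in distr M borel (\<lambda>\<omega>. \<Prod>i\<in>I. g (X i \<omega>)). 0 \<le> x"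
    by (subst AE_distr_iff) (use AEg in \<open>auto elim!: eventually_mono intro!: prod_nonneg\<close>)
  have "(\<integral>\<^sup>+x. ennreal (x ^ n) \<partial>distr M borel (\<lambda>\<omega>. \<Prod>i\<in>I. g (X i \<omega>))) = (\<integral>\<^sup>+\<omega>. ennreal ((\<Prod>i\<in>I. g (X i \<omega>)) ^ n) \<partial>M)"
    by (subst nn_integral_distr) simp_all
  also have "\<dots> = (\<integral>\<^sup>+\<omega>. (\<Prod>i\<in>I. ennreal (g (X i \<omega>) ^ n)) \<partial>M)"
    using AEg by (intro nn_integral_cong_AE) (auto elim!: eventually_mono simp: prod_ennreal prod_power_distrib)
  also have "\<dots> = (\<Prod>i\<in>I. \<integral>\<^sup>+\<omega>. ennreal (g (X i \<omega>) ^ n) \<partial>M)"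
    by (rule indep_vars_nn_integral[OF I indep_vars_compose2[OF ind, where Y = "\<lambda>_ x. ennreal (g x ^ n)"]]) auto
  also have "\<dots> = (\<Prod>i\<in>I. ennreal (m i))"
  proof (rule prod.cong[OF refl])
    fix i assume i: "i \<in> I"
    have "(\<integral>\<^sup>+\<omega>. ennreal (g (X i \<omega>) ^ n) \<partial>M) = (\<integral>\<^sup>+x. ennreal (g x ^ n) \<partial>distr M borel (X i))"
      using i by (subst nn_integral_distr) simp_all
    then show "(\<integral>\<^sup>+\<omega>. ennreal (g (X i \<omega>) ^ n) \<partial>M) = ennreal (m i)"
      unfolding D[OF i] mom[OF i] .
  qed
  finally show "(\<integral>\<^sup>+x. ennreal (x ^ n) \<partial>distr M borel (\<lambda>\<omega>. \<Prod>i\<in>I. g (X i \<omega>))) = ennreal (\<Prod>i\<in>I. m i)"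
    using m by (simp add: prod_ennreal)
qed

text \<open>Telescoping: the factor \<open>W i\<close> leads from the parameter
  \<open>i * \<alpha> - \<beta>\<close> down to \<open>(i - 1) * \<alpha> - \<beta>\<close>, so
  \<open>l\<close> factors lead from \<open>l * \<alpha> - \<beta>\<close> to
  \<open>- \<beta>\<close>.\<close>

lemma W_product_moments:
  fixes l :: nat
  assumes M: "prob_space M" and b: "0 \<le> \<beta>" "\<beta> < \<alpha>" "\<alpha> < 1"
    and ind: "prob_space.indep_vars M (\<lambda>_. borel) W {1..l}"
    and law: "\<And>i. i \<in> {1..l} \<Longrightarrow> has_law M (W i) (beta_law (real i * \<alpha> - \<beta>) (1 - \<alpha>))"
  shows "\<exists>c. 0 \<le> c \<and> (\<integral>\<^sup>+x. ennreal (x ^ n) \<partial>distr M borel (\<lambda>\<omega>. \<Prod>i=1..l. W i \<omega> powr \<alpha>)) = ennreal c \<and>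
      c * ml_moment \<alpha> (real l * \<alpha> - \<beta>) n = ml_moment \<alpha> (- \<beta>) n"
    and "AE x in distr M borel (\<lambda>\<omega>. \<Prod>i=1..l. W i \<omega> powr \<alpha>). 0 \<le> x"
proof -
  define m where "m i = Beta (real i * \<alpha> - \<beta> + real n * \<alpha>) (1 - \<alpha>) / Beta (real i * \<alpha> - \<beta>) (1 - \<alpha>)" for i :: nat
  have ip: "0 < real i * \<alpha> - \<beta>" if "1 \<le> i" for i :: nat
  proof -
    have "1 * \<alpha> \<le> real i * \<alpha>" using that b by (intro mult_right_mono) auto
    then show ?thesis using b by linarith
  qed
  have mp: "0 \<le> m i" if "i \<in> {1..l}" for i
    using ip[of i] that b unfolding m_def
    by (intro divide_nonneg_nonneg less_imp_le[OF Beta_real_pos] add_pos_nonneg) auto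
  have mom: "(\<integral>\<^sup>+x. ennreal ((x powr \<alpha>) ^ n) \<partial>beta_law (real i * \<alpha> - \<beta>) (1 - \<alpha>)) = ennreal (m i)" if "i \<in> {1..l}" for i
    using ip[of i] that b unfolding m_def by (intro nn_integral_beta_law_power) auto
  have tel: "(\<Prod>i=1..j. m i) * ml_moment \<alpha> (real j * \<alpha> - \<beta>) n = ml_moment \<alpha> (- \<beta>) n" for j
  proof (induction j)
    case (Suc j)
    have eq: "real (Suc j) * \<alpha> - \<beta> = real j * \<alpha> - \<beta> + \<alpha>" by (simp add: algebra_simps)
    have "m (Suc j) * ml_moment \<alpha> (real (Suc j) * \<alpha> - \<beta>) n = ml_moment \<alpha> (real j * \<alpha> - \<beta>) n"
      unfolding m_def eq using b ip[of "Suc j"] by (intro ml_moment_shift_alpha) (auto simp: algebra_simps)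
    with Suc show ?case by (simp add: mult.assoc)
  qed simp
  have 1: "(\<integral>\<^sup>+x. ennreal (x ^ n) \<partial>distr M borel (\<lambda>\<omega>. \<Prod>i=1..l. W i \<omega> powr \<alpha>)) = ennreal (\<Prod>i=1..l. m i)"
    by (rule product_moment(1)[OF M ind _ law mom]) (use mp in auto)
  show "AE x in distr M borel (\<lambda>\<omega>. \<Prod>i=1..l. W i \<omega> powr \<alpha>). 0 \<le> x"
    by (rule product_moment(2)[OF M ind _ law mom]) (use mp in auto)
  show "\<exists>c. 0 \<le> c \<and> (\<integral>\<^sup>+x. ennreal (x ^ n) \<partial>distr M borel (\<lambda>\<omega>. \<Prod>i=1..l. W i \<omega> powr \<alpha>)) = ennreal c \<and>
      c * ml_moment \<alpha> (real l * \<alpha> - \<beta>) n = ml_moment \<alpha> (- \<beta>) n"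
    using 1 tel mp by (intro exI[of _ "\<Prod>i=1..l. m i"]) (auto intro: prod_nonneg)
qed

text \<open>Telescoping in steps of length 1: the factor \<open>B i\<close> leads from the parameter
  \<open>i - \<beta>\<close> down to \<open>i - 1 - \<beta>\<close>.\<close>

lemma B_product_moments:
  fixes l :: nat
  assumes M: "prob_space M" and b: "0 \<le> \<beta>" "\<beta> < \<alpha>" "\<alpha> < 1"
    and ind: "prob_space.indep_vars M (\<lambda>_. borel) B {1..l}"
    and law: "\<And>i. i \<in> {1..l} \<Longrightarrow> has_law M (B i) (beta_law ((\<alpha> - \<beta> + real i - 1) / \<alpha>) ((1 - \<alpha>) / \<alpha>))"
  shows "\<exists>c. 0 \<le> c \<and> (\<integral>\<^sup>+x. ennreal (x ^ n) \<partial>distr M borel (\<lambda>\<omega>. \<Prod>i=1..l. B i \<omega>)) = ennreal c \<and>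
      c * ml_moment \<alpha> (real l - \<beta>) n = ml_moment \<alpha> (- \<beta>) n"
    and "AE x in distr M borel (\<lambda>\<omega>. \<Prod>i=1..l. B i \<omega>). 0 \<le> x"
proof -
  let ?a = "\<lambda>i::nat. (\<alpha> - \<beta> + real i - 1) / \<alpha>"
  define m where "m i = Beta (?a i + real n) ((1 - \<alpha>) / \<alpha>) / Beta (?a i) ((1 - \<alpha>) / \<alpha>)" for i :: nat
  have ip: "0 < ?a i" if "1 \<le> i" for i :: nat
    using that b by (intro divide_pos_pos) auto
  have mp: "0 \<le> m i" if "i \<in> {1..l}" for i
    using ip[of i] that b unfolding m_def
    by (intro divide_nonneg_nonneg less_imp_le[OF Beta_real_pos] add_pos_nonneg) auto
  have AEp: "AE x in beta_law (?a i) ((1 - \<alpha>) / \<alpha>). 0 \<le> x" if "i \<in> {1..l}" for i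
    using AE_beta_law[of "?a i" "(1 - \<alpha>) / \<alpha>"] ip[of i] that b by (auto elim!: eventually_mono)
  have mom: "(\<integral>\<^sup>+x. ennreal (x ^ n) \<partial>beta_law (?a i) ((1 - \<alpha>) / \<alpha>)) = ennreal (m i)" if "i \<in> {1..l}" for i
  proof -
    have "(\<integral>\<^sup>+x. ennreal (x ^ n) \<partial>beta_law (?a i) ((1 - \<alpha>) / \<alpha>)) = (\<integral>\<^sup>+x. ennreal ((x powr 1) ^ n) \<partial>beta_law (?a i) ((1 - \<alpha>) / \<alpha>))"
      using AEp[OF that] by (intro nn_integral_cong_AE) (auto elim!: eventually_mono)
    also have "\<dots> = ennreal (Beta (?a i + real n * 1) ((1 - \<alpha>) / \<alpha>) / Beta (?a i) ((1 - \<alpha>) / \<alpha>))"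
      using ip[of i] that b by (intro nn_integral_beta_law_power) auto
    finally show ?thesis by (simp add: m_def)
  qed
  have tel: "(\<Prod>i=1..j. m i) * ml_moment \<alpha> (real j - \<beta>) n = ml_moment \<alpha> (- \<beta>) n" for j
  proof (induction j)
    case (Suc j)
    have eq: "real (Suc j) - \<beta> = real j - \<beta> + 1" "\<alpha> - \<beta> + real (Suc j) - 1 = real j - \<beta> + \<alpha>" by simp_all
    have "m (Suc j) * ml_moment \<alpha> (real (Suc j) - \<beta>) n = ml_moment \<alpha> (real j - \<beta>) n"
      unfolding m_def eq using b by (intro ml_moment_shift_one) auto
    with Suc show ?case by (simp add: mult.assoc)
  qed simp
  have 1: "(\<integral>\<^sup>+x. ennreal (x ^ n) \<partial>distr M borel (\<lambda>\<omega>. \<Prod>i=1..l. B i \<omega>)) = ennreal (\<Prod>i=1..l. m i)"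
    by (rule product_moment(1)[OF M ind _ law, where g = "\<lambda>x. x"]) (use mp mom AEp in auto)
  show "AE x in distr M borel (\<lambda>\<omega>. \<Prod>i=1..l. B i \<omega>). 0 \<le> x"
    by (rule product_moment(2)[OF M ind _ law, where g = "\<lambda>x. x"]) (use mp mom AEp in auto)
  show "\<exists>c. 0 \<le> c \<and> (\<integral>\<^sup>+x. ennreal (x ^ n) \<partial>distr M borel (\<lambda>\<omega>. \<Prod>i=1..l. B i \<omega>)) = ennreal c \<and>
      c * ml_moment \<alpha> (real l - \<beta>) n = ml_moment \<alpha> (- \<beta>) n"
    using 1 tel mp by (intro exI[of _ "\<Prod>i=1..l. m i"]) (auto intro: prod_nonneg)
qed

lemma mittag_leffler_integrable_power:
  assumes \<alpha>: "0 < \<alpha>" "\<alpha> < 1" and f: "stable_density \<alpha> f" and \<theta>: "0 < \<theta>"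
  shows "integrable (mittag_leffler_law f \<alpha> \<theta>) (\<lambda>x. x ^ n)"
    and "(\<integral>x. x ^ n \<partial>mittag_leffler_law f \<alpha> \<theta>) = ml_moment \<alpha> \<theta> n"
proof -
  have "has_bochner_integral (mittag_leffler_law f \<alpha> \<theta>) (\<lambda>x. x ^ n) (ml_moment \<alpha> \<theta> n)"
    using mittag_leffler_moment[OF \<alpha> f \<theta>, of n] AE_mittag_leffler_pos[OF \<alpha> f \<theta>] ml_moment_pos[of \<alpha> \<theta> n] \<alpha> \<theta>
    by (intro has_bochner_integral_nn_integral)
      (auto elim!: eventually_mono simp: measurable_cong_sets[OF sets_mittag_leffler refl])
  then show "integrable (mittag_leffler_law f \<alpha> \<theta>) (\<lambda>x. x ^ n)"
    "(\<integral>x. x ^ n \<partial>mittag_leffler_law f \<alpha> \<theta>) = ml_moment \<alpha> \<theta> n"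
    by (auto simp: has_bochner_integral_iff)
qed

lemma mittag_leffler_moment_determinacy:
  assumes \<alpha>: "0 < \<alpha>" "\<alpha> < 1" and f: "stable_density \<alpha> f" and \<theta>: "0 < \<theta>"
    and "prob_space M" and X: "X \<in> borel_measurable M" "AE \<omega> in M. 0 \<le> X \<omega>"
    and int: "\<And>n. integrable M (\<lambda>\<omega>. X \<omega> ^ n)" and mom: "\<And>n. (\<integral>\<omega>. X \<omega> ^ n \<partial>M) = ml_moment \<alpha> \<theta> n"
  shows "distr M borel X = mittag_leffler_law f \<alpha> \<theta>"
proof (rule moment_determinacy)
  interpret prob_space M by fact
  note [measurable] = X(1)
  show "real_distribution (distr M borel X)"
    by (rule real_distribution_distr) simp
  show "real_distribution (mittag_leffler_law f \<alpha> \<theta>)"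
    using prob_space_mittag_leffler[OF \<alpha> f \<theta>] by (auto simp: real_distribution_def real_distribution_axioms_def)
  show "integrable (distr M borel X) (\<lambda>x. x ^ n)" for n
    using int by (subst integrable_distr_eq) auto
  show "integrable (mittag_leffler_law f \<alpha> \<theta>) (\<lambda>x. x ^ n)" for n by (rule mittag_leffler_integrable_power[OF \<alpha> f \<theta>])
  show "(\<integral>x. x ^ n \<partial>distr M borel X) = (\<integral>x. x ^ n \<partial>mittag_leffler_law f \<alpha> \<theta>)" for n
    unfolding mittag_leffler_integrable_power(2)[OF \<alpha> f \<theta>] mom[symmetric] by (subst integral_distr) auto
  show "AE x in distr M borel X. 0 \<le> x"
    using X(2) by (subst AE_distr_iff) auto
  show "AE x in mittag_leffler_law f \<alpha> \<theta>. 0 \<le> x"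
    using AE_mittag_leffler_pos[OF \<alpha> f \<theta>] by (auto elim!: eventually_mono)
  show "(\<lambda>n. t ^ n * (\<integral>x. x ^ n \<partial>mittag_leffler_law f \<alpha> \<theta>) / fact n) \<longlonglongrightarrow> 0" for t
    unfolding mittag_leffler_integrable_power(2)[OF \<alpha> f \<theta>] by (rule ml_moment_exp_small[OF \<alpha> \<theta>])
qed

text \<open>The common core of both equations. All that is asked of the weight law
  \<open>\<mu>\<close> is that its moments carry those for \<open>\<theta>\<close> into those for
  \<open>- \<beta>\<close>, the existential merely saying that they are finite.\<close>

lemma mittag_leffler_fixed_point:
  assumes M: "prob_space M" and \<beta>: "0 \<le> \<beta>" "\<beta> < \<alpha>" "\<alpha> < 1" and f: "stable_density \<alpha> f" and \<theta>: "0 < \<theta>"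
    and P: "has_seq_law M P (GEM \<beta> \<theta>)"
    and V: "iid_with_law M V \<mu>" and Z: "iid_with_law M Z (mittag_leffler_law f \<alpha> \<theta>)"
    and ind: "indep_seqs M [P, V, Z]" and pos: "AE x in \<mu>. 0 \<le> x"
    and moments: "\<And>n. \<exists>c. 0 \<le> c \<and> (\<integral>\<^sup>+x. ennreal (x ^ n) \<partial>\<mu>) = ennreal c \<and> c * ml_moment \<alpha> \<theta> n = ml_moment \<alpha> (- \<beta>) n"
    and Z0: "has_law M Z0 (mittag_leffler_law f \<alpha> \<theta>)"
  shows "(AE \<omega> in M. summable (\<lambda>k. P k \<omega> powr \<alpha> * V k \<omega> * Z k \<omega>)) \<and>
    distr M borel Z0 = distr M borel (\<lambda>\<omega>. \<Sum>k. P k \<omega> powr \<alpha> * V k \<omega> * Z k \<omega>) \<and>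
    (AE \<omega> in M. summable (\<lambda>k. P k \<omega> powr \<alpha> * V k \<omega>)) \<and>
    (\<integral>\<omega>. (\<Sum>k. P k \<omega> powr \<alpha> * V k \<omega>) \<partial>M) = 1"
proof -
  have \<alpha>: "0 < \<alpha>" "\<alpha> < 1" using \<beta> by auto
  have posZ: "AE x in mittag_leffler_law f \<alpha> \<theta>. 0 \<le> x"
    using AE_mittag_leffler_pos[OF \<alpha> f \<theta>] by (auto elim!: eventually_mono)
  have mom: "(\<integral>\<^sup>+x. ennreal (x ^ n) \<partial>\<mu>) * (\<integral>\<^sup>+w. ennreal (w ^ n) \<partial>mittag_leffler_law f \<alpha> \<theta>) = ennreal (ml_moment \<alpha> (- \<beta>) n)" for n
    using moments[of n] unfolding mittag_leffler_moment[OF \<alpha> f \<theta>] by (metis ennreal_mult')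
  note S = stick_sum_moments[OF M \<beta> \<theta> P V Z ind pos posZ mom]
  have [measurable]: "P k \<in> borel_measurable M" "V k \<in> borel_measurable M" "Z k \<in> borel_measurable M" for k
    using P V Z by (auto simp: has_seq_law_def iid_with_law_def has_law_def)
  have "AE \<omega> in M. 0 \<le> (\<Sum>k. P k \<omega> powr \<alpha> * V k \<omega> * Z k \<omega>)"
    using S(1,2) by eventually_elim (auto intro!: suminf_nonneg)
  then have "distr M borel (\<lambda>\<omega>. \<Sum>k. P k \<omega> powr \<alpha> * V k \<omega> * Z k \<omega>) = mittag_leffler_law f \<alpha> \<theta>"
    using S(3,4) by (intro mittag_leffler_moment_determinacy[OF \<alpha> f \<theta> M]) auto
  moreover have "distr M borel Z0 = mittag_leffler_law f \<alpha> \<theta>" using Z0 by (simp add: has_law_def)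
  moreover have "AE \<omega> in M. \<forall>k. 0 \<le> P k \<omega> \<and> 0 \<le> V k \<omega> \<and> 0 \<le> Z k \<omega>"
    using S(1) by eventually_elim (auto intro: less_imp_le)
  note mean_stick_weight[OF M P V Z ind this S(2)]
  moreover note this[where c = "ml_moment \<alpha> \<theta> 1"]
  ultimately show ?thesis
    using S(2) S(3,4)[of 1] mittag_leffler_moment[OF \<alpha> f \<theta>, of 1] ml_moment_pos[of \<alpha> \<theta> 1] \<alpha> \<theta> by simp
qed

section \<open>Marked Poisson sampling from GEM laws\<close>

text \<open>For a mass partition \<open>p\<close>, \<open>mark_survival s t p\<close> is the probability that no index is both
  marked (independently, with probability \<open>s\<close>) and hit by the points of a Poisson process of
  intensity \<open>t * p\<close>, that is, the product of \<open>1 - s * (1 - exp (- t * p a))\<close> over all \<open>a\<close>.\<close>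

lemma nn_integral_beta_gamma:
  fixes G :: "real \<Rightarrow> real \<Rightarrow> ennreal"
  assumes [measurable]: "(\<lambda>(u, v). G u v) \<in> borel_measurable (borel \<Otimes>\<^sub>M borel)" and ab: "0 < a" "0 < b"
  shows "(\<integral>\<^sup>+t. ennreal (t powr (a + b - 1)) * (\<integral>\<^sup>+r. G (t * r) (t * (1 - r)) \<partial>beta_law a b) * indicator {0<..} t \<partial>lborel) =
    ennreal (1 / Beta a b) * (\<integral>\<^sup>+u. \<integral>\<^sup>+v. ennreal (u powr (a - 1)) * ennreal (v powr (b - 1)) * G u v *
      indicator {0<..} v * indicator {0<..} u \<partial>lborel \<partial>lborel)"
proof -
  have B: "0 < Beta a b" using ab by (rule Beta_real_pos)
  let ?F = "\<lambda>t u. ennreal (u powr (a - 1)) * ennreal ((t - u) powr (b - 1)) * G u (t - u) * indicator {0<..} (t - u)"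
  have inner: "ennreal (t powr (a + b - 1)) * (\<integral>\<^sup>+r. G (t * r) (t * (1 - r)) \<partial>beta_law a b) * indicator {0<..} t =
    ennreal (1 / Beta a b) * (\<integral>\<^sup>+u. ?F t u * indicator {0<..} u \<partial>lborel)" (is "?l = ?r") for t
  proof (cases "0 < t")
    case True
    have "(\<integral>\<^sup>+u. ?F t u * indicator {0<..} u \<partial>lborel) = ennreal t * (\<integral>\<^sup>+r. ?F t (t * r) * indicator {0<..} r \<partial>lborel)"
      by (rule nn_integral_scale_subst[of "?F t"]) (use True in auto)
    then have "?r = (\<integral>\<^sup>+r. ennreal (1 / Beta a b) * (ennreal t * (?F t (t * r) * indicator {0<..} r)) \<partial>lborel)"
      by (simp add: nn_integral_cmult)
    also have "\<dots> = (\<integral>\<^sup>+r. ennreal (t powr (a + b - 1)) *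
      (ennreal (indicator {0<..<1} r * r powr (a - 1) * (1 - r) powr (b - 1) / Beta a b) * G (t * r) (t * (1 - r))) \<partial>lborel)"
    proof (intro nn_integral_cong)
      fix r :: real
      show "ennreal (1 / Beta a b) * (ennreal t * (?F t (t * r) * indicator {0<..} r)) =
        ennreal (t powr (a + b - 1)) *
        (ennreal (indicator {0<..<1} r * r powr (a - 1) * (1 - r) powr (b - 1) / Beta a b) * G (t * r) (t * (1 - r)))"
      proof (cases "0 < r \<and> r < 1")
        case r: True
        have e: "t - t * r = t * (1 - r)" by (simp add: algebra_simps)
        have "t * ((t * r) powr (a - 1) * (t * (1 - r)) powr (b - 1)) = t powr (a + b - 1) * (r powr (a - 1) * (1 - r) powr (b - 1))"
        proof -
          have "t * (t powr (a - 1) * t powr (b - 1)) = t powr (a + b - 1)"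
            using True by (simp add: powr_add[symmetric] powr_mult_base algebra_simps)
          moreover have "t * ((t * r) powr (a - 1) * (t * (1 - r)) powr (b - 1)) =
            (t * (t powr (a - 1) * t powr (b - 1))) * (r powr (a - 1) * (1 - r) powr (b - 1))"
            using r True by (simp add: powr_mult mult_ac)
          ultimately show ?thesis by simp
        qed
        then have "1 / Beta a b * (t * ((t * r) powr (a - 1) * (t * (1 - r)) powr (b - 1))) =
          t powr (a + b - 1) * (r powr (a - 1) * (1 - r) powr (b - 1) / Beta a b)" by simp
        then have "ennreal (1 / Beta a b) * (ennreal t * (ennreal ((t * r) powr (a - 1)) * ennreal ((t * (1 - r)) powr (b - 1)))) =
          ennreal (t powr (a + b - 1)) * ennreal (r powr (a - 1) * (1 - r) powr (b - 1) / Beta a b)"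
          using B True by (simp add: ennreal_mult'[symmetric])
        then have "ennreal (1 / Beta a b) * (ennreal t * (ennreal ((t * r) powr (a - 1)) * ennreal ((t * (1 - r)) powr (b - 1)))) * G (t * r) (t * (1 - r)) =
          ennreal (t powr (a + b - 1)) * ennreal (r powr (a - 1) * (1 - r) powr (b - 1) / Beta a b) * G (t * r) (t * (1 - r))"
          by (rule arg_cong)
        moreover have "indicator {0<..} (t * (1 - r)) = (1::ennreal)" using r True by simp
        ultimately show ?thesis using r unfolding e by (simp add: mult.assoc)
      next
        case False
        then have "indicator {0<..} (t - t * r) * indicator {0<..} r = (0::ennreal)"
          using True by (auto simp: indicator_def mult_less_cancel_left1)
        with False show ?thesis by (auto simp: indicator_def)
      qed
    qed
    also have "\<dots> = ennreal (t powr (a + b - 1)) * (\<integral>\<^sup>+r. G (t * r) (t * (1 - r)) \<partial>beta_law a b)"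
      using ab by (subst nn_integral_beta_law) (simp_all add: nn_integral_cmult)
    finally show ?thesis using True by simp
  next
    case False
    then have z: "?F t u * indicator {0<..} u = 0" for u by (auto simp: indicator_def)
    have "(\<integral>\<^sup>+u. ?F t u * indicator {0<..} u \<partial>lborel) = 0" unfolding z by simp
    with False show ?thesis by simp
  qed
  have "(\<integral>\<^sup>+t. ennreal (t powr (a + b - 1)) * (\<integral>\<^sup>+r. G (t * r) (t * (1 - r)) \<partial>beta_law a b) * indicator {0<..} t \<partial>lborel) =
    ennreal (1 / Beta a b) * (\<integral>\<^sup>+t. \<integral>\<^sup>+u. ?F t u * indicator {0<..} u \<partial>lborel \<partial>lborel)"
    unfolding inner by (rule nn_integral_cmult) measurable
  also have "(\<integral>\<^sup>+t. \<integral>\<^sup>+u. ?F t u * indicator {0<..} u \<partial>lborel \<partial>lborel) = (\<integral>\<^sup>+u. \<integral>\<^sup>+t. ?F t u * indicator {0<..} u \<partial>lborel \<partial>lborel)"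
    by (rule lborel_pair.Fubini') measurable
  also have "\<dots> = (\<integral>\<^sup>+u. \<integral>\<^sup>+v. ennreal (u powr (a - 1)) * ennreal (v powr (b - 1)) * G u v *
      indicator {0<..} v * indicator {0<..} u \<partial>lborel \<partial>lborel)"
  proof (rule nn_integral_cong)
    fix u :: real
    \<comment> \<open>For fixed \<open>u\<close> the total time is written as \<open>u + v\<close>,
      so that the two parts become separate variables.\<close>
    have "(\<integral>\<^sup>+t. ?F t u * indicator {0<..} u \<partial>lborel) = ennreal \<bar>1\<bar> * (\<integral>\<^sup>+v. ?F (u + 1 * v) u * indicator {0<..} u \<partial>lborel)"
      by (rule nn_integral_real_affine) measurable
    then show "(\<integral>\<^sup>+t. ?F t u * indicator {0<..} u \<partial>lborel) =
      (\<integral>\<^sup>+v. ennreal (u powr (a - 1)) * ennreal (v powr (b - 1)) * G u v * indicator {0<..} v * indicator {0<..} u \<partial>lborel)"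
      by simp
  qed
  finally show ?thesis .
qed

lemma Gamma_density_integral:
  assumes \<theta>: "0 < \<theta>" and c: "0 < c"
  shows "(\<integral>\<^sup>+t. ennreal (t powr (\<theta> - 1) * exp (- c * t) / Gamma \<theta>) * indicator {0<..} t \<partial>lborel) = ennreal (c powr (- \<theta>))"
proof -
  have G: "Gamma \<theta> \<noteq> 0" "0 < Gamma \<theta>" using Gamma_real_pos[OF \<theta>] by auto
  have "(\<integral>\<^sup>+t. ennreal (t powr (\<theta> - 1) * exp (- c * t) / Gamma \<theta>) * indicator {0<..} t \<partial>lborel) =
    (\<integral>\<^sup>+t. ennreal (1 / Gamma \<theta>) * (ennreal (t powr (\<theta> - 1) * exp (- c * t)) * indicator {0<..} t) \<partial>lborel)"
    using G by (intro nn_integral_cong) (simp add: ennreal_mult'[symmetric] mult.assoc[symmetric])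
  also have "\<dots> = ennreal (1 / Gamma \<theta>) * ennreal (Gamma \<theta> * c powr (- \<theta>))"
    by (subst nn_integral_cmult) (simp_all only: nn_integral_Gamma_scaled[OF \<theta> c], measurable)
  also have "\<dots> = ennreal (c powr (- \<theta>))" using G by (simp add: ennreal_mult'[symmetric])
  finally show "(\<integral>\<^sup>+t. ennreal (t powr (\<theta> - 1) * exp (- c * t) / Gamma \<theta>) * indicator {0<..} t \<partial>lborel) = ennreal (c powr (- \<theta>))" .
qed

lemma Gamma_density_mean:
  assumes \<theta>: "0 < \<theta>" and c: "0 < c" and k: "0 \<le> k"
  shows "(\<integral>\<^sup>+t. ennreal (t powr (\<theta> - 1) * exp (- c * t) / Gamma \<theta>) * ennreal (k * t) * indicator {0<..} t \<partial>lborel) = ennreal (k * \<theta> * c powr (- \<theta> - 1))"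
proof -
  have G: "Gamma \<theta> \<noteq> 0" "0 < Gamma \<theta>" using Gamma_real_pos[OF \<theta>] by auto
  have "(\<integral>\<^sup>+t. ennreal (t powr (\<theta> - 1) * exp (- c * t) / Gamma \<theta>) * ennreal (k * t) * indicator {0<..} t \<partial>lborel) =
    (\<integral>\<^sup>+t. ennreal (k / Gamma \<theta>) * (ennreal (t powr (\<theta> + 1 - 1) * exp (- c * t)) * indicator {0<..} t) \<partial>lborel)"
  proof (intro nn_integral_cong)
    fix t :: real
    have "t powr (\<theta> - 1) * exp (- c * t) / Gamma \<theta> * (k * t) = k / Gamma \<theta> * (t powr (\<theta> + 1 - 1) * exp (- c * t))" if "0 < t"
      using that by (simp add: powr_diff)
    then show "ennreal (t powr (\<theta> - 1) * exp (- c * t) / Gamma \<theta>) * ennreal (k * t) * indicator {0<..} t =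
      ennreal (k / Gamma \<theta>) * (ennreal (t powr (\<theta> + 1 - 1) * exp (- c * t)) * indicator {0<..} t)"
      using G k by (cases "0 < t") (auto simp: ennreal_mult'[symmetric] ennreal_mult''[symmetric])
  qed
  also have "\<dots> = ennreal (k / Gamma \<theta>) * ennreal (Gamma (\<theta> + 1) * c powr (- (\<theta> + 1)))"
    using \<theta> c nn_integral_Gamma_scaled[of "\<theta> + 1" c] by (subst nn_integral_cmult) simp_all
  also have "\<dots> = ennreal (k / Gamma \<theta> * (Gamma (\<theta> + 1) * c powr (- (\<theta> + 1))))"
    using G k by (intro ennreal_mult'[symmetric]) simp
  also have "k / Gamma \<theta> * (Gamma (\<theta> + 1) * c powr (- (\<theta> + 1))) = k * \<theta> * c powr (- \<theta> - 1)"
    unfolding Gamma_real_plus1[OF \<theta>] using G(1) by simp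
  finally show "(\<integral>\<^sup>+t. ennreal (t powr (\<theta> - 1) * exp (- c * t) / Gamma \<theta>) * ennreal (k * t) * indicator {0<..} t \<partial>lborel) = ennreal (k * \<theta> * c powr (- \<theta> - 1))" .
qed

text \<open>Mass at most 1 is what the partial sums in \<open>AE_GEM\<close> give, and it is
  preserved by rearrangement.\<close>

definition sub_mass :: "(nat \<Rightarrow> real) \<Rightarrow> bool" where
  "sub_mass p \<longleftrightarrow> (\<forall>a. 0 \<le> p a) \<and> summable p \<and> (\<Sum>a. p a) \<le> 1"

lemma AE_GEM_sub_mass:
  assumes "0 \<le> \<gamma>" "\<gamma> < 1" "- \<gamma> < \<theta>"
  shows "AE p in GEM \<gamma> \<theta>. sub_mass p"
  using AE_GEM[OF assms]
proof eventually_elim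
  case (elim p)
  then have nn: "0 \<le> p a" for a by (auto intro: less_imp_le)
  then have "summable p" using elim by (intro summableI_nonneg_bounded[of p 1]) auto
  moreover from this have "(\<Sum>a. p a) \<le> 1" using elim by (intro suminf_le_const) auto
  ultimately show ?case using nn by (simp add: sub_mass_def)
qed

text \<open>The negative logarithm of the factor of an atom hit at rate \<open>x\<close>. In this
  form the infinite product is a series of nonnegative terms, dominated by the masses, and such sums
  are what the rearrangement argument can handle.\<close>

definition mark_rate :: "real \<Rightarrow> real \<Rightarrow> real" where
  "mark_rate s x = - ln (1 - s * (1 - exp (- x)))"

definition mark_survival :: "real \<Rightarrow> real \<Rightarrow> (nat \<Rightarrow> real) \<Rightarrow> real" where
  "mark_survival s t p = exp (- (\<Sum>a. mark_rate s (t * p a)))"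

lemma measurable_mark_rate [measurable]: "mark_rate s \<in> borel_measurable borel"
  unfolding mark_rate_def[abs_def] by measurable

lemma measurable_mark_survival [measurable (raw)]:
  assumes [measurable]: "f \<in> borel_measurable M" "\<And>k. (\<lambda>x. g x k) \<in> borel_measurable M"
  shows "(\<lambda>x. mark_survival s (f x) (g x)) \<in> borel_measurable M"
  unfolding mark_survival_def by measurable

section \<open>Survival probability of a fixed mass partition\<close>

context
  fixes s :: real
  assumes s: "0 \<le> s" "s < 1"
begin

lemma mark_factor_pos:
  assumes "0 \<le> x"
  shows "0 < 1 - s * (1 - exp (- x))" "1 - s * (1 - exp (- x)) \<le> 1"
proof -
  have "s * (1 - exp (- x)) \<le> s * 1" using s assms by (intro mult_left_mono) auto
  with s show "0 < 1 - s * (1 - exp (- x))" by simp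
  show "1 - s * (1 - exp (- x)) \<le> 1" using s assms by simp
qed

lemma exp_mark_rate: "0 \<le> x \<Longrightarrow> exp (- mark_rate s x) = 1 - s * (1 - exp (- x))"
  using mark_factor_pos[of x] by (simp add: mark_rate_def)

lemma mark_rate_nonneg: "0 \<le> x \<Longrightarrow> 0 \<le> mark_rate s x"
  using mark_factor_pos[of x] by (simp add: mark_rate_def)

lemma mark_rate_le:
  assumes "0 \<le> x"
  shows "mark_rate s x \<le> s / (1 - s) * x"
proof -
  let ?y = "1 - s * (1 - exp (- x))"
  have e: "1 - exp (- x) \<le> x" using exp_ge_add_one_self[of "- x"] by simp
  have y: "1 - s \<le> ?y" using mult_left_mono[of "1 - exp (- x)" 1 s] s by simp
  have "mark_rate s x = ln (1 / ?y)"
    using mark_factor_pos[OF assms] by (simp add: mark_rate_def ln_div)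
  \<comment> \<open>The constant \<open>s / (1 - s)\<close> arises from
    \<open>ln z \<le> z - 1\<close> at \<open>z = 1 / ?y\<close>, together with the lower bound
    \<open>1 - s\<close> for \<open>?y\<close>.\<close>
  also have "\<dots> \<le> 1 / ?y - 1"
    using mark_factor_pos[OF assms] by (intro ln_le_minus_one) simp
  also have "\<dots> = s * (1 - exp (- x)) / ?y"
    using mark_factor_pos[OF assms] by (simp add: field_simps)
  also have "\<dots> \<le> s * x / (1 - s)"
    using s e y assms by (intro frac_le mult_left_mono) auto
  finally show ?thesis by simp
qed

lemma summable_mark_rate:
  assumes p: "sub_mass p" and t: "0 \<le> t"
  shows "summable (\<lambda>a. mark_rate s (t * p a))"
proof (rule summable_comparison_test'[where N = 0])
  show "summable (\<lambda>a. s / (1 - s) * (t * p a))" using p by (intro summable_mult) (simp add: sub_mass_def)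
  show "norm (mark_rate s (t * p a)) \<le> s / (1 - s) * (t * p a)" for a
    using mark_rate_le[of "t * p a"] mark_rate_nonneg[of "t * p a"] p t by (simp add: sub_mass_def)
qed

lemma mark_survival_pos: "0 < mark_survival s t p"
  by (simp add: mark_survival_def)

lemma mark_survival_le_1:
  assumes p: "sub_mass p" and t: "0 \<le> t"
  shows "mark_survival s t p \<le> 1"
proof -
  have "0 \<le> (\<Sum>a. mark_rate s (t * p a))"
    using p t by (intro suminf_nonneg summable_mark_rate mark_rate_nonneg) (auto simp: sub_mass_def)
  then show ?thesis by (simp add: mark_survival_def)
qed

lemma mark_survival_ge:
  assumes p: "sub_mass p" and t: "0 \<le> t"
  shows "1 - s / (1 - s) * t \<le> mark_survival s t p"
proof -
  have summ: "summable (\<lambda>a. s / (1 - s) * (t * p a))" using p by (intro summable_mult) (simp add: sub_mass_def)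
  have "(\<Sum>a. mark_rate s (t * p a)) \<le> (\<Sum>a. s / (1 - s) * (t * p a))"
    using p t by (intro suminf_le mark_rate_le summable_mark_rate summ) (auto simp: sub_mass_def)
  also have "\<dots> = s / (1 - s) * t * (\<Sum>a. p a)"
    using suminf_mult[of p "s / (1 - s) * t"] p by (simp only: sub_mass_def mult.assoc)
  also have "\<dots> \<le> s / (1 - s) * t * 1"
    using p s t by (intro mult_left_mono) (auto simp: sub_mass_def)
  finally have "1 - s / (1 - s) * t \<le> 1 + (- (\<Sum>a. mark_rate s (t * p a)))" by simp
  also have "\<dots> \<le> mark_survival s t p" unfolding mark_survival_def by (rule exp_ge_add_one_self)
  finally show ?thesis .
qed

lemma mark_survival_case_nat:
  assumes p: "sub_mass p" and t: "0 \<le> t" and r: "0 \<le> r" "r \<le> 1"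
  shows "mark_survival s t (case_nat r (\<lambda>k. (1 - r) * p k)) =
    (1 - s * (1 - exp (- (t * r)))) * mark_survival s (t * (1 - r)) p"
proof -
  define h where "h a = mark_rate s (t * case_nat r (\<lambda>k. (1 - r) * p k) a)" for a
  have Suc: "h (Suc a) = mark_rate s (t * (1 - r) * p a)" and 0: "h 0 = mark_rate s (t * r)" for a
    by (simp_all add: h_def mult.assoc)
  have "summable (\<lambda>a. h (Suc a))"
    unfolding Suc using p t r by (intro summable_mark_rate) auto
  then have "summable h" by (simp only: summable_Suc_iff)
  from suminf_split_head[OF this] have "(\<Sum>a. h a) = mark_rate s (t * r) + (\<Sum>a. mark_rate s (t * (1 - r) * p a))"
    unfolding Suc 0 by simp
  then show ?thesis
    using t r unfolding h_def by (simp add: mark_survival_def exp_diff exp_minus[symmetric] exp_add[symmetric] flip: exp_mark_rate)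
qed

definition GEM_survival :: "real \<Rightarrow> real \<Rightarrow> real \<Rightarrow> ennreal" where
  "GEM_survival \<alpha> \<theta> t = (\<integral>\<^sup>+p. ennreal (mark_survival s t p) \<partial>GEM \<alpha> \<theta>)"

text \<open>The normalising factor \<open>c powr \<theta>\<close> of the Gamma density with rate
  \<open>c\<close> is left out; without it the recursion over \<open>\<theta>\<close> is an integral
  over all rates above \<open>c\<close>. The factor returns in
  \<open>neg_binomial_sampled\<close>.\<close>

definition GEM_transform :: "real \<Rightarrow> real \<Rightarrow> real \<Rightarrow> ennreal" where
  "GEM_transform \<alpha> \<theta> c =
    (\<integral>\<^sup>+t. ennreal (t powr (\<theta> - 1) * exp (- c * t) / Gamma \<theta>) * GEM_survival \<alpha> \<theta> t * indicator {0<..} t \<partial>lborel)"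

section \<open>Survival averaged over a GEM law at a Gamma time\<close>

context
  fixes \<alpha> :: real
  assumes \<alpha>: "0 < \<alpha>" "\<alpha> < 1"
begin

lemma measurable_GEM_survival:
  assumes \<theta>: "0 < \<theta>" and [measurable]: "f \<in> borel_measurable M"
  shows "(\<lambda>x. GEM_survival \<alpha> \<theta> (f x)) \<in> borel_measurable M"
proof -
  interpret prob_space "GEM \<alpha> \<theta>" using \<alpha> \<theta> by (intro prob_space_GEM) auto
  have "GEM_survival \<alpha> \<theta> \<in> borel_measurable borel"
    unfolding GEM_survival_def[abs_def] by measurable
  then show ?thesis by measurable
qed

lemma GEM_survival_step:
  assumes \<theta>: "0 < \<theta>" and t: "0 \<le> t"
  shows "GEM_survival \<alpha> \<theta> t =
    (\<integral>\<^sup>+r. ennreal (1 - s * (1 - exp (- (t * r)))) * GEM_survival \<alpha> (\<theta> + \<alpha>) (t * (1 - r)) \<partial>beta_law (1 - \<alpha>) (\<theta> + \<alpha>))"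
proof -
  have "GEM_survival \<alpha> \<theta> t = (\<integral>\<^sup>+r. \<integral>\<^sup>+p. ennreal (mark_survival s t (case_nat r (\<lambda>k. (1 - r) * p k)))
    \<partial>GEM \<alpha> (\<theta> + \<alpha>) \<partial>beta_law (1 - \<alpha>) (\<theta> + \<alpha>))"
    unfolding GEM_survival_def using \<alpha> \<theta> by (intro nn_integral_GEM_unfold) auto
  also have "\<dots> = (\<integral>\<^sup>+r. ennreal (1 - s * (1 - exp (- (t * r)))) * GEM_survival \<alpha> (\<theta> + \<alpha>) (t * (1 - r)) \<partial>beta_law (1 - \<alpha>) (\<theta> + \<alpha>))"
  proof (intro nn_integral_cong_AE)
    have "AE r in beta_law (1 - \<alpha>) (\<theta> + \<alpha>). 0 < r \<and> r < 1" using \<alpha> \<theta> by (intro AE_beta_law) auto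
    then show "AE r in beta_law (1 - \<alpha>) (\<theta> + \<alpha>).
      (\<integral>\<^sup>+p. ennreal (mark_survival s t (case_nat r (\<lambda>k. (1 - r) * p k))) \<partial>GEM \<alpha> (\<theta> + \<alpha>)) =
      ennreal (1 - s * (1 - exp (- (t * r)))) * GEM_survival \<alpha> (\<theta> + \<alpha>) (t * (1 - r))"
    proof eventually_elim
      case (elim r)
      have "(\<integral>\<^sup>+p. ennreal (mark_survival s t (case_nat r (\<lambda>k. (1 - r) * p k))) \<partial>GEM \<alpha> (\<theta> + \<alpha>)) =
        (\<integral>\<^sup>+p. ennreal (1 - s * (1 - exp (- (t * r)))) * ennreal (mark_survival s (t * (1 - r)) p) \<partial>GEM \<alpha> (\<theta> + \<alpha>))"
      proof (intro nn_integral_cong_AE)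
        have "AE p in GEM \<alpha> (\<theta> + \<alpha>). sub_mass p" using \<alpha> \<theta> by (intro AE_GEM_sub_mass) auto
        then show "AE p in GEM \<alpha> (\<theta> + \<alpha>). ennreal (mark_survival s t (case_nat r (\<lambda>k. (1 - r) * p k))) =
          ennreal (1 - s * (1 - exp (- (t * r)))) * ennreal (mark_survival s (t * (1 - r)) p)"
          by eventually_elim (use elim t mark_factor_pos[of "t * r"] mark_survival_pos in
            \<open>simp add: mark_survival_case_nat ennreal_mult'[symmetric]\<close>)
      qed
      then show ?case by (simp add: GEM_survival_def nn_integral_cmult)
    qed
  qed
  finally show ?thesis .
qed

text \<open>The lower bound is kept additive because subtraction in \<open>ennreal\<close>
  truncates. It is the first-order estimate from which the comparison with the closed form
  starts.\<close>

lemma GEM_survival_bounds: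
  assumes \<theta>: "0 < \<theta>" and t: "0 \<le> t"
  shows "GEM_survival \<alpha> \<theta> t \<le> 1" "1 \<le> GEM_survival \<alpha> \<theta> t + ennreal (s / (1 - s) * t)"
proof -
  interpret prob_space "GEM \<alpha> \<theta>" using \<alpha> \<theta> by (intro prob_space_GEM) auto
  have AE: "AE p in GEM \<alpha> \<theta>. sub_mass p" using \<alpha> \<theta> by (intro AE_GEM_sub_mass) auto
  have "GEM_survival \<alpha> \<theta> t \<le> (\<integral>\<^sup>+p. 1 \<partial>GEM \<alpha> \<theta>)"
    unfolding GEM_survival_def
  proof (rule nn_integral_mono_AE)
    show "AE p in GEM \<alpha> \<theta>. ennreal (mark_survival s t p) \<le> 1"
      using AE by eventually_elim (simp add: mark_survival_le_1[OF _ t])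
  qed
  then show "GEM_survival \<alpha> \<theta> t \<le> 1" by (simp add: emeasure_space_1[simplified])
  have "1 = (\<integral>\<^sup>+p. 1 \<partial>GEM \<alpha> \<theta>)" by (simp add: emeasure_space_1[simplified])
  also have "\<dots> \<le> (\<integral>\<^sup>+p. ennreal (mark_survival s t p) + ennreal (s / (1 - s) * t) \<partial>GEM \<alpha> \<theta>)"
  proof (rule nn_integral_mono_AE)
    show "AE p in GEM \<alpha> \<theta>. 1 \<le> ennreal (mark_survival s t p) + ennreal (s / (1 - s) * t)"
      using AE
    proof eventually_elim
      case (elim p)
      have "1 \<le> mark_survival s t p + s / (1 - s) * t" using mark_survival_ge[OF elim t] by simp
      then have "ennreal 1 \<le> ennreal (mark_survival s t p + s / (1 - s) * t)" by (rule ennreal_leI)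
      then show ?case using mark_survival_pos[of t p] s t by (simp add: ennreal_plus[symmetric] less_imp_le del: ennreal_plus)
    qed
  qed
  also have "\<dots> = GEM_survival \<alpha> \<theta> t + ennreal (s / (1 - s) * t)"
    by (simp add: nn_integral_add GEM_survival_def emeasure_space_1[simplified])
  finally show "1 \<le> GEM_survival \<alpha> \<theta> t + ennreal (s / (1 - s) * t)" .
qed

text \<open>The contribution of one stick: up to the factor \<open>Gamma (1 - \<alpha>)\<close>, the
  integral of \<open>u powr (- \<alpha>) * exp (- x * u)\<close> against
  \<open>1 - s * (1 - exp (- u))\<close>. A mark, of probability \<open>s\<close>, moves the rate
  from \<open>x\<close> to \<open>x + 1\<close>.\<close>

definition tilt_rate :: "real \<Rightarrow> real" where
  "tilt_rate x = (1 - s) * x powr (\<alpha> - 1) + s * (x + 1) powr (\<alpha> - 1)"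

text \<open>An antiderivative of \<open>\<alpha> * tilt_rate\<close> for positive arguments. Divided
  by \<open>c powr \<alpha>\<close> it becomes \<open>1 - s + s * (1 + 1 / c) powr \<alpha>\<close>,
  the base of the closed form.\<close>

definition tilt :: "real \<Rightarrow> real" where
  "tilt x = (1 - s) * x powr \<alpha> + s * (x + 1) powr \<alpha>"

lemma tilt_rate_nonneg: "0 \<le> tilt_rate x"
  using s by (simp add: tilt_rate_def)

lemma tilt_rate_le:
  assumes "0 < x"
  shows "tilt_rate x \<le> x powr (\<alpha> - 1)"
proof -
  have "(x + 1) powr (\<alpha> - 1) \<le> x powr (\<alpha> - 1)" using \<alpha> assms by (intro powr_mono2') auto
  then have "s * (x + 1) powr (\<alpha> - 1) \<le> s * x powr (\<alpha> - 1)" using s by (intro mult_left_mono) auto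
  then show ?thesis by (simp add: tilt_rate_def algebra_simps)
qed

lemma tilt_ge:
  assumes "0 < x"
  shows "x powr \<alpha> \<le> tilt x"
proof -
  have "x powr \<alpha> \<le> (x + 1) powr \<alpha>" using \<alpha> assms by (intro powr_mono2) auto
  then have "s * x powr \<alpha> \<le> s * (x + 1) powr \<alpha>" using s by (intro mult_left_mono) auto
  then show ?thesis by (simp add: tilt_def algebra_simps)
qed

lemma tilt_pos: "0 < x \<Longrightarrow> 0 < tilt x"
  using tilt_ge[of x] powr_gt_zero[of x \<alpha>] by linarith

lemma measurable_tilt_rate [measurable]: "tilt_rate \<in> borel_measurable borel"
  unfolding tilt_rate_def[abs_def] by measurable

text \<open>The candidate solves the recursion of \<open>GEM_transform_step\<close>: the integrand
  is minus the derivative of \<open>tilt x powr (- (\<theta> / \<alpha>))\<close>, which vanishes at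
  infinity.\<close>

lemma tilt_powr_integral:
  assumes \<theta>: "0 < \<theta>" and c: "0 < c"
  shows "ennreal (tilt c powr (- (\<theta> / \<alpha>))) =
    (\<integral>\<^sup>+x. ennreal (\<theta> * tilt_rate x * tilt x powr (- ((\<theta> + \<alpha>) / \<alpha>))) * indicator {c..} x \<partial>lborel)"
proof -
  have "(\<integral>\<^sup>+x. ennreal (\<theta> * tilt_rate x * tilt x powr (- ((\<theta> + \<alpha>) / \<alpha>))) * indicator {c..} x \<partial>lborel) =
    ennreal (0 - - (tilt c powr (- (\<theta> / \<alpha>))))"
  proof (rule nn_integral_FTC_atLeast)
    show "(\<lambda>x. \<theta> * tilt_rate x * tilt x powr (- ((\<theta> + \<alpha>) / \<alpha>))) \<in> borel_measurable borel"
      unfolding tilt_def by measurable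
    show "0 \<le> \<theta> * tilt_rate x * tilt x powr (- ((\<theta> + \<alpha>) / \<alpha>))" for x
      using \<theta> tilt_rate_nonneg by simp
    fix x assume x: "c \<le> x"
    have "(tilt has_real_derivative (\<alpha> * tilt_rate x)) (at x)"
      unfolding tilt_def[abs_def] tilt_rate_def using x c
      by (auto intro!: derivative_eq_intros simp: algebra_simps)
    then have "((\<lambda>x. - (tilt x powr (- (\<theta> / \<alpha>)))) has_real_derivative
      (- ((- (\<theta> / \<alpha>)) * tilt x powr (- (\<theta> / \<alpha>) - 1) * (\<alpha> * tilt_rate x)))) (at x)"
      using x c tilt_pos[of x] \<alpha> by (auto intro!: derivative_eq_intros)
    moreover have "- (\<theta> / \<alpha>) - 1 = - ((\<theta> + \<alpha>) / \<alpha>)" using \<alpha> by (simp add: field_simps)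
    ultimately show "((\<lambda>x. - (tilt x powr (- (\<theta> / \<alpha>)))) has_real_derivative
      (\<theta> * tilt_rate x * tilt x powr (- ((\<theta> + \<alpha>) / \<alpha>)))) (at x)"
      using \<alpha> by (simp add: mult_ac)
  next
    have "filterlim tilt at_top at_top"
    proof (rule filterlim_at_top_mono)
      show "filterlim (\<lambda>x. x powr \<alpha>) at_top at_top" using \<alpha> by real_asymp
      show "\<forall>\<^sub>F x in at_top. x powr \<alpha> \<le> tilt x"
        using eventually_gt_at_top[of 0] by eventually_elim (rule tilt_ge)
    qed
    then have "((\<lambda>x. tilt x powr (- (\<theta> / \<alpha>))) \<longlongrightarrow> 0) at_top"
      using \<alpha> \<theta> by (intro tendsto_neg_powr) auto
    then show "((\<lambda>x. - (tilt x powr (- (\<theta> / \<alpha>)))) \<longlongrightarrow> 0) at_top"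
      using tendsto_minus by fastforce
  qed
  then show ?thesis by simp
qed

text \<open>The weight \<open>t powr \<theta>\<close> belongs to shape
  \<open>\<theta> + 1 = (1 - \<alpha>) + (\<theta> + \<alpha>)\<close>, the sum of the parameters of
  the first stick. By the beta-gamma algebra the time spent on this stick and the time spent on the
  rest decouple: one yields \<open>tilt_rate\<close>, the other the transform for
  \<open>\<theta> + \<alpha>\<close>.\<close>

lemma GEM_transform_inner:
  assumes \<theta>: "0 < \<theta>" and x: "0 < x"
  shows "(\<integral>\<^sup>+t. ennreal (t powr \<theta> * exp (- x * t)) * GEM_survival \<alpha> \<theta> t * indicator {0<..} t \<partial>lborel) =
    ennreal (Gamma (\<theta> + 1) * tilt_rate x) * GEM_transform \<alpha> (\<theta> + \<alpha>) x"
proof -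
  let ?G = "\<lambda>u v. ennreal (exp (- x * u) * (1 - s * (1 - exp (- u)))) * (ennreal (exp (- x * v)) * GEM_survival \<alpha> (\<theta> + \<alpha>) v)"
  have \<theta>': "0 < \<theta> + \<alpha>" using \<theta> \<alpha> by simp
  note [measurable] = measurable_GEM_survival[OF \<theta>'] measurable_GEM_survival[OF \<theta>]
  have Ga: "0 < Gamma (1 - \<alpha>)" "0 < Gamma (\<theta> + \<alpha>)" "0 < Gamma (\<theta> + 1)" using \<alpha> \<theta> by (auto intro!: Gamma_real_pos)
  have "(\<integral>\<^sup>+t. ennreal (t powr \<theta> * exp (- x * t)) * GEM_survival \<alpha> \<theta> t * indicator {0<..} t \<partial>lborel) =
    (\<integral>\<^sup>+t. ennreal (t powr ((1 - \<alpha>) + (\<theta> + \<alpha>) - 1)) * (\<integral>\<^sup>+r. ?G (t * r) (t * (1 - r)) \<partial>beta_law (1 - \<alpha>) (\<theta> + \<alpha>)) * indicator {0<..} t \<partial>lborel)"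
  proof (rule nn_integral_cong)
    fix t :: real
    show "ennreal (t powr \<theta> * exp (- x * t)) * GEM_survival \<alpha> \<theta> t * indicator {0<..} t =
      ennreal (t powr ((1 - \<alpha>) + (\<theta> + \<alpha>) - 1)) * (\<integral>\<^sup>+r. ?G (t * r) (t * (1 - r)) \<partial>beta_law (1 - \<alpha>) (\<theta> + \<alpha>)) * indicator {0<..} t"
    proof (cases "0 < t")
      case True
      have "(\<integral>\<^sup>+r. ?G (t * r) (t * (1 - r)) \<partial>beta_law (1 - \<alpha>) (\<theta> + \<alpha>)) =
        (\<integral>\<^sup>+r. ennreal (exp (- x * t)) * (ennreal (1 - s * (1 - exp (- (t * r)))) * GEM_survival \<alpha> (\<theta> + \<alpha>) (t * (1 - r))) \<partial>beta_law (1 - \<alpha>) (\<theta> + \<alpha>))"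
      proof (intro nn_integral_cong)
        fix r :: real
        have "exp (- x * (t * r)) * exp (- x * (t * (1 - r))) = exp (- x * t)"
          by (simp add: exp_add[symmetric] algebra_simps)
        then have "ennreal (exp (- x * (t * r))) * ennreal (exp (- x * (t * (1 - r)))) = ennreal (exp (- x * t))"
          by (simp add: ennreal_mult'[symmetric])
        moreover have "?G (t * r) (t * (1 - r)) = (ennreal (exp (- x * (t * r))) * ennreal (exp (- x * (t * (1 - r))))) *
          (ennreal (1 - s * (1 - exp (- (t * r)))) * GEM_survival \<alpha> (\<theta> + \<alpha>) (t * (1 - r)))"
          by (subst ennreal_mult'[OF exp_ge_zero]) (simp only: mult_ac)
        ultimately show "?G (t * r) (t * (1 - r)) = ennreal (exp (- x * t)) * (ennreal (1 - s * (1 - exp (- (t * r)))) * GEM_survival \<alpha> (\<theta> + \<alpha>) (t * (1 - r)))"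
          by (simp only:)
      qed
      also have "\<dots> = ennreal (exp (- x * t)) * GEM_survival \<alpha> \<theta> t"
        using True by (subst nn_integral_cmult) (simp_all add: GEM_survival_step[OF \<theta>])
      finally show ?thesis using True by (simp add: ennreal_mult' mult.assoc)
    qed simp
  qed
  also have "\<dots> = ennreal (1 / Beta (1 - \<alpha>) (\<theta> + \<alpha>)) * (\<integral>\<^sup>+u. \<integral>\<^sup>+v. ennreal (u powr ((1 - \<alpha>) - 1)) * ennreal (v powr ((\<theta> + \<alpha>) - 1)) * ?G u v *
      indicator {0<..} v * indicator {0<..} u \<partial>lborel \<partial>lborel)"
    by (rule nn_integral_beta_gamma) (use \<alpha> \<theta> in auto)
  also have "(\<integral>\<^sup>+u. \<integral>\<^sup>+v. ennreal (u powr ((1 - \<alpha>) - 1)) * ennreal (v powr ((\<theta> + \<alpha>) - 1)) * ?G u v *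
      indicator {0<..} v * indicator {0<..} u \<partial>lborel \<partial>lborel) =
    (\<integral>\<^sup>+u. (ennreal (Gamma (\<theta> + \<alpha>)) * GEM_transform \<alpha> (\<theta> + \<alpha>) x) *
      (ennreal (u powr ((1 - \<alpha>) - 1) * (exp (- x * u) * (1 - s * (1 - exp (- u))))) * indicator {0<..} u) \<partial>lborel)"
  proof (rule nn_integral_cong)
    fix u :: real
    let ?U = "ennreal (u powr ((1 - \<alpha>) - 1) * (exp (- x * u) * (1 - s * (1 - exp (- u))))) * indicator {0<..} u"
    have "(\<integral>\<^sup>+v. ennreal (u powr ((1 - \<alpha>) - 1)) * ennreal (v powr ((\<theta> + \<alpha>) - 1)) * ?G u v *
      indicator {0<..} v * indicator {0<..} u \<partial>lborel) =
      (\<integral>\<^sup>+v. (?U * ennreal (Gamma (\<theta> + \<alpha>))) *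
        (ennreal (v powr ((\<theta> + \<alpha>) - 1) * exp (- x * v) / Gamma (\<theta> + \<alpha>)) * GEM_survival \<alpha> (\<theta> + \<alpha>) v * indicator {0<..} v) \<partial>lborel)"
    proof (rule nn_integral_cong)
      fix v :: real
      have 1: "ennreal (Gamma (\<theta> + \<alpha>)) * ennreal (v powr ((\<theta> + \<alpha>) - 1) * exp (- x * v) / Gamma (\<theta> + \<alpha>)) =
        ennreal (v powr ((\<theta> + \<alpha>) - 1)) * ennreal (exp (- x * v))"
        using Ga by (simp add: ennreal_mult'[symmetric])
      have 2: "?U = ennreal (u powr ((1 - \<alpha>) - 1)) * ennreal (exp (- x * u) * (1 - s * (1 - exp (- u)))) * indicator {0<..} u"
        by (simp add: ennreal_mult')
      have "(?U * ennreal (Gamma (\<theta> + \<alpha>))) *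
        (ennreal (v powr ((\<theta> + \<alpha>) - 1) * exp (- x * v) / Gamma (\<theta> + \<alpha>)) * GEM_survival \<alpha> (\<theta> + \<alpha>) v * indicator {0<..} v)
        = ?U * (ennreal (Gamma (\<theta> + \<alpha>)) * ennreal (v powr ((\<theta> + \<alpha>) - 1) * exp (- x * v) / Gamma (\<theta> + \<alpha>))) *
          GEM_survival \<alpha> (\<theta> + \<alpha>) v * indicator {0<..} v"
        by (simp only: mult.assoc)
      then show "ennreal (u powr ((1 - \<alpha>) - 1)) * ennreal (v powr ((\<theta> + \<alpha>) - 1)) * ?G u v * indicator {0<..} v * indicator {0<..} u =
        (?U * ennreal (Gamma (\<theta> + \<alpha>))) *
        (ennreal (v powr ((\<theta> + \<alpha>) - 1) * exp (- x * v) / Gamma (\<theta> + \<alpha>)) * GEM_survival \<alpha> (\<theta> + \<alpha>) v * indicator {0<..} v)"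
        unfolding 1 2 by (simp only: mult_ac)
    qed
    also have "\<dots> = (?U * ennreal (Gamma (\<theta> + \<alpha>))) * GEM_transform \<alpha> (\<theta> + \<alpha>) x"
      unfolding GEM_transform_def by (rule nn_integral_cmult) measurable
    finally show "(\<integral>\<^sup>+v. ennreal (u powr ((1 - \<alpha>) - 1)) * ennreal (v powr ((\<theta> + \<alpha>) - 1)) * ?G u v *
      indicator {0<..} v * indicator {0<..} u \<partial>lborel) = (ennreal (Gamma (\<theta> + \<alpha>)) * GEM_transform \<alpha> (\<theta> + \<alpha>) x) * ?U"
      by (simp only: mult_ac)
  qed
  also have "\<dots> = (ennreal (Gamma (\<theta> + \<alpha>)) * GEM_transform \<alpha> (\<theta> + \<alpha>) x) *
    (\<integral>\<^sup>+u. ennreal (u powr ((1 - \<alpha>) - 1) * (exp (- x * u) * (1 - s * (1 - exp (- u))))) * indicator {0<..} u \<partial>lborel)"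
    by (rule nn_integral_cmult) measurable
  also have "(\<integral>\<^sup>+u. ennreal (u powr ((1 - \<alpha>) - 1) * (exp (- x * u) * (1 - s * (1 - exp (- u))))) * indicator {0<..} u \<partial>lborel) =
    ennreal (Gamma (1 - \<alpha>) * tilt_rate x)"
  proof -
    let ?g = "\<lambda>c u. ennreal (u powr ((1 - \<alpha>) - 1) * exp (- c * u)) * indicator {0<..} u"
    have "ennreal (u powr ((1 - \<alpha>) - 1) * (exp (- x * u) * (1 - s * (1 - exp (- u))))) * indicator {0<..} u =
      ennreal (1 - s) * ?g x u + ennreal s * ?g (x + 1) u" for u
    proof -
      \<comment> \<open>Unmarked and marked case; the extra factor \<open>exp (- u)\<close> of the
        latter raises the rate by one.\<close>
      have "u powr ((1 - \<alpha>) - 1) * (exp (- x * u) * (1 - s * (1 - exp (- u)))) =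
        (1 - s) * (u powr ((1 - \<alpha>) - 1) * exp (- x * u)) + s * (u powr ((1 - \<alpha>) - 1) * exp (- (x + 1) * u))"
        by (simp add: algebra_simps exp_add exp_diff exp_minus field_simps)
      then show ?thesis using s by (simp add: indicator_def ennreal_mult'[symmetric])
    qed
    then have "(\<integral>\<^sup>+u. ennreal (u powr ((1 - \<alpha>) - 1) * (exp (- x * u) * (1 - s * (1 - exp (- u))))) * indicator {0<..} u \<partial>lborel) =
      ennreal (1 - s) * (\<integral>\<^sup>+u. ?g x u \<partial>lborel) + ennreal s * (\<integral>\<^sup>+u. ?g (x + 1) u \<partial>lborel)"
      by (simp add: nn_integral_add nn_integral_cmult)
    also have "\<dots> = ennreal (1 - s) * ennreal (Gamma (1 - \<alpha>) * x powr (- (1 - \<alpha>))) + ennreal s * ennreal (Gamma (1 - \<alpha>) * (x + 1) powr (- (1 - \<alpha>)))"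
      using \<alpha> x nn_integral_Gamma_scaled[of "1 - \<alpha>" x] nn_integral_Gamma_scaled[of "1 - \<alpha>" "x + 1"] by simp
    also have "\<dots> = ennreal (Gamma (1 - \<alpha>) * tilt_rate x)"
    proof -
      have "ennreal (1 - s) * ennreal A + ennreal s * ennreal B = ennreal ((1 - s) * A + s * B)" if "0 \<le> A" "0 \<le> B" for A B
        using s that by (subst ennreal_plus) (auto simp: ennreal_mult)
      moreover have "(1 - s) * (Gamma (1 - \<alpha>) * x powr (- (1 - \<alpha>))) + s * (Gamma (1 - \<alpha>) * (x + 1) powr (- (1 - \<alpha>))) = Gamma (1 - \<alpha>) * tilt_rate x"
        by (simp add: tilt_rate_def algebra_simps)
      ultimately show ?thesis using Ga by simp
    qed
    finally show ?thesis .
  qed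
  also have "ennreal (1 / Beta (1 - \<alpha>) (\<theta> + \<alpha>)) * ((ennreal (Gamma (\<theta> + \<alpha>)) * GEM_transform \<alpha> (\<theta> + \<alpha>) x) * ennreal (Gamma (1 - \<alpha>) * tilt_rate x)) =
    (ennreal (1 / Beta (1 - \<alpha>) (\<theta> + \<alpha>)) * ennreal (Gamma (\<theta> + \<alpha>)) * ennreal (Gamma (1 - \<alpha>) * tilt_rate x)) * GEM_transform \<alpha> (\<theta> + \<alpha>) x"
    by (simp only: mult_ac)
  also have "ennreal (1 / Beta (1 - \<alpha>) (\<theta> + \<alpha>)) * ennreal (Gamma (\<theta> + \<alpha>)) * ennreal (Gamma (1 - \<alpha>) * tilt_rate x) =
    ennreal (Gamma (\<theta> + 1) * tilt_rate x)"
    using Ga tilt_rate_nonneg[of x] by (simp add: ennreal_mult'[symmetric] Beta_def add.commute)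
  finally show ?thesis .
qed

text \<open>Integrating \<open>t powr \<theta> * exp (- x * t)\<close> over all rates
  \<open>x\<close> from \<open>c\<close> on gives
  \<open>t powr (\<theta> - 1) * exp (- c * t)\<close>. So shape \<open>\<theta>\<close> is an
  integral of weights of shape \<open>\<theta> + 1\<close>, to which the splitting applies.\<close>

lemma GEM_transform_step:
  assumes \<theta>: "0 < \<theta>" and c: "0 < c"
  shows "GEM_transform \<alpha> \<theta> c =
    (\<integral>\<^sup>+x. ennreal (\<theta> * tilt_rate x) * GEM_transform \<alpha> (\<theta> + \<alpha>) x * indicator {c..} x \<partial>lborel)"
proof -
  note [measurable] = measurable_GEM_survival[OF \<theta>]
  have G: "0 < Gamma \<theta>" using \<theta> by (rule Gamma_real_pos)
  then have G0: "Gamma \<theta> \<noteq> 0" by linarith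
  have "GEM_transform \<alpha> \<theta> c = (\<integral>\<^sup>+t. \<integral>\<^sup>+x. ennreal (1 / Gamma \<theta>) * (ennreal (t powr \<theta> * exp (- x * t)) * GEM_survival \<alpha> \<theta> t *
    indicator {0<..} t) * indicator {c..} x \<partial>lborel \<partial>lborel)"
    unfolding GEM_transform_def
  proof (rule nn_integral_cong)
    fix t :: real
    show "ennreal (t powr (\<theta> - 1) * exp (- c * t) / Gamma \<theta>) * GEM_survival \<alpha> \<theta> t * indicator {0<..} t =
      (\<integral>\<^sup>+x. ennreal (1 / Gamma \<theta>) * (ennreal (t powr \<theta> * exp (- x * t)) * GEM_survival \<alpha> \<theta> t * indicator {0<..} t) * indicator {c..} x \<partial>lborel)"
    proof (cases "0 < t")
      case True
      have "(\<integral>\<^sup>+x. ennreal (t powr \<theta> * exp (- x * t)) * indicator {c..} x \<partial>lborel) = ennreal (0 - (- (t powr (\<theta> - 1) * exp (- c * t))))"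
      proof (rule nn_integral_FTC_atLeast)
        fix x :: real
        have "t powr (\<theta> - 1) * t = t powr \<theta>" using True by (simp add: powr_diff)
        then show "((\<lambda>x. - (t powr (\<theta> - 1) * exp (- x * t))) has_real_derivative t powr \<theta> * exp (- x * t)) (at x)"
          by (auto intro!: derivative_eq_intros simp: mult_ac)
        have "((\<lambda>x. exp (- x * t)) \<longlongrightarrow> 0) at_top" using True by real_asymp
        from tendsto_mult_right_zero[OF this, of "- (t powr (\<theta> - 1))"]
        show "((\<lambda>x. - (t powr (\<theta> - 1) * exp (- x * t))) \<longlongrightarrow> 0) at_top" by simp
      qed auto
      then have I: "(\<integral>\<^sup>+x. ennreal (t powr \<theta> * exp (- x * t)) * indicator {c..} x \<partial>lborel) = ennreal (t powr (\<theta> - 1) * exp (- c * t))" by simp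
      have "(\<integral>\<^sup>+x. ennreal (1 / Gamma \<theta>) * (ennreal (t powr \<theta> * exp (- x * t)) * GEM_survival \<alpha> \<theta> t * indicator {0<..} t) * indicator {c..} x \<partial>lborel) =
        (\<integral>\<^sup>+x. (ennreal (1 / Gamma \<theta>) * GEM_survival \<alpha> \<theta> t) * (ennreal (t powr \<theta> * exp (- x * t)) * indicator {c..} x) \<partial>lborel)"
        using True by (simp add: mult_ac)
      also have "\<dots> = (ennreal (1 / Gamma \<theta>) * GEM_survival \<alpha> \<theta> t) * ennreal (t powr (\<theta> - 1) * exp (- c * t))"
        by (subst nn_integral_cmult) (simp_all only: I, measurable)
      also have "\<dots> = (ennreal (1 / Gamma \<theta>) * ennreal (t powr (\<theta> - 1) * exp (- c * t))) * GEM_survival \<alpha> \<theta> t"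
        by (simp only: mult_ac)
      also have "ennreal (1 / Gamma \<theta>) * ennreal (t powr (\<theta> - 1) * exp (- c * t)) = ennreal (t powr (\<theta> - 1) * exp (- c * t) / Gamma \<theta>)"
        using G by (simp add: ennreal_mult'[symmetric])
      finally show ?thesis using True by simp
    qed simp
  qed
  also have "\<dots> = (\<integral>\<^sup>+x. \<integral>\<^sup>+t. ennreal (1 / Gamma \<theta>) * (ennreal (t powr \<theta> * exp (- x * t)) * GEM_survival \<alpha> \<theta> t *
    indicator {0<..} t) * indicator {c..} x \<partial>lborel \<partial>lborel)"
    by (rule lborel_pair.Fubini') measurable
  also have "\<dots> = (\<integral>\<^sup>+x. ennreal (\<theta> * tilt_rate x) * GEM_transform \<alpha> (\<theta> + \<alpha>) x * indicator {c..} x \<partial>lborel)"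
  proof (rule nn_integral_cong)
    fix x :: real
    show "(\<integral>\<^sup>+t. ennreal (1 / Gamma \<theta>) * (ennreal (t powr \<theta> * exp (- x * t)) * GEM_survival \<alpha> \<theta> t *
      indicator {0<..} t) * indicator {c..} x \<partial>lborel) = ennreal (\<theta> * tilt_rate x) * GEM_transform \<alpha> (\<theta> + \<alpha>) x * indicator {c..} x"
    proof (cases "c \<le> x")
      case True
      have "(\<integral>\<^sup>+t. ennreal (1 / Gamma \<theta>) * (ennreal (t powr \<theta> * exp (- x * t)) * GEM_survival \<alpha> \<theta> t *
        indicator {0<..} t) * indicator {c..} x \<partial>lborel) = ennreal (1 / Gamma \<theta>) * (ennreal (Gamma (\<theta> + 1) * tilt_rate x) * GEM_transform \<alpha> (\<theta> + \<alpha>) x)"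
        using True c by (subst GEM_transform_inner[OF \<theta>, symmetric]) (simp_all add: nn_integral_cmult)
      also have "\<dots> = (ennreal (1 / Gamma \<theta>) * ennreal (Gamma (\<theta> + 1) * tilt_rate x)) * GEM_transform \<alpha> (\<theta> + \<alpha>) x"
        by (simp only: mult.assoc)
      also have "ennreal (1 / Gamma \<theta>) * ennreal (Gamma (\<theta> + 1) * tilt_rate x) = ennreal (\<theta> * tilt_rate x)"
        using G0 \<theta> Gamma_real_pos[of \<theta>] by (simp add: ennreal_mult'[symmetric] Gamma_real_plus1)
      finally show ?thesis using True by simp
    qed simp
  qed
  finally show ?thesis .
qed

lemma GEM_transform_bounds:
  assumes \<theta>: "0 < \<theta>" and c: "0 < c"
  shows "GEM_transform \<alpha> \<theta> c \<le> ennreal (c powr (- \<theta>))"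
    and "ennreal (c powr (- \<theta>)) \<le> GEM_transform \<alpha> \<theta> c + ennreal (s / (1 - s) * \<theta> * c powr (- \<theta> - 1))"
proof -
  note [measurable] = measurable_GEM_survival[OF \<theta>]
  let ?d = "\<lambda>t. ennreal (t powr (\<theta> - 1) * exp (- c * t) / Gamma \<theta>)"
  have "GEM_transform \<alpha> \<theta> c \<le> (\<integral>\<^sup>+t. ?d t * indicator {0<..} t \<partial>lborel)"
    unfolding GEM_transform_def
  proof (rule nn_integral_mono)
    fix t :: real
    show "?d t * GEM_survival \<alpha> \<theta> t * indicator {0<..} t \<le> ?d t * indicator {0<..} t"
      using GEM_survival_bounds(1)[OF \<theta>, of t] mult_left_mono[of "GEM_survival \<alpha> \<theta> t" 1 "?d t"]
      by (cases "0 < t") auto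
  qed
  then show "GEM_transform \<alpha> \<theta> c \<le> ennreal (c powr (- \<theta>))" unfolding Gamma_density_integral[OF \<theta> c] .
  have "ennreal (c powr (- \<theta>)) = (\<integral>\<^sup>+t. ?d t * indicator {0<..} t \<partial>lborel)"
    by (rule Gamma_density_integral[OF \<theta> c, symmetric])
  also have "\<dots> \<le> (\<integral>\<^sup>+t. ?d t * GEM_survival \<alpha> \<theta> t * indicator {0<..} t + ?d t * ennreal (s / (1 - s) * t) * indicator {0<..} t \<partial>lborel)"
  proof (rule nn_integral_mono)
    fix t :: real
    show "?d t * indicator {0<..} t \<le> ?d t * GEM_survival \<alpha> \<theta> t * indicator {0<..} t + ?d t * ennreal (s / (1 - s) * t) * indicator {0<..} t"
      using GEM_survival_bounds(2)[OF \<theta>, of t] mult_left_mono[of 1 "GEM_survival \<alpha> \<theta> t + ennreal (s / (1 - s) * t)" "?d t"]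
      by (cases "0 < t") (auto simp: distrib_left)
  qed
  also have "\<dots> = GEM_transform \<alpha> \<theta> c + (\<integral>\<^sup>+t. ?d t * ennreal (s / (1 - s) * t) * indicator {0<..} t \<partial>lborel)"
    unfolding GEM_transform_def by (rule nn_integral_add) measurable
  also have "(\<integral>\<^sup>+t. ?d t * ennreal (s / (1 - s) * t) * indicator {0<..} t \<partial>lborel) = ennreal (s / (1 - s) * \<theta> * c powr (- \<theta> - 1))"
    using s by (intro Gamma_density_mean[OF \<theta> c]) simp
  finally show "ennreal (c powr (- \<theta>)) \<le> GEM_transform \<alpha> \<theta> c + ennreal (s / (1 - s) * \<theta> * c powr (- \<theta> - 1))" .
qed

text \<open>The candidate is squeezed around \<open>c powr (- \<theta>)\<close> in the same way as
  the transform in \<open>GEM_transform_bounds\<close>, with \<open>s / \<alpha>\<close> in place of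
  \<open>s / (1 - s)\<close>. The two estimates together start the comparison.\<close>

lemma tilt_powr_bounds:
  assumes \<theta>: "0 < \<theta>" and c: "0 < c"
  shows "tilt c powr (- (\<theta> / \<alpha>)) \<le> c powr (- \<theta>)"
    and "c powr (- \<theta>) \<le> tilt c powr (- (\<theta> / \<alpha>)) + s / \<alpha> * \<theta> * c powr (- \<theta> - 1)"
proof -
  have q: "0 < \<theta> / \<alpha>" using \<theta> \<alpha> by simp
  have "tilt c powr (- (\<theta> / \<alpha>)) \<le> (c powr \<alpha>) powr (- (\<theta> / \<alpha>))"
    using tilt_ge[OF c] q c by (intro powr_mono2') auto
  then show "tilt c powr (- (\<theta> / \<alpha>)) \<le> c powr (- \<theta>)" using \<alpha> by (simp add: powr_powr)
  define y where "y = s / c"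
  have y: "0 \<le> y" using s c by (simp add: y_def)
  \<comment> \<open>As the exponent is below 1, the base of the closed form is at most
    \<open>1 + s / c\<close>; the estimate then follows from \<open>ln (1 + y) \<le> y\<close> and
    \<open>1 + z \<le> exp z\<close>.\<close>
  have "(1 + 1 / c) powr \<alpha> \<le> (1 + 1 / c) powr 1" using \<alpha> c by (intro powr_mono) auto
  then have "(1 - s) + s * (1 + 1 / c) powr \<alpha> \<le> (1 - s) + s * (1 + 1 / c)"
    using s c by (intro add_left_mono mult_left_mono) auto
  also have "\<dots> = 1 + y" by (simp add: y_def algebra_simps)
  finally have le: "(1 - s) + s * (1 + 1 / c) powr \<alpha> \<le> 1 + y" .
  have pos: "0 < (1 - s) + s * (1 + 1 / c) powr \<alpha>" using s c by (intro add_pos_nonneg) auto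
  have "c powr \<alpha> * (1 + 1 / c) powr \<alpha> = (c + 1) powr \<alpha>"
  proof -
    have "c * (1 + 1 / c) = c + 1" using c by (simp add: field_simps)
    then show ?thesis using c by (simp add: powr_mult[symmetric])
  qed
  then have tilt_eq: "tilt c = c powr \<alpha> * ((1 - s) + s * (1 + 1 / c) powr \<alpha>)"
    by (simp add: tilt_def algebra_simps)
  have "1 - \<theta> / \<alpha> * y \<le> exp (- (\<theta> / \<alpha>) * y)" using exp_ge_add_one_self[of "- (\<theta> / \<alpha>) * y"] by simp
  also have "\<dots> \<le> exp (- (\<theta> / \<alpha>) * ln (1 + y))"
    using mult_left_mono[OF ln_add_one_self_le_self[OF y], of "\<theta> / \<alpha>"] q by (simp only: exp_le_cancel_iff) simp
  also have "\<dots> = (1 + y) powr (- (\<theta> / \<alpha>))" using y by (simp add: powr_def)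
  also have "\<dots> \<le> ((1 - s) + s * (1 + 1 / c) powr \<alpha>) powr (- (\<theta> / \<alpha>))"
    using le pos q by (intro powr_mono2') auto
  finally have "c powr (- \<theta>) * (1 - \<theta> / \<alpha> * y) \<le> c powr (- \<theta>) * ((1 - s) + s * (1 + 1 / c) powr \<alpha>) powr (- (\<theta> / \<alpha>))"
    by (intro mult_left_mono) auto
  also have "\<dots> = tilt c powr (- (\<theta> / \<alpha>))"
    unfolding tilt_eq using c pos \<alpha> by (subst powr_mult) (auto simp: powr_powr)
  finally show "c powr (- \<theta>) \<le> tilt c powr (- (\<theta> / \<alpha>)) + s / \<alpha> * \<theta> * c powr (- \<theta> - 1)"
    using c by (simp add: y_def powr_diff algebra_simps)
qed

text \<open>Uniqueness for the recursion. Transform and candidate satisfy the same integral equation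
  with a positive kernel, so an error bound for \<open>\<theta> + \<alpha>\<close> integrates to one
  for \<open>\<theta>\<close>. Each step contributes a factor
  \<open>1 - (1 - \<alpha>) / (\<theta> + 1)\<close> at its own parameter, and their product tends
  to 0. Both directions are additive inequalities in place of an absolute difference in
  \<open>ennreal\<close>.\<close>

lemma GEM_transform_close:
  assumes \<theta>: "0 < \<theta>" and c: "0 < c"
  defines "K \<equiv> s / ((1 - s) * \<alpha>)"
  shows "GEM_transform \<alpha> \<theta> c \<le> ennreal (tilt c powr (- (\<theta> / \<alpha>))) +
      ennreal (K * (\<theta> * (\<Prod>i<m. 1 - (1 - \<alpha>) / (\<theta> + 1 + real i * \<alpha>))) * c powr (- \<theta> - 1)) \<and>
    ennreal (tilt c powr (- (\<theta> / \<alpha>))) \<le> GEM_transform \<alpha> \<theta> c +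
      ennreal (K * (\<theta> * (\<Prod>i<m. 1 - (1 - \<alpha>) / (\<theta> + 1 + real i * \<alpha>))) * c powr (- \<theta> - 1))"
  using \<theta> c
proof (induction m arbitrary: \<theta> c)
  case 0
  \<comment> \<open>\<open>K\<close> dominates the constants of both starting estimates.\<close>
  have K: "s / \<alpha> \<le> K" "s / (1 - s) \<le> K"
    using s \<alpha> unfolding K_def by (auto intro!: divide_left_mono mult_pos_pos simp: mult_le_cancel_right1 mult_le_cancel_left1)
  have K': "s / \<alpha> * \<theta> * c powr (- \<theta> - 1) \<le> K * \<theta> * c powr (- \<theta> - 1)"
    "s / (1 - s) * \<theta> * c powr (- \<theta> - 1) \<le> K * \<theta> * c powr (- \<theta> - 1)"
    using K 0 by (intro mult_right_mono; simp)+
  have "GEM_transform \<alpha> \<theta> c \<le> ennreal (c powr (- \<theta>))" by (rule GEM_transform_bounds[OF 0])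
  also have "\<dots> \<le> ennreal (tilt c powr (- (\<theta> / \<alpha>)) + K * \<theta> * c powr (- \<theta> - 1))"
    using tilt_powr_bounds(2)[OF 0] K' by (intro ennreal_leI) linarith
  also have "\<dots> \<le> ennreal (tilt c powr (- (\<theta> / \<alpha>))) + ennreal (K * \<theta> * c powr (- \<theta> - 1))"
    using s \<alpha> 0 by (subst ennreal_plus) (auto simp: K_def)
  finally have 1: "GEM_transform \<alpha> \<theta> c \<le> ennreal (tilt c powr (- (\<theta> / \<alpha>))) + ennreal (K * \<theta> * c powr (- \<theta> - 1))" .
  have "ennreal (tilt c powr (- (\<theta> / \<alpha>))) \<le> ennreal (c powr (- \<theta>))"
    using tilt_powr_bounds(1)[OF 0] by (rule ennreal_leI)
  also have "\<dots> \<le> GEM_transform \<alpha> \<theta> c + ennreal (s / (1 - s) * \<theta> * c powr (- \<theta> - 1))"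
    by (rule GEM_transform_bounds[OF 0])
  also have "\<dots> \<le> GEM_transform \<alpha> \<theta> c + ennreal (K * \<theta> * c powr (- \<theta> - 1))"
    using K' by (intro add_left_mono ennreal_leI)
  finally show ?case using 1 by (simp add: mult.assoc)
next
  case (Suc m)
  let ?P = "\<lambda>m \<theta>. \<Prod>i<m. 1 - (1 - \<alpha>) / (\<theta> + 1 + real i * \<alpha>)"
  let ?H = "GEM_transform \<alpha> (\<theta> + \<alpha>)" and ?C = "\<lambda>x. ennreal (tilt x powr (- ((\<theta> + \<alpha>) / \<alpha>)))"
  define A where "A = K * ((\<theta> + \<alpha>) * ?P m (\<theta> + \<alpha>))"
  have \<theta>: "0 < \<theta>" and \<theta>': "0 < \<theta> + \<alpha>" using Suc.prems \<alpha> by auto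
  have Pn: "0 \<le> ?P j \<theta>" if "0 < \<theta>" for j \<theta>
  proof (intro prod_nonneg ballI)
    fix i
    have "0 < \<theta> + 1 + real i * \<alpha>" "1 - \<alpha> \<le> \<theta> + 1 + real i * \<alpha>"
      using that \<alpha> by (auto intro!: add_pos_nonneg) (smt (verit) mult_nonneg_nonneg of_nat_0_le_iff)
    then show "0 \<le> 1 - (1 - \<alpha>) / (\<theta> + 1 + real i * \<alpha>)" by (simp add: divide_le_eq)
  qed
  have K: "0 \<le> K" using s \<alpha> by (simp add: K_def)
  have A: "0 \<le> A" using K \<theta>' Pn[OF \<theta>'] by (simp add: A_def)
  note [measurable] = measurable_GEM_survival[OF \<theta>']
  have Hm [measurable]: "?H \<in> borel_measurable borel"
    unfolding GEM_transform_def[abs_def] by measurable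
  have tm [measurable]: "tilt \<in> borel_measurable borel" unfolding tilt_def[abs_def] by measurable
  let ?w = "\<lambda>x. ennreal (\<theta> * tilt_rate x)"
  let ?R = "\<lambda>x. ennreal (A * x powr (- (\<theta> + \<alpha>) - 1))"
  have IH: "?H x \<le> ?C x + ?R x \<and> ?C x \<le> ?H x + ?R x" if "0 < x" for x
    using Suc.IH[OF \<theta>' that] by (simp only: A_def)
  \<comment> \<open>How one step transforms the error:
    \<open>tilt_rate x \<le> x powr (\<alpha> - 1)\<close> leaves an integrand of order
    \<open>x powr (- \<theta> - 2)\<close>, whose integral from \<open>c\<close> on supplies the
    divisor \<open>\<theta> + 1\<close> and restores the power
    \<open>- \<theta> - 1\<close>.\<close>
  have rem: "(\<integral>\<^sup>+x. ?w x * ?R x * indicator {c..} x \<partial>lborel) \<le> ennreal (\<theta> / (\<theta> + 1) * A * c powr (- \<theta> - 1))"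
  proof -
    have "(\<integral>\<^sup>+x. ?w x * ?R x * indicator {c..} x \<partial>lborel) \<le> (\<integral>\<^sup>+x. ennreal (\<theta> * A * x powr (- \<theta> - 2)) * indicator {c..} x \<partial>lborel)"
    proof (rule nn_integral_mono)
      fix x :: real
      show "?w x * ?R x * indicator {c..} x \<le> ennreal (\<theta> * A * x powr (- \<theta> - 2)) * indicator {c..} x"
      proof (cases "c \<le> x")
        case True
        then have x: "0 < x" using Suc.prems by simp
        have "\<theta> * tilt_rate x * (A * x powr (- (\<theta> + \<alpha>) - 1)) \<le> \<theta> * x powr (\<alpha> - 1) * (A * x powr (- (\<theta> + \<alpha>) - 1))"
          using tilt_rate_le[OF x] \<theta> A by (intro mult_right_mono mult_left_mono) auto
        also have "\<dots> = \<theta> * A * (x powr (\<alpha> - 1) * x powr (- (\<theta> + \<alpha>) - 1))" by (simp add: mult_ac)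
        also have "x powr (\<alpha> - 1) * x powr (- (\<theta> + \<alpha>) - 1) = x powr (- \<theta> - 2)"
          using x by (simp add: powr_add[symmetric] algebra_simps)
        finally show ?thesis
          using True \<theta> tilt_rate_nonneg[of x] by (simp add: ennreal_mult'[symmetric] ennreal_leI)
      qed simp
    qed
    also have "\<dots> = ennreal (0 - - (\<theta> / (\<theta> + 1) * A * c powr (- \<theta> - 1)))"
    proof (rule nn_integral_FTC_atLeast)
      show "((\<lambda>x. - (\<theta> / (\<theta> + 1) * A * x powr (- \<theta> - 1))) has_real_derivative \<theta> * A * x powr (- \<theta> - 2)) (at x)" if "c \<le> x" for x
      proof -
        have e: "- \<theta> - 1 - 1 = - \<theta> - 2" by simp
        have "((\<lambda>x. - (\<theta> / (\<theta> + 1) * A * x powr (- \<theta> - 1))) has_real_derivative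
          - (\<theta> / (\<theta> + 1) * A * ((- \<theta> - 1) * x powr (- \<theta> - 1 - 1)))) (at x)"
          using that Suc.prems by (auto intro!: derivative_eq_intros)
        moreover have "- (\<theta> / (\<theta> + 1) * A * ((- \<theta> - 1) * x powr (- \<theta> - 1 - 1))) = \<theta> * A * x powr (- \<theta> - 2)"
          unfolding e using \<theta> by (simp add: field_simps)
        ultimately show ?thesis by simp
      qed
      show "((\<lambda>x. - (\<theta> / (\<theta> + 1) * A * x powr (- \<theta> - 1))) \<longlongrightarrow> 0) at_top"
      proof -
        have "((\<lambda>x. x powr (- \<theta> - 1)) \<longlongrightarrow> 0) at_top"
          using \<theta> by (intro tendsto_neg_powr filterlim_ident) simp
        from tendsto_mult_right_zero[OF this, of "- (\<theta> / (\<theta> + 1) * A)"] show ?thesis by simp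
      qed
    qed (use \<theta> A in auto)
    finally show ?thesis by simp
  qed
  \<comment> \<open>The factor \<open>\<theta> + \<alpha>\<close> in \<open>A\<close> and the
    divisor \<open>\<theta> + 1\<close> combine to the factor with index 0 of the longer
    product.\<close>
  have Peq: "K * (\<theta> * ?P (Suc m) \<theta>) = \<theta> / (\<theta> + 1) * A"
  proof -
    have "?P (Suc m) \<theta> = (1 - (1 - \<alpha>) / (\<theta> + 1)) * ?P m (\<theta> + \<alpha>)"
      by (subst prod.lessThan_Suc_shift) (simp add: algebra_simps)
    also have "1 - (1 - \<alpha>) / (\<theta> + 1) = (\<theta> + \<alpha>) / (\<theta> + 1)" using \<theta> by (simp add: field_simps)
    finally show ?thesis by (simp add: A_def)
  qed
  have Ceq: "ennreal (tilt c powr (- (\<theta> / \<alpha>))) = (\<integral>\<^sup>+x. ?w x * ?C x * indicator {c..} x \<partial>lborel)"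
    unfolding tilt_powr_integral[OF Suc.prems]
    using \<theta> tilt_rate_nonneg by (intro nn_integral_cong) (simp add: ennreal_mult')
  have Heq: "GEM_transform \<alpha> \<theta> c = (\<integral>\<^sup>+x. ?w x * ?H x * indicator {c..} x \<partial>lborel)"
    by (rule GEM_transform_step[OF Suc.prems])
  \<comment> \<open>Symmetric in transform and candidate, so it is applied twice with the roles
    exchanged.\<close>
  have main: "(\<integral>\<^sup>+x. ?w x * u x * indicator {c..} x \<partial>lborel) \<le>
    (\<integral>\<^sup>+x. ?w x * v x * indicator {c..} x \<partial>lborel) + ennreal (\<theta> / (\<theta> + 1) * A * c powr (- \<theta> - 1))"
    if [measurable]: "v \<in> borel_measurable borel" and uv: "\<And>x. 0 < x \<Longrightarrow> u x \<le> v x + ?R x" for u v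
  proof -
    have "(\<integral>\<^sup>+x. ?w x * u x * indicator {c..} x \<partial>lborel) \<le>
      (\<integral>\<^sup>+x. ?w x * v x * indicator {c..} x + ?w x * ?R x * indicator {c..} x \<partial>lborel)"
    proof (rule nn_integral_mono)
      fix x :: real
      show "?w x * u x * indicator {c..} x \<le> ?w x * v x * indicator {c..} x + ?w x * ?R x * indicator {c..} x"
        using mult_left_mono[OF uv[of x], of "?w x"] Suc.prems by (cases "c \<le> x") (auto simp: distrib_left)
    qed
    also have "\<dots> = (\<integral>\<^sup>+x. ?w x * v x * indicator {c..} x \<partial>lborel) + (\<integral>\<^sup>+x. ?w x * ?R x * indicator {c..} x \<partial>lborel)"
      by (rule nn_integral_add) measurable
    also have "\<dots> \<le> (\<integral>\<^sup>+x. ?w x * v x * indicator {c..} x \<partial>lborel) + ennreal (\<theta> / (\<theta> + 1) * A * c powr (- \<theta> - 1))"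
      by (intro add_left_mono rem)
    finally show ?thesis .
  qed
  have Cm: "?C \<in> borel_measurable borel" by measurable
  show ?case
    unfolding Peq Ceq Heq using main[OF Cm, of ?H] main[OF Hm, of ?C] IH by blast
qed

lemma GEM_transform_eq:
  assumes \<theta>: "0 < \<theta>" and c: "0 < c"
  shows "GEM_transform \<alpha> \<theta> c = ennreal (tilt c powr (- (\<theta> / \<alpha>)))"
proof -
  let ?e = "\<lambda>m. ennreal (s / ((1 - s) * \<alpha>) * (\<theta> * (\<Prod>i<m. 1 - (1 - \<alpha>) / (\<theta> + 1 + real i * \<alpha>))) * c powr (- \<theta> - 1))"
  have "(\<lambda>m. s / ((1 - s) * \<alpha>) * (\<theta> * (\<Prod>i<m. 1 - (1 - \<alpha>) / (\<theta> + 1 + real i * \<alpha>))) * c powr (- \<theta> - 1))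
    \<longlonglongrightarrow> s / ((1 - s) * \<alpha>) * (\<theta> * 0) * c powr (- \<theta> - 1)"
    using \<alpha> \<theta> by (intro tendsto_intros prod_tendsto_0_harmonic) auto
  then have e: "?e \<longlonglongrightarrow> 0" using tendsto_ennrealI by fastforce
  have lim: "(\<lambda>m. x + ?e m) \<longlonglongrightarrow> x" for x
    using tendsto_add[OF tendsto_const[of x] e] by simp
  show ?thesis
  proof (rule antisym)
    show "GEM_transform \<alpha> \<theta> c \<le> ennreal (tilt c powr (- (\<theta> / \<alpha>)))"
      using GEM_transform_close[OF assms] by (intro LIMSEQ_le_const[OF lim]) auto
    show "ennreal (tilt c powr (- (\<theta> / \<alpha>))) \<le> GEM_transform \<alpha> \<theta> c"
      using GEM_transform_close[OF assms] by (intro LIMSEQ_le_const[OF lim]) auto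
  qed
qed

end

end

section \<open>Decreasing rearrangements\<close>

abbreviation rearrangement_bounds :: "(nat \<Rightarrow> real) \<Rightarrow> nat \<Rightarrow> real set" where
  "rearrangement_bounds x n \<equiv> {t. 0 \<le> t \<and> finite {i. t < x i} \<and> card {i. t < x i} \<le> n}"

text \<open>Replaces finiteness and cardinality by a quantifier over lists. For indices in
  \<open>nat\<close> there are only countably many lists, which is what measurability needs.\<close>

lemma finite_card_le_iff_lists:
  fixes A :: "'a set"
  shows "finite A \<and> card A \<le> n \<longleftrightarrow> (\<forall>xs. distinct xs \<and> length xs = Suc n \<longrightarrow> (\<exists>a\<in>set xs. a \<notin> A))"
proof (intro iffI allI impI)
  fix xs :: "'a list" assume *: "finite A \<and> card A \<le> n" "distinct xs \<and> length xs = Suc n"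
  show "\<exists>a\<in>set xs. a \<notin> A"
  proof (rule ccontr)
    assume "\<not> ?thesis"
    then have "card (set xs) \<le> card A" using * by (intro card_mono) auto
    with * show False by (simp add: distinct_card)
  qed
next
  assume *: "\<forall>xs. distinct xs \<and> length xs = Suc n \<longrightarrow> (\<exists>a\<in>set xs. a \<notin> A)"
  have no: False if "F \<subseteq> A" "finite F" "card F = Suc n" for F
    using finite_distinct_list[OF that(2)] * that by (metis distinct_card subsetD)
  show "finite A \<and> card A \<le> n"
  proof (rule ccontr)
    assume "\<not> ?thesis"
    then have "infinite A \<or> Suc n \<le> card A" by auto
    then show False
      using no infinite_arbitrarily_large[of A "Suc n"] obtain_subset_with_card_n[of "Suc n" A]
      by (metis card_ge_0_finite zero_less_Suc)
  qed
qed

lemma measurable_decreasing_rearrangement [measurable]: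
  "decreasing_rearrangement \<in> seq_space \<rightarrow>\<^sub>M seq_space"
proof (rule measurable_seq_spaceI)
  fix n
  let ?B = "\<lambda>x. rearrangement_bounds x n"
  have up: "u \<in> ?B x" if "t \<in> ?B x" "t \<le> u" for t u x
  proof -
    have "{i. u < x i} \<subseteq> {i. t < x i}" using that by auto
    moreover have "finite {i. t < x i}" "card {i. t < x i} \<le> n" "0 \<le> t" using that by auto
    ultimately show ?thesis
      using that card_mono[of "{i. t < x i}" "{i. u < x i}"] by (auto intro: finite_subset)
  qed
  have B: "q \<in> ?B x \<longleftrightarrow> 0 \<le> q \<and> (\<forall>xs. distinct xs \<and> length xs = Suc n \<longrightarrow> (\<exists>i\<in>set xs. x i \<le> q))" for q x
    using finite_card_le_iff_lists[of "{i. q < x i}" n] by (simp add: not_less)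
  \<comment> \<open>The set of bounds is upward closed, so rational thresholds decide the infimum.
    For a sequence without any bound the infimum is the fixed value \<open>Inf {}\<close>; this case
    is kept because measurability concerns all sequences.\<close>
  have less: "(decreasing_rearrangement x n < a) \<longleftrightarrow>
    (\<exists>q::rat. of_rat q < a \<and> of_rat q \<in> ?B x) \<or> ((\<forall>q::rat. of_rat q \<notin> ?B x) \<and> Inf {} < a)" for x a
  proof (cases "?B x = {}")
    case True
    then show ?thesis unfolding decreasing_rearrangement_def by (simp only: True) simp
  next
    case False
    then obtain t where t: "t \<in> ?B x" by auto
    obtain q where "t < of_rat q" using of_rat_dense[of t "t + 1"] by auto
    then have ex: "of_rat q \<in> ?B x" by (intro up[OF t]) simp
    have bdd: "bdd_below (?B x)" by (rule bdd_belowI[of _ 0]) auto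
    have "(Inf (?B x) < a) \<longleftrightarrow> (\<exists>t\<in>?B x. t < a)"
      by (rule cInf_less_iff[OF False bdd])
    also have "\<dots> \<longleftrightarrow> (\<exists>q::rat. of_rat q < a \<and> of_rat q \<in> ?B x)"
    proof
      assume "\<exists>t\<in>?B x. t < a"
      then obtain t where t: "t \<in> ?B x" "t < a" by auto
      then obtain q where "t < of_rat q" "of_rat q < a" using of_rat_dense by blast
      then show "\<exists>q::rat. of_rat q < a \<and> of_rat q \<in> ?B x" using up[OF t(1), of "of_rat q"] by (intro exI[of _ q]) (simp only: less_imp_le simp_thms)
    next
      assume "\<exists>q::rat. of_rat q < a \<and> of_rat q \<in> ?B x"
      then obtain q :: rat where "of_rat q < a" "of_rat q \<in> ?B x" by blast
      then show "\<exists>t\<in>?B x. t < a" by blast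
    qed
    finally show ?thesis unfolding decreasing_rearrangement_def using ex by blast
  qed
  show "(\<lambda>x. decreasing_rearrangement x n) \<in> borel_measurable seq_space"
  proof (subst borel_measurable_iff_less, intro allI)
    fix a :: real
    show "{x \<in> space seq_space. decreasing_rearrangement x n < a} \<in> sets seq_space"
      unfolding less B by measurable
  qed
qed

lemma finite_sub_mass_above:
  assumes p: "sub_mass p" and t: "0 < t"
  shows "finite {i. t < p i}"
proof -
  have "p \<longlonglongrightarrow> 0" using p by (intro summable_LIMSEQ_zero) (simp add: sub_mass_def)
  then have "\<forall>\<^sub>F i in sequentially. p i < t" using t by (rule order_tendstoD)
  then obtain N where "\<And>i. N \<le> i \<Longrightarrow> p i < t" by (auto simp: eventually_sequentially)
  then have "{i. t < p i} \<subseteq> {..<N}" by (metis (mono_tags, lifting) lessThan_iff mem_Collect_eq not_le not_less_iff_gr_or_eq subsetI)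
  then show ?thesis by (rule finite_subset) simp
qed

lemma sub_mass_le_1: "sub_mass p \<Longrightarrow> p i \<le> 1"
  using sum_le_suminf[of p "{i}"] by (auto simp: sub_mass_def intro: order_trans)

text \<open>On positive levels the rearrangement has the same counting function as \<open>p\<close>.
  Strictness survives the infimum because only finitely many values exceed \<open>t\<close>, so the
  least of them stays away from \<open>t\<close>.\<close>

lemma
  assumes p: "sub_mass p"
  shows decreasing_rearrangement_nonneg: "0 \<le> decreasing_rearrangement p n"
    and less_decreasing_rearrangement_iff: "0 < t \<Longrightarrow> t < decreasing_rearrangement p n \<longleftrightarrow> n < card {i. t < p i}"
proof -
  let ?B = "rearrangement_bounds p n"
  have e: "{i. 1 < p i} = {}" using sub_mass_le_1[OF p] by (auto simp: not_less)
  have "1 \<in> ?B" by (simp add: e)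
  then have ne: "?B \<noteq> {}" by blast
  have bdd: "bdd_below ?B" by (rule bdd_belowI[of _ 0]) auto
  show "0 \<le> decreasing_rearrangement p n"
    unfolding decreasing_rearrangement_def using ne by (intro cInf_greatest) auto
  assume t: "0 < t"
  have fin: "finite {i. t < p i}" by (rule finite_sub_mass_above[OF p t])
  show "t < decreasing_rearrangement p n \<longleftrightarrow> n < card {i. t < p i}"
  proof
    assume "t < decreasing_rearrangement p n"
    then have "t \<notin> ?B" using cInf_lower[OF _ bdd, of t] unfolding decreasing_rearrangement_def by fastforce
    then show "n < card {i. t < p i}" using t fin by auto
  next
    assume n: "n < card {i. t < p i}"
    \<comment> \<open>The least value above \<open>t\<close>: any bound below it would still leave
      more than \<open>n\<close> entries above.\<close>
    define \<mu> where "\<mu> = Min (p ` {i. t < p i})"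
    have ne': "{i. t < p i} \<noteq> {}" using n by (metis card.empty not_less_zero)
    have "t < \<mu>" unfolding \<mu>_def using fin ne' by (subst Min_gr_iff) auto
    also have "\<mu> \<le> decreasing_rearrangement p n"
      unfolding decreasing_rearrangement_def
    proof (rule cInf_greatest[OF ne])
      fix u assume u: "u \<in> ?B"
      show "\<mu> \<le> u"
      proof (rule ccontr)
        assume "\<not> \<mu> \<le> u"
        then have "{i. t < p i} \<subseteq> {i. u < p i}"
          using fin by (auto simp: \<mu>_def not_le Min_gr_iff intro: less_le_trans[OF _ Min_le])
        then have "card {i. t < p i} \<le> card {i. u < p i}" using u by (intro card_mono) auto
        with n u show False by simp
      qed
    qed
    finally show "t < decreasing_rearrangement p n" .
  qed
qed

lemma suminf_indicator_card:
  assumes "finite {i. t < p i}" and t: "0 < t"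
  shows "(\<Sum>i. indicator {0<..<p i} t :: ennreal) = of_nat (card {i::nat. t < p i})"
proof -
  have "(\<Sum>i. indicator {0<..<p i} t :: ennreal) = (\<Sum>i\<in>{i. t < p i}. indicator {0<..<p i} t)"
    using assms by (intro suminf_finite) auto
  also have "\<dots> = (\<Sum>i\<in>{i. t < p i}. 1)" using t by (intro sum.cong) auto
  finally show ?thesis by simp
qed

text \<open>Layer-cake formula: the sum depends on \<open>p\<close> only through its counting
  function on positive levels, and \<open>h 0 = 0\<close> makes zero entries irrelevant. Invariance
  under decreasing rearrangement follows without constructing a permutation.\<close>

lemma suminf_layer_cake:
  assumes p: "\<And>i. 0 \<le> p i" "\<And>t. 0 < t \<Longrightarrow> finite {i. t < p i}"
    and [measurable]: "h' \<in> borel_measurable borel"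
    and h: "\<And>x. 0 \<le> x \<Longrightarrow> (h has_real_derivative h' x) (at x)" "h 0 = 0" "\<And>x. 0 \<le> x \<Longrightarrow> 0 \<le> h' x"
  shows "(\<Sum>i. ennreal (h (p i))) = (\<integral>\<^sup>+t. ennreal (h' t) * of_nat (card {i::nat. t < p i}) * indicator {0<..} t \<partial>lborel)"
proof -
  have "ennreal (h (p i)) = (\<integral>\<^sup>+t. ennreal (h' t) * indicator {0<..<p i} t \<partial>lborel)" for i
  proof -
    have "ennreal (h (p i)) = (\<integral>\<^sup>+t. ennreal (h' t) * indicator {0..p i} t \<partial>lborel)"
      using h p by (subst nn_integral_FTC_Icc[where F = h]) (auto intro: has_field_derivative_at_within)
    also have "\<dots> = (\<integral>\<^sup>+t. ennreal (h' t) * indicator {0<..<p i} t \<partial>lborel)"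
    proof (rule nn_integral_cong_AE)
      show "AE t in lborel. ennreal (h' t) * indicator {0..p i} t = ennreal (h' t) * indicator {0<..<p i} t"
        using AE_lborel_singleton[of 0] AE_lborel_singleton[of "p i"]
        by eventually_elim (auto simp: indicator_def)
    qed
    finally show ?thesis .
  qed
  then have "(\<Sum>i. ennreal (h (p i))) = (\<integral>\<^sup>+t. (\<Sum>i. ennreal (h' t) * indicator {0<..<p i} t) \<partial>lborel)"
    by (subst nn_integral_suminf) simp_all
  also have "\<dots> = (\<integral>\<^sup>+t. ennreal (h' t) * of_nat (card {i. t < p i}) * indicator {0<..} t \<partial>lborel)"
  proof (rule nn_integral_cong)
    fix t :: real
    show "(\<Sum>i. ennreal (h' t) * indicator {0<..<p i} t) = ennreal (h' t) * of_nat (card {i. t < p i}) * indicator {0<..} t"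
    proof (cases "0 < t")
      case True
      have "(\<Sum>i. ennreal (h' t) * indicator {0<..<p i} t) = ennreal (h' t) * (\<Sum>i. indicator {0<..<p i} t)" by simp
      then show ?thesis using True by (simp add: suminf_indicator_card[OF p(2)[OF True] True])
    qed simp
  qed
  finally show ?thesis .
qed

lemma suminf_decreasing_rearrangement:
  assumes p: "sub_mass p" and h': "h' \<in> borel_measurable borel"
    and h: "\<And>x. 0 \<le> x \<Longrightarrow> (h has_real_derivative h' x) (at x)" "h 0 = 0" "\<And>x. 0 \<le> x \<Longrightarrow> 0 \<le> h' x"
  shows "(\<Sum>i. ennreal (h (decreasing_rearrangement p i))) = (\<Sum>i. ennreal (h (p i)))"
proof -
  have set: "{n. t < decreasing_rearrangement p n} = {..<card {i. t < p i}}" if "0 < t" for t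
    using less_decreasing_rearrangement_iff[OF p that] by auto
  have "(\<Sum>i. ennreal (h (decreasing_rearrangement p i))) =
    (\<integral>\<^sup>+t. ennreal (h' t) * of_nat (card {i. t < decreasing_rearrangement p i}) * indicator {0<..} t \<partial>lborel)"
    using set decreasing_rearrangement_nonneg[OF p] by (intro suminf_layer_cake h' h) auto
  also have "\<dots> = (\<integral>\<^sup>+t. ennreal (h' t) * of_nat (card {i. t < p i}) * indicator {0<..} t \<partial>lborel)"
    using set by (intro nn_integral_cong) (auto simp: indicator_def)
  also have "\<dots> = (\<Sum>i. ennreal (h (p i)))"
    using p finite_sub_mass_above[OF p] by (intro suminf_layer_cake[symmetric] h' h) (auto simp: sub_mass_def)
  finally show ?thesis .
qed

lemma sub_mass_decreasing_rearrangement: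
  assumes p: "sub_mass p"
  shows "sub_mass (decreasing_rearrangement p)"
proof -
  note nn = decreasing_rearrangement_nonneg[OF p]
  have "(\<Sum>i. ennreal (decreasing_rearrangement p i)) = (\<Sum>i. ennreal (p i))"
    using suminf_decreasing_rearrangement[OF p, of "\<lambda>_. 1" "\<lambda>x. x"] by simp
  also have "\<dots> = ennreal (\<Sum>i. p i)" using p by (intro suminf_ennreal2) (auto simp: sub_mass_def)
  finally have eq: "(\<Sum>i. ennreal (decreasing_rearrangement p i)) = ennreal (\<Sum>i. p i)" .
  then have summ: "summable (decreasing_rearrangement p)"
    using nn by (intro summable_suminf_not_top) auto
  then have "ennreal (\<Sum>i. decreasing_rearrangement p i) = ennreal (\<Sum>i. p i)"
    using eq nn by (subst (asm) suminf_ennreal2) auto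
  then have "(\<Sum>i. decreasing_rearrangement p i) = (\<Sum>i. p i)"
    using p summ nn by (subst (asm) ennreal_inj) (auto simp: sub_mass_def intro!: suminf_nonneg)
  with p summ nn show ?thesis by (simp add: sub_mass_def)
qed

text \<open>\<open>mark_rate s (t * x)\<close> vanishes at \<open>x = 0\<close> and is nondecreasing
  in \<open>x\<close>, so the layer-cake argument applies to the exponent.\<close>

lemma mark_survival_decreasing_rearrangement:
  assumes s: "0 \<le> s" "s < 1" and p: "sub_mass p" and t: "0 \<le> t"
  shows "mark_survival s t (decreasing_rearrangement p) = mark_survival s t p"
proof -
  note q = sub_mass_decreasing_rearrangement[OF p]
  let ?h' = "\<lambda>x. s * t * exp (- (t * x)) / (1 - s * (1 - exp (- (t * x))))"
  have "(\<Sum>i. ennreal (mark_rate s (t * decreasing_rearrangement p i))) = (\<Sum>i. ennreal (mark_rate s (t * p i)))"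
  proof (rule suminf_decreasing_rearrangement[OF p, of ?h' "\<lambda>x. mark_rate s (t * x)"])
    fix x :: real assume x: "0 \<le> x"
    have pos: "0 < 1 - s * (1 - exp (- (t * x)))" using s t x by (intro mark_factor_pos) auto
    then show "((\<lambda>x. mark_rate s (t * x)) has_real_derivative ?h' x) (at x)"
      unfolding mark_rate_def by (auto intro!: derivative_eq_intros simp: field_simps)
    show "0 \<le> ?h' x" using pos s t by auto
  qed (auto simp: mark_rate_def)
  moreover have "(\<Sum>i. ennreal (mark_rate s (t * q i))) = ennreal (\<Sum>i. mark_rate s (t * q i))" if "sub_mass q" for q
    using that t s by (intro suminf_ennreal2 mark_rate_nonneg summable_mark_rate) (auto simp: sub_mass_def)
  moreover have "0 \<le> (\<Sum>i. mark_rate s (t * q i))" if "sub_mass q" for q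
    using that t s by (intro suminf_nonneg mark_rate_nonneg summable_mark_rate) (auto simp: sub_mass_def)
  ultimately have "(\<Sum>i. mark_rate s (t * decreasing_rearrangement p i)) = (\<Sum>i. mark_rate s (t * p i))"
    using p q by (metis ennreal_inj)
  then show ?thesis by (simp add: mark_survival_def)
qed

lemma measurable_sub_mass [measurable]: "Measurable.pred seq_space sub_mass"
proof -
  have eq: "sub_mass p \<longleftrightarrow> (\<forall>a. 0 \<le> p a) \<and> (\<forall>m. (\<Sum>a<m. p a) \<le> 1)" for p
    using summableI_nonneg_bounded[of p 1] suminf_le_const[of p 1] sum_le_suminf[of p]
    unfolding sub_mass_def by (metis finite_lessThan order_trans)
  show ?thesis unfolding eq by measurable
qed

lemma
  assumes \<gamma>: "0 \<le> \<gamma>" "\<gamma> < 1" and \<theta>: "- \<gamma> < \<theta>"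
  shows AE_PD_sub_mass: "AE p in PD \<gamma> \<theta>. sub_mass p"
    and nn_integral_PD_mark_survival: "0 \<le> s \<Longrightarrow> s < 1 \<Longrightarrow> 0 \<le> t \<Longrightarrow>
      (\<integral>\<^sup>+p. ennreal (mark_survival s t p) \<partial>PD \<gamma> \<theta>) = GEM_survival s \<gamma> \<theta> t"
proof -
  have m: "decreasing_rearrangement \<in> GEM \<gamma> \<theta> \<rightarrow>\<^sub>M seq_space" by measurable
  have AE: "AE p in GEM \<gamma> \<theta>. sub_mass p" by (rule AE_GEM_sub_mass[OF assms])
  show "AE p in PD \<gamma> \<theta>. sub_mass p"
    unfolding PD_def using AE
    by (subst AE_distr_iff[OF m]) (auto elim!: eventually_mono intro: sub_mass_decreasing_rearrangement)
  assume s: "0 \<le> s" "s < 1" "0 \<le> t"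
  have "(\<integral>\<^sup>+p. ennreal (mark_survival s t p) \<partial>PD \<gamma> \<theta>) = (\<integral>\<^sup>+p. ennreal (mark_survival s t (decreasing_rearrangement p)) \<partial>GEM \<gamma> \<theta>)"
    unfolding PD_def by (subst nn_integral_distr[OF m]) auto
  also have "\<dots> = GEM_survival s \<gamma> \<theta> t"
    unfolding GEM_survival_def[OF s(1,2)] using AE s
    by (intro nn_integral_cong_AE) (auto elim!: eventually_mono simp: mark_survival_decreasing_rearrangement)
  finally show "(\<integral>\<^sup>+p. ennreal (mark_survival s t p) \<partial>PD \<gamma> \<theta>) = GEM_survival s \<gamma> \<theta> t" .
qed

section \<open>Sampling from a random mass partition\<close>

text \<open>Mark the elements of \<open>A\<close> independently with probability \<open>s\<close>:
  both sides are the probability that the marked set \<open>U\<close> misses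
  \<open>X\<close>.\<close>

lemma power_card_eq_sum_marks:
  fixes s :: real
  assumes A: "finite A" and X: "X \<subseteq> A"
  shows "(1 - s) ^ card X = (\<Sum>U\<in>Pow A. if U \<inter> X = {} then s ^ card U * (1 - s) ^ card (A - U) else 0)"
proof -
  have fin: "finite (A - X)" using A by simp
  have "1 = (\<Prod>a\<in>A - X. s + (1 - s))" by simp
  also have "\<dots> = (\<Sum>U\<in>Pow (A - X). (\<Prod>a\<in>U. s) * (\<Prod>a\<in>A - X - U. 1 - s))"
    by (rule prod_add[OF fin])
  finally have "(1 - s) ^ card X = (\<Sum>U\<in>Pow (A - X). s ^ card U * ((1 - s) ^ card (A - X - U) * (1 - s) ^ card X))"
    by (simp add: sum_distrib_left[symmetric] mult.assoc[symmetric] sum_distrib_right[symmetric])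
  also have "\<dots> = (\<Sum>U\<in>Pow (A - X). s ^ card U * (1 - s) ^ card (A - U))"
  proof (intro sum.cong refl)
    fix U assume "U \<in> Pow (A - X)"
    then have "A - U = (A - X - U) \<union> X" "(A - X - U) \<inter> X = {}" using X by auto
    then have "card (A - U) = card (A - X - U) + card X"
      using A X by (metis card_Un_disjoint finite_Diff finite_subset)
    then show "s ^ card U * ((1 - s) ^ card (A - X - U) * (1 - s) ^ card X) = s ^ card U * (1 - s) ^ card (A - U)"
      by (simp add: power_add)
  qed
  also have "\<dots> = (\<Sum>U\<in>{U \<in> Pow A. U \<inter> X = {}}. s ^ card U * (1 - s) ^ card (A - U))"
    by (intro sum.cong) auto
  also have "\<dots> = (\<Sum>U\<in>Pow A. if U \<inter> X = {} then s ^ card U * (1 - s) ^ card (A - U) else 0)"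
    using A by (intro sum.inter_filter) simp
  finally show ?thesis .
qed

text \<open>Exchanging the average over the marks with the sum over tuples: for a fixed marked set
  \<open>U\<close> the tuples avoiding \<open>U\<close> range over a full product, and their weights
  factor into a power.\<close>

lemma sum_tuples_power_card:
  fixes q :: "'a \<Rightarrow> real" and s :: real
  assumes A: "finite A"
  shows "(\<Sum>i\<in>({..<n::nat} \<rightarrow>\<^sub>E A). (1 - s) ^ card (i ` {..<n}) * (\<Prod>j<n. q (i j))) =
    (\<Sum>U\<in>Pow A. s ^ card U * (1 - s) ^ card (A - U) * (\<Sum>a\<in>A - U. q a) ^ n)"
proof -
  let ?w = "\<lambda>U. s ^ card U * (1 - s) ^ card (A - U)"
  let ?T = "{..<n} \<rightarrow>\<^sub>E A"
  have fin: "finite ?T" using A by (intro finite_PiE) auto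
  have "(\<Sum>i\<in>?T. (1 - s) ^ card (i ` {..<n}) * (\<Prod>j<n. q (i j))) =
    (\<Sum>i\<in>?T. \<Sum>U\<in>Pow A. if U \<inter> i ` {..<n} = {} then ?w U * (\<Prod>j<n. q (i j)) else 0)"
  proof (intro sum.cong refl)
    fix i assume "i \<in> ?T"
    then have "i ` {..<n} \<subseteq> A" by auto
    from power_card_eq_sum_marks[OF A this, of s]
    show "(1 - s) ^ card (i ` {..<n}) * (\<Prod>j<n. q (i j)) = (\<Sum>U\<in>Pow A. if U \<inter> i ` {..<n} = {} then ?w U * (\<Prod>j<n. q (i j)) else 0)"
      by (simp add: sum_distrib_right if_distrib[of "\<lambda>x. x * _"] cong: if_cong)
  qed
  also have "\<dots> = (\<Sum>U\<in>Pow A. \<Sum>i\<in>?T. if U \<inter> i ` {..<n} = {} then ?w U * (\<Prod>j<n. q (i j)) else 0)"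
    by (rule sum.swap)
  also have "\<dots> = (\<Sum>U\<in>Pow A. ?w U * (\<Sum>a\<in>A - U. q a) ^ n)"
  proof (intro sum.cong refl)
    fix U assume U: "U \<in> Pow A"
    have "(\<Sum>i\<in>?T. if U \<inter> i ` {..<n} = {} then ?w U * (\<Prod>j<n. q (i j)) else 0) =
      (\<Sum>i\<in>{i\<in>?T. U \<inter> i ` {..<n} = {}}. ?w U * (\<Prod>j<n. q (i j)))"
      by (rule sum.inter_filter[symmetric, OF fin])
    also have "{i\<in>?T. U \<inter> i ` {..<n} = {}} = ({..<n} \<rightarrow>\<^sub>E (A - U))"
    proof (intro set_eqI)
      fix i
      have "U \<inter> i ` {..<n} = {} \<longleftrightarrow> (\<forall>j<n. i j \<notin> U)" by blast
      then show "i \<in> {i\<in>?T. U \<inter> i ` {..<n} = {}} \<longleftrightarrow> i \<in> ({..<n} \<rightarrow>\<^sub>E (A - U))"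
        by (auto simp only: PiE_iff mem_Collect_eq Diff_iff lessThan_iff)
    qed
    also have "(\<Sum>i\<in>({..<n} \<rightarrow>\<^sub>E (A - U)). ?w U * (\<Prod>j<n. q (i j))) = ?w U * (\<Prod>j<n. \<Sum>a\<in>A - U. q a)"
      using A by (subst prod_sum_PiE) (auto simp: sum_distrib_left)
    finally show "(\<Sum>i\<in>?T. if U \<inter> i ` {..<n} = {} then ?w U * (\<Prod>j<n. q (i j)) else 0) = ?w U * (\<Sum>a\<in>A - U. q a) ^ n"
      by simp
  qed
  finally show ?thesis .
qed

text \<open>With a Poisson number of draws the powers add up to exponentials, and the sum over
  marked sets is the expansion of a product over atoms. Poisson sampling thus makes the atoms
  independent of each other.\<close>

lemma poisson_sum_tuples:
  fixes q :: "'a \<Rightarrow> real" and s :: real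
  assumes A: "finite A"
  shows "(\<lambda>n. exp (- t) * t ^ n / fact n * (\<Sum>i\<in>({..<n::nat} \<rightarrow>\<^sub>E A). (1 - s) ^ card (i ` {..<n}) * (\<Prod>j<n. q (i j)))) sums
    (exp (- t) * (\<Prod>a\<in>A. s + (1 - s) * exp (t * q a)))"
proof -
  let ?w = "\<lambda>U. s ^ card U * (1 - s) ^ card (A - U)"
  have "(\<lambda>n. exp (- t) * (\<Sum>U\<in>Pow A. ?w U * ((t * (\<Sum>a\<in>A - U. q a)) ^ n /\<^sub>R fact n))) sums
    (exp (- t) * (\<Sum>U\<in>Pow A. ?w U * exp (t * (\<Sum>a\<in>A - U. q a))))"
    by (intro sums_mult sums_sum exp_converges)
  moreover have "exp (- t) * (\<Sum>U\<in>Pow A. ?w U * ((t * (\<Sum>a\<in>A - U. q a)) ^ n /\<^sub>R fact n)) =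
    exp (- t) * t ^ n / fact n * (\<Sum>i\<in>({..<n::nat} \<rightarrow>\<^sub>E A). (1 - s) ^ card (i ` {..<n}) * (\<Prod>j<n. q (i j)))" for n
    unfolding sum_tuples_power_card[OF A] sum_distrib_left
    by (intro sum.cong refl) (simp add: sum_distrib_left[symmetric] power_mult_distrib divide_inverse mult_ac)
  moreover have "(\<Sum>U\<in>Pow A. ?w U * exp (t * (\<Sum>a\<in>A - U. q a))) = (\<Prod>a\<in>A. s + (1 - s) * exp (t * q a))"
    using A by (simp add: prod_add[OF A] prod.distrib exp_sum sum_distrib_left mult.assoc)
  ultimately show ?thesis by simp
qed

definition num_distinct :: "(nat \<Rightarrow> 'b \<Rightarrow> nat) \<Rightarrow> nat \<Rightarrow> 'b \<Rightarrow> nat" where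
  "num_distinct I n \<omega> = card ((\<lambda>j. I j \<omega>) ` {..<n})"

section \<open>Marked Poisson sampling from a random mass partition\<close>

context
  fixes N :: "'b measure" and Q :: "nat \<Rightarrow> 'b \<Rightarrow> real" and I :: "nat \<Rightarrow> 'b \<Rightarrow> nat"
  assumes N: "prob_space N" and samp: "iid_sampled N Q I" and mass: "AE \<omega> in N. sub_mass (\<lambda>k. Q k \<omega>)"
begin

interpretation prob_space N by (rule N)

lemma measurable_iid_sampled: "Q k \<in> borel_measurable N" "I j \<in> measurable N (count_space UNIV)"
  using samp by (auto simp: iid_sampled_def)

lemma emeasure_sampled_tuple:
  "emeasure N {\<omega>\<in>space N. \<forall>j<n. I j \<omega> = i j} = (\<integral>\<^sup>+\<omega>. ennreal (\<Prod>j<n. Q (i j) \<omega>) \<partial>N)"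
proof -
  note [measurable] = measurable_iid_sampled
  have UN: "UNIV \<in> sets seq_space" using sets.top[of seq_space] by (simp add: space_PiM)
  have bnd: "AE \<omega> in N. 0 \<le> (\<Prod>j<n. Q (i j) \<omega>) \<and> (\<Prod>j<n. Q (i j) \<omega>) \<le> 1"
    using mass
  proof eventually_elim
    case (elim \<omega>)
    then have "0 \<le> Q k \<omega>" "Q k \<omega> \<le> 1" for k using sub_mass_le_1[OF elim, of k] by (auto simp: sub_mass_def)
    then show ?case by (auto intro!: prod_nonneg prod_le_1)
  qed
  have int: "integrable N (\<lambda>\<omega>. \<Prod>j<n. Q (i j) \<omega>)"
    by (rule integrable_const_bound[of _ 1], rule eventually_mono[OF bnd]) auto
  have "measure N {\<omega>\<in>space N. (\<lambda>k. Q k \<omega>) \<in> UNIV \<and> (\<forall>j<n. I j \<omega> = i j)} =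
        (\<integral>\<omega>. indicator UNIV (\<lambda>k. Q k \<omega>) * (\<Prod>j<n. Q (i j) \<omega>) \<partial>N)"
    using samp UN unfolding iid_sampled_def by blast
  then have "measure N {\<omega>\<in>space N. \<forall>j<n. I j \<omega> = i j} = (\<integral>\<omega>. (\<Prod>j<n. Q (i j) \<omega>) \<partial>N)" by simp
  then show ?thesis
    using nn_integral_eq_integral[OF int] bnd by (simp add: emeasure_eq_measure)
qed

text \<open>The first sampled index takes some value with probability 1, so the mean total mass is
  1; since the mass never exceeds 1, it equals 1 almost surely.\<close>

lemma AE_sampled_mass: "AE \<omega> in N. (\<Sum>k. Q k \<omega>) = 1"
proof -
  note [measurable] = measurable_iid_sampled
  have "(\<integral>\<^sup>+\<omega>. ennreal (\<Sum>k. Q k \<omega>) \<partial>N) = (\<integral>\<^sup>+\<omega>. (\<Sum>k. ennreal (Q k \<omega>)) \<partial>N)"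
    by (intro nn_integral_cong_AE eventually_mono[OF mass]) (auto simp: sub_mass_def suminf_ennreal2)
  also have "\<dots> = (\<Sum>k. \<integral>\<^sup>+\<omega>. ennreal (Q k \<omega>) \<partial>N)" by (rule nn_integral_suminf) simp
  also have "\<dots> = (\<Sum>k. emeasure N {\<omega>\<in>space N. I 0 \<omega> = k})"
    using emeasure_sampled_tuple[of 1 "\<lambda>_. k" for k] by (simp add: lessThan_Suc)
  also have "\<dots> = emeasure N (\<Union>k. {\<omega>\<in>space N. I 0 \<omega> = k})"
    by (rule suminf_emeasure) (auto simp: disjoint_family_on_def)
  also have "(\<Union>k. {\<omega>\<in>space N. I 0 \<omega> = k}) = space N" by auto
  finally have one: "(\<integral>\<^sup>+\<omega>. ennreal (\<Sum>k. Q k \<omega>) \<partial>N) = 1" by (simp add: emeasure_space_1)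
  have le: "AE \<omega> in N. 0 \<le> (\<Sum>k. Q k \<omega>) \<and> (\<Sum>k. Q k \<omega>) \<le> 1"
    using mass by eventually_elim (auto simp: sub_mass_def intro: suminf_nonneg)
  have int: "integrable N (\<lambda>\<omega>. \<Sum>k. Q k \<omega>)"
    by (rule integrable_const_bound[of _ 1], rule eventually_mono[OF le]) auto
  have "(\<integral>\<omega>. (\<Sum>k. Q k \<omega>) \<partial>N) = 1"
    using one le nn_integral_eq_integral[OF int] by simp
  then have "(\<integral>\<omega>. 1 - (\<Sum>k. Q k \<omega>) \<partial>N) = 0" using int by (simp add: prob_space)
  then have "AE \<omega> in N. 1 - (\<Sum>k. Q k \<omega>) = 0"
    using le int by (subst (asm) integral_nonneg_eq_0_iff_AE) simp_all
  then show ?thesis by (auto elim!: eventually_mono)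
qed

lemma measurable_num_distinct: "num_distinct I n \<in> measurable N (count_space UNIV)"
proof -
  note [measurable] = measurable_iid_sampled
  \<comment> \<open>Each value is counted at its first occurrence, which makes the cardinality a
    finite sum of indicators.\<close>
  have "num_distinct I n \<omega> = (\<Sum>j<n. if \<exists>k<j. I k \<omega> = I j \<omega> then 0 else 1)" for \<omega>
  proof -
    let ?F = "{j\<in>{..<n}. \<not> (\<exists>k<j. I k \<omega> = I j \<omega>)}"
    have inj: "inj_on (\<lambda>j. I j \<omega>) ?F" by (auto simp: inj_on_def) (metis linorder_neqE_nat)
    have "(\<lambda>j. I j \<omega>) ` {..<n} = (\<lambda>j. I j \<omega>) ` ?F"
    proof (intro equalityI subsetI)
      fix v assume "v \<in> (\<lambda>j. I j \<omega>) ` {..<n}"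
      then have ex: "\<exists>j. j < n \<and> I j \<omega> = v" by auto
      define j where "j = (LEAST j. j < n \<and> I j \<omega> = v)"
      have "j < n \<and> I j \<omega> = v" unfolding j_def by (rule LeastI_ex[OF ex])
      moreover have "\<not> (k < n \<and> I k \<omega> = v)" if "k < j" for k using not_less_Least that unfolding j_def by blast
      ultimately show "v \<in> (\<lambda>j. I j \<omega>) ` ?F" by (intro image_eqI[of _ _ j]) (auto dest: less_trans)
    qed auto
    then have "num_distinct I n \<omega> = card ?F" unfolding num_distinct_def using card_image[OF inj] by simp
    also have "\<dots> = (\<Sum>j\<in>{..<n}. if \<exists>k<j. I k \<omega> = I j \<omega> then 0 else 1)"
      by (simp add: card_eq_sum sum.inter_filter[symmetric] if_not_P del: sum_constant)
        (simp add: sum.If_cases Int_def)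
    finally show ?thesis .
  qed
  then have eq: "real (num_distinct I n \<omega>) = (\<Sum>j<n. if \<exists>k<j. I k \<omega> = I j \<omega> then 0 else 1)" for \<omega>
    by (simp add: of_nat_sum if_distrib[of real] cong: if_cong)
  have [measurable]: "Measurable.pred N (\<lambda>\<omega>. I k \<omega> = I j \<omega>)" for k j
  proof -
    have "(I k \<omega> = I j \<omega>) \<longleftrightarrow> (\<exists>v. I k \<omega> = v \<and> I j \<omega> = v)" for \<omega> by auto
    then show ?thesis by (simp only:) measurable
  qed
  have [measurable]: "(\<lambda>\<omega>. real (num_distinct I n \<omega>)) \<in> borel_measurable N"
    unfolding eq by measurable
  have "num_distinct I n = (\<lambda>\<omega>. nat \<lfloor>real (num_distinct I n \<omega>)\<rfloor>)" by simp
  also have "\<dots> \<in> measurable N (count_space UNIV)" by measurable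
  finally show ?thesis .
qed

text \<open>Given the partition and the marks, an index set of size \<open>num_distinct\<close> is
  free of marks with probability \<open>(1 - s) ^ num_distinct\<close>. Restricting to indices below
  \<open>m\<close> leaves finite sums, where \<open>poisson_sum_tuples\<close> applies; as
  \<open>m\<close> grows, the sampling side increases to its limit and the other side converges by
  domination.\<close>

lemma poisson_sampled:
  assumes s: "0 \<le> s" "s < 1" and t: "0 \<le> t"
  shows "(\<Sum>n. ennreal (exp (- t) * t ^ n / fact n) * (\<integral>\<^sup>+\<omega>. ennreal ((1 - s) ^ num_distinct I n \<omega>) \<partial>N)) =
    (\<integral>\<^sup>+\<omega>. ennreal (mark_survival s t (\<lambda>k. Q k \<omega>)) \<partial>N)"
proof -
  note [measurable] = measurable_iid_sampled measurable_num_distinct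
  let ?T = "\<lambda>n m. {..<n} \<rightarrow>\<^sub>E {..<m::nat}"
  \<comment> \<open>Keeps only the event that the first \<open>n\<close> samples are below
    \<open>m\<close>; for each outcome this holds for all large \<open>m\<close>.\<close>
  define g where "g m n \<omega> = ennreal ((1 - s) ^ num_distinct I n \<omega>) * indicator {\<omega>. \<forall>j<n. I j \<omega> < m} \<omega>" for m n \<omega>
  have [measurable]: "g m n \<in> borel_measurable N" for m n unfolding g_def[abs_def] by measurable
  have g_inc: "incseq (\<lambda>m. g m n \<omega>)" for n \<omega>
    by (auto simp: incseq_def g_def indicator_def intro: less_le_trans)
  have g_SUP: "(SUP m. g m n \<omega>) = ennreal ((1 - s) ^ num_distinct I n \<omega>)" for n \<omega>
  proof (rule antisym)
    show "(SUP m. g m n \<omega>) \<le> ennreal ((1 - s) ^ num_distinct I n \<omega>)"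
      by (rule SUP_least) (auto simp: g_def indicator_def)
    have "I j \<omega> < Suc (Max ((\<lambda>j. I j \<omega>) ` {..<n}))" if "j < n" for j
      using that by (auto simp: less_Suc_eq_le)
    then have "ennreal ((1 - s) ^ num_distinct I n \<omega>) = g (Suc (Max ((\<lambda>j. I j \<omega>) ` {..<n}))) n \<omega>"
      by (simp add: g_def)
    then show "ennreal ((1 - s) ^ num_distinct I n \<omega>) \<le> (SUP m. g m n \<omega>)"
      by (metis SUP_upper UNIV_I)
  qed
  have g_int: "(\<integral>\<^sup>+\<omega>. g m n \<omega> \<partial>N) =
    (\<integral>\<^sup>+\<omega>. ennreal (\<Sum>i\<in>?T n m. (1 - s) ^ card (i ` {..<n}) * (\<Prod>j<n. Q (i j) \<omega>)) \<partial>N)" for m n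
  proof -
    have fin: "finite (?T n m)" by (intro finite_PiE) auto
    have "(\<integral>\<^sup>+\<omega>. g m n \<omega> \<partial>N) = (\<integral>\<^sup>+\<omega>. (\<Sum>i\<in>?T n m. ennreal ((1 - s) ^ card (i ` {..<n})) * indicator {\<omega>\<in>space N. \<forall>j<n. I j \<omega> = i j} \<omega>) \<partial>N)"
    proof (rule nn_integral_cong)
      fix \<omega> assume \<omega>: "\<omega> \<in> space N"
      let ?i = "restrict (\<lambda>j. I j \<omega>) {..<n}"
      have iff: "(\<forall>j<n. I j \<omega> = i j) \<longleftrightarrow> i = ?i" if "i \<in> ?T n m" for i
        using that by (auto simp: fun_eq_iff PiE_iff extensional_def)
      have "(\<Sum>i\<in>?T n m. ennreal ((1 - s) ^ card (i ` {..<n})) * indicator {\<omega>\<in>space N. \<forall>j<n. I j \<omega> = i j} \<omega>) =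
        (\<Sum>i\<in>?T n m. if i = ?i then ennreal ((1 - s) ^ card (?i ` {..<n})) else 0)"
        using \<omega> iff by (intro sum.cong refl) (auto simp: indicator_def)
      also have "\<dots> = (if ?i \<in> ?T n m then ennreal ((1 - s) ^ card (?i ` {..<n})) else 0)"
        using fin by (simp add: sum.delta)
      also have "\<dots> = g m n \<omega>"
        by (auto simp: g_def num_distinct_def indicator_def PiE_iff)
      finally show "g m n \<omega> = (\<Sum>i\<in>?T n m. ennreal ((1 - s) ^ card (i ` {..<n})) * indicator {\<omega>\<in>space N. \<forall>j<n. I j \<omega> = i j} \<omega>)" ..
    qed
    also have "\<dots> = (\<Sum>i\<in>?T n m. ennreal ((1 - s) ^ card (i ` {..<n})) * emeasure N {\<omega>\<in>space N. \<forall>j<n. I j \<omega> = i j})"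
      by (subst nn_integral_sum) (auto simp: nn_integral_cmult_indicator intro!: sum.cong)
    also have "\<dots> = (\<integral>\<^sup>+\<omega>. (\<Sum>i\<in>?T n m. ennreal ((1 - s) ^ card (i ` {..<n})) * ennreal (\<Prod>j<n. Q (i j) \<omega>)) \<partial>N)"
      unfolding emeasure_sampled_tuple by (rule nn_integral_sum_cmult[symmetric]) simp
    also have "\<dots> = (\<integral>\<^sup>+\<omega>. ennreal (\<Sum>i\<in>?T n m. (1 - s) ^ card (i ` {..<n}) * (\<Prod>j<n. Q (i j) \<omega>)) \<partial>N)"
    proof (rule nn_integral_cong_AE)
      show "AE \<omega> in N. (\<Sum>i\<in>?T n m. ennreal ((1 - s) ^ card (i ` {..<n})) * ennreal (\<Prod>j<n. Q (i j) \<omega>)) =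
        ennreal (\<Sum>i\<in>?T n m. (1 - s) ^ card (i ` {..<n}) * (\<Prod>j<n. Q (i j) \<omega>))"
        using mass
      proof eventually_elim
        case (elim \<omega>)
        then have "0 \<le> (\<Prod>j<n. Q (i j) \<omega>)" for i by (intro prod_nonneg) (auto simp: sub_mass_def)
        then show ?case using s by (subst sum_ennreal[symmetric]) (auto simp: ennreal_mult'[symmetric])
      qed
    qed
    finally show ?thesis .
  qed
  define p where "p n = exp (- t) * t ^ n / fact n" for n
  have p: "0 \<le> p n" for n using t by (simp add: p_def)
  let ?F = "\<lambda>m \<omega>. exp (- t) * (\<Prod>a<m. s + (1 - s) * exp (t * Q a \<omega>))"
  have sum_m: "(\<Sum>n. ennreal (p n) * (\<integral>\<^sup>+\<omega>. g m n \<omega> \<partial>N)) = (\<integral>\<^sup>+\<omega>. ennreal (?F m \<omega>) \<partial>N)" for m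
  proof -
    let ?S = "\<lambda>n \<omega>. \<Sum>i\<in>?T n m. (1 - s) ^ card (i ` {..<n}) * (\<Prod>j<n. Q (i j) \<omega>)"
    have "(\<Sum>n. ennreal (p n) * (\<integral>\<^sup>+\<omega>. g m n \<omega> \<partial>N)) = (\<Sum>n. \<integral>\<^sup>+\<omega>. ennreal (p n) * ennreal (?S n \<omega>) \<partial>N)"
      unfolding g_int by (intro arg_cong[where f = suminf] ext nn_integral_cmult[symmetric]) simp
    also have "\<dots> = (\<integral>\<^sup>+\<omega>. (\<Sum>n. ennreal (p n) * ennreal (?S n \<omega>)) \<partial>N)"
      by (rule nn_integral_suminf[symmetric]) simp
    also have "\<dots> = (\<integral>\<^sup>+\<omega>. ennreal (?F m \<omega>) \<partial>N)"
    proof (rule nn_integral_cong_AE)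
      show "AE \<omega> in N. (\<Sum>n. ennreal (p n) * ennreal (?S n \<omega>)) = ennreal (?F m \<omega>)"
        using mass
      proof eventually_elim
        case (elim \<omega>)
        have S: "0 \<le> ?S n \<omega>" for n
          using elim s by (intro sum_nonneg mult_nonneg_nonneg prod_nonneg) (auto simp: sub_mass_def)
        have "(\<lambda>n. p n * ?S n \<omega>) sums ?F m \<omega>"
          unfolding p_def using poisson_sum_tuples[of "{..<m}" t s "\<lambda>a. Q a \<omega>"] by simp
        then have "(\<Sum>n. ennreal (p n * ?S n \<omega>)) = ennreal (?F m \<omega>)"
          by (subst suminf_ennreal2[OF mult_nonneg_nonneg[OF p S]]) (simp_all only: sums_iff)
        then show ?case by (simp only: ennreal_mult[OF p S])
      qed
    qed
    finally show ?thesis .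
  qed
  have "(\<lambda>m. \<integral>\<^sup>+\<omega>. ennreal (?F m \<omega>) \<partial>N) \<longlonglongrightarrow> (\<integral>\<^sup>+\<omega>. ennreal (mark_survival s t (\<lambda>k. Q k \<omega>)) \<partial>N)"
  proof (rule nn_integral_dominated_convergence[where w = "\<lambda>_. 1"])
    \<comment> \<open>When the total mass is 1, the first factor is the probability that no point
      falls outside the first \<open>m\<close> atoms. It tends to 1 by
      \<open>AE_sampled_mass\<close>; the other factor is a truncated survival probability.\<close>
    have F: "?F m \<omega> = exp (- t * (1 - (\<Sum>a<m. Q a \<omega>))) * exp (- (\<Sum>a<m. mark_rate s (t * Q a \<omega>)))"
      if "sub_mass (\<lambda>k. Q k \<omega>)" for m \<omega>
    proof -
      have "s + (1 - s) * exp (t * Q a \<omega>) = exp (t * Q a \<omega>) * exp (- mark_rate s (t * Q a \<omega>))" for a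
        using that t s by (subst exp_mark_rate) (auto simp: sub_mass_def algebra_simps exp_minus field_simps)
      then show ?thesis
        by (simp add: prod.distrib exp_sum[symmetric] exp_add[symmetric] sum_negf sum_subtractf sum_distrib_left algebra_simps)
    qed
    show "AE \<omega> in N. ennreal (?F m \<omega>) \<le> 1" for m
      using mass
    proof eventually_elim
      case (elim \<omega>)
      have "(\<Sum>a<m. Q a \<omega>) \<le> (\<Sum>a. Q a \<omega>)" using elim by (intro sum_le_suminf) (auto simp: sub_mass_def)
      also have "\<dots> \<le> 1" using elim by (simp add: sub_mass_def)
      finally have "exp (- t * (1 - (\<Sum>a<m. Q a \<omega>))) \<le> 1" using t by simp
      moreover have "0 \<le> (\<Sum>a<m. mark_rate s (t * Q a \<omega>))"
        using elim s t by (intro sum_nonneg mark_rate_nonneg) (auto simp: sub_mass_def)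
      ultimately have "?F m \<omega> \<le> 1 * 1" unfolding F[OF elim] by (intro mult_mono) auto
      then show ?case by simp
    qed
    show "AE \<omega> in N. (\<lambda>m. ennreal (?F m \<omega>)) \<longlonglongrightarrow> ennreal (mark_survival s t (\<lambda>k. Q k \<omega>))"
      using mass AE_sampled_mass
    proof eventually_elim
      case (elim \<omega>)
      have "summable (\<lambda>k. Q k \<omega>)" using elim by (simp add: sub_mass_def)
      from summable_LIMSEQ[OF this] have "(\<lambda>m. \<Sum>a<m. Q a \<omega>) \<longlonglongrightarrow> 1" using elim by simp
      then have "(\<lambda>m. ?F m \<omega>) \<longlonglongrightarrow> exp (- t * (1 - 1)) * exp (- (\<Sum>a. mark_rate s (t * Q a \<omega>)))"
        unfolding F[OF elim(1)] using summable_LIMSEQ[OF summable_mark_rate[OF s elim(1) t]]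
        by (intro tendsto_intros)
      then show ?case by (intro tendsto_ennrealI) (simp add: mark_survival_def)
    qed
  qed (auto simp: emeasure_space_1[simplified])
  moreover have "(\<lambda>m. \<Sum>n. ennreal (p n) * (\<integral>\<^sup>+\<omega>. g m n \<omega> \<partial>N)) \<longlonglongrightarrow>
    (\<Sum>n. ennreal (p n) * (\<integral>\<^sup>+\<omega>. ennreal ((1 - s) ^ num_distinct I n \<omega>) \<partial>N))"
  proof -
    have inc: "incseq (\<lambda>m. ennreal (p n) * (\<integral>\<^sup>+\<omega>. g m n \<omega> \<partial>N))" for n
      using g_inc by (auto simp: incseq_def intro!: mult_left_mono nn_integral_mono)
    have "(\<Sum>n. ennreal (p n) * (\<integral>\<^sup>+\<omega>. ennreal ((1 - s) ^ num_distinct I n \<omega>) \<partial>N)) =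
      (\<Sum>n. SUP m. ennreal (p n) * (\<integral>\<^sup>+\<omega>. g m n \<omega> \<partial>N))"
    proof (intro arg_cong[where f = suminf] ext)
      fix n
      have "(\<integral>\<^sup>+\<omega>. ennreal ((1 - s) ^ num_distinct I n \<omega>) \<partial>N) = (SUP m. \<integral>\<^sup>+\<omega>. g m n \<omega> \<partial>N)"
        unfolding g_SUP[symmetric] using g_inc
        by (intro nn_integral_monotone_convergence_SUP) (auto simp: incseq_def le_fun_def)
      then show "ennreal (p n) * (\<integral>\<^sup>+\<omega>. ennreal ((1 - s) ^ num_distinct I n \<omega>) \<partial>N) = (SUP m. ennreal (p n) * (\<integral>\<^sup>+\<omega>. g m n \<omega> \<partial>N))"
        by (simp add: SUP_mult_left_ennreal)
    qed
    also have "\<dots> = (SUP m. \<Sum>n. ennreal (p n) * (\<integral>\<^sup>+\<omega>. g m n \<omega> \<partial>N))"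
      by (rule ennreal_suminf_SUP_eq[OF inc])
    finally show ?thesis
      using inc by (auto intro!: LIMSEQ_SUP suminf_le simp: incseq_def)
  qed
  ultimately have "(\<Sum>n. ennreal (p n) * (\<integral>\<^sup>+\<omega>. ennreal ((1 - s) ^ num_distinct I n \<omega>) \<partial>N)) =
    (\<integral>\<^sup>+\<omega>. ennreal (mark_survival s t (\<lambda>k. Q k \<omega>)) \<partial>N)"
    unfolding sum_m by (rule LIMSEQ_unique[rotated])
  then show ?thesis by (simp add: p_def)
qed

end

section \<open>The law of the diversity\<close>

text \<open>The law of the number of points of a unit-rate Poisson process at an independent Gamma
  time of shape \<open>\<theta>\<close> and rate \<open>c\<close>.\<close>

definition neg_binomial :: "real \<Rightarrow> real \<Rightarrow> nat \<Rightarrow> real" where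
  "neg_binomial \<theta> c n = Gamma (\<theta> + real n) / (Gamma \<theta> * fact n) * c powr \<theta> * (1 + c) powr (- (\<theta> + real n))"

lemma neg_binomial_nonneg: "0 < \<theta> \<Longrightarrow> 0 \<le> neg_binomial \<theta> c n"
  unfolding neg_binomial_def
  by (intro mult_nonneg_nonneg divide_nonneg_nonneg less_imp_le[OF Gamma_real_pos]) (auto intro: add_pos_nonneg)

lemma AE_sampled_sub_mass:
  assumes \<alpha>: "0 < \<alpha>" "\<alpha> < 1" and \<theta>: "0 < \<theta>" and Q: "has_seq_law N Q (PD \<alpha> \<theta>)"
  shows "AE \<omega> in N. sub_mass (\<lambda>k. Q k \<omega>)"
proof -
  have Qm: "(\<lambda>\<omega> k. Q k \<omega>) \<in> N \<rightarrow>\<^sub>M seq_space"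
    using Q by (intro measurable_seq_spaceI) (simp add: has_seq_law_def)
  have PD: "distr N seq_space (\<lambda>\<omega> k. Q k \<omega>) = PD \<alpha> \<theta>" using Q by (simp add: has_seq_law_def)
  have "AE p in distr N seq_space (\<lambda>\<omega> k. Q k \<omega>). sub_mass p"
    unfolding PD using \<alpha> \<theta> by (intro AE_PD_sub_mass) auto
  then show ?thesis using measurable_sub_mass by (subst (asm) AE_distr_iff[OF Qm]) auto
qed

text \<open>Integrates \<open>poisson_sampled\<close> against the Gamma density, including the
  factor \<open>c powr \<theta>\<close> missing in \<open>GEM_transform\<close>: the mixed Poisson
  counts become negative binomial, and the survival side has the closed form. For
  \<open>s = 0\<close> it says that the counts have total mass 1.\<close>

lemma neg_binomial_sampled:
  assumes N: "prob_space N" and \<alpha>: "0 < \<alpha>" "\<alpha> < 1" and \<theta>: "0 < \<theta>" and c: "0 < c" and s: "0 \<le> s" "s < 1"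
    and Q: "has_seq_law N Q (PD \<alpha> \<theta>)" and samp: "iid_sampled N Q I"
  shows "(\<Sum>n. ennreal (neg_binomial \<theta> c n) * (\<integral>\<^sup>+\<omega>. ennreal ((1 - s) ^ num_distinct I n \<omega>) \<partial>N)) =
    ennreal (c powr \<theta> * tilt s \<alpha> c powr (- (\<theta> / \<alpha>)))"
proof -
  interpret prob_space N by fact
  have [measurable]: "Q k \<in> borel_measurable N" for k using Q by (simp add: has_seq_law_def)
  have Qm: "(\<lambda>\<omega> k. Q k \<omega>) \<in> N \<rightarrow>\<^sub>M seq_space" by (rule measurable_seq_spaceI) simp
  have PD: "distr N seq_space (\<lambda>\<omega> k. Q k \<omega>) = PD \<alpha> \<theta>" using Q by (simp add: has_seq_law_def)
  note mass = AE_sampled_sub_mass[OF \<alpha> \<theta> Q]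
  let ?E = "\<lambda>n. \<integral>\<^sup>+\<omega>. ennreal ((1 - s) ^ num_distinct I n \<omega>) \<partial>N"
  have surv: "GEM_survival s \<alpha> \<theta> t = (\<Sum>n. ennreal (exp (- t) * t ^ n / fact n) * ?E n)" if t: "0 \<le> t" for t
  proof -
    have "GEM_survival s \<alpha> \<theta> t = (\<integral>\<^sup>+p. ennreal (mark_survival s t p) \<partial>PD \<alpha> \<theta>)"
      using \<alpha> \<theta> s t by (intro nn_integral_PD_mark_survival[symmetric]) auto
    also have "\<dots> = (\<integral>\<^sup>+\<omega>. ennreal (mark_survival s t (\<lambda>k. Q k \<omega>)) \<partial>N)"
      unfolding PD[symmetric] by (subst nn_integral_distr[OF Qm]) simp_all
    also have "\<dots> = (\<Sum>n. ennreal (exp (- t) * t ^ n / fact n) * ?E n)"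
      by (rule poisson_sampled[OF N samp mass s t, symmetric])
    finally show ?thesis .
  qed
  have G: "0 < Gamma \<theta>" "Gamma \<theta> \<noteq> 0" using Gamma_real_pos[OF \<theta>] by auto
  have "ennreal (c powr \<theta>) * GEM_transform s \<alpha> \<theta> c =
    ennreal (c powr \<theta>) * (\<integral>\<^sup>+t. (\<Sum>n. ?E n * (ennreal (1 / (Gamma \<theta> * fact n)) * (ennreal (t powr (\<theta> + real n - 1) * exp (- (1 + c) * t)) * indicator {0<..} t))) \<partial>lborel)"
    unfolding GEM_transform_def[OF s]
  proof (intro arg_cong2[where f = "(*)"] refl nn_integral_cong)
    fix t :: real
    show "ennreal (t powr (\<theta> - 1) * exp (- c * t) / Gamma \<theta>) * GEM_survival s \<alpha> \<theta> t * indicator {0<..} t =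
      (\<Sum>n. ?E n * (ennreal (1 / (Gamma \<theta> * fact n)) * (ennreal (t powr (\<theta> + real n - 1) * exp (- (1 + c) * t)) * indicator {0<..} t)))"
    proof (cases "0 < t")
      case True
      have e: "ennreal (t powr (\<theta> - 1) * exp (- c * t) / Gamma \<theta>) * (ennreal (exp (- t) * t ^ n / fact n) * ?E n) =
        ?E n * (ennreal (1 / (Gamma \<theta> * fact n)) * ennreal (t powr (\<theta> + real n - 1) * exp (- (1 + c) * t)))" for n
      proof -
        have p1: "t powr (\<theta> + real n - 1) = t powr (\<theta> - 1) * t ^ n"
          using True by (simp add: powr_add[symmetric] powr_realpow[symmetric] algebra_simps)
        have p2: "exp (- (1 + c) * t) = exp (- c * t) * exp (- t)"
          by (simp add: exp_add[symmetric] algebra_simps)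
        have "t powr (\<theta> - 1) * exp (- c * t) / Gamma \<theta> * (exp (- t) * t ^ n / fact n) =
          1 / (Gamma \<theta> * fact n) * (t powr (\<theta> + real n - 1) * exp (- (1 + c) * t))"
          unfolding p1 p2 using G by (simp add: field_simps)
        then have "ennreal (t powr (\<theta> - 1) * exp (- c * t) / Gamma \<theta>) * ennreal (exp (- t) * t ^ n / fact n) =
          ennreal (1 / (Gamma \<theta> * fact n)) * ennreal (t powr (\<theta> + real n - 1) * exp (- (1 + c) * t))"
          using G True by (subst (1 2) ennreal_mult'[symmetric]) (auto simp del: times_divide_eq_left times_divide_eq_right)
        then show ?thesis by (simp only: mult.assoc[symmetric]) (simp only: mult.commute mult.left_commute)
      qed
      have "ennreal (t powr (\<theta> - 1) * exp (- c * t) / Gamma \<theta>) * GEM_survival s \<alpha> \<theta> t =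
        (\<Sum>n. ennreal (t powr (\<theta> - 1) * exp (- c * t) / Gamma \<theta>) * (ennreal (exp (- t) * t ^ n / fact n) * ?E n))"
        using True by (simp add: surv)
      then show ?thesis using True unfolding e by simp
    qed simp
  qed
  also have "\<dots> = ennreal (c powr \<theta>) * (\<Sum>n. ?E n * (ennreal (1 / (Gamma \<theta> * fact n)) * ennreal (Gamma (\<theta> + real n) * (1 + c) powr (- (\<theta> + real n)))))"
  proof (intro arg_cong2[where f = "(*)"] refl)
    have "(\<integral>\<^sup>+t. (\<Sum>n. ?E n * (ennreal (1 / (Gamma \<theta> * fact n)) * (ennreal (t powr (\<theta> + real n - 1) * exp (- (1 + c) * t)) * indicator {0<..} t))) \<partial>lborel) =
      (\<Sum>n. \<integral>\<^sup>+t. ?E n * (ennreal (1 / (Gamma \<theta> * fact n)) * (ennreal (t powr (\<theta> + real n - 1) * exp (- (1 + c) * t)) * indicator {0<..} t)) \<partial>lborel)"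
      by (rule nn_integral_suminf) measurable
    also have "\<dots> = (\<Sum>n. ?E n * (ennreal (1 / (Gamma \<theta> * fact n)) * ennreal (Gamma (\<theta> + real n) * (1 + c) powr (- (\<theta> + real n)))))"
    proof (intro arg_cong[where f = suminf] ext)
      fix n
      have I: "(\<integral>\<^sup>+t. ennreal (t powr (\<theta> + real n - 1) * exp (- (1 + c) * t)) * indicator {0<..} t \<partial>lborel) = ennreal (Gamma (\<theta> + real n) * (1 + c) powr (- (\<theta> + real n)))"
        using \<theta> c by (intro nn_integral_Gamma_scaled add_pos_nonneg) auto
      have "(\<integral>\<^sup>+t. ?E n * (ennreal (1 / (Gamma \<theta> * fact n)) * (ennreal (t powr (\<theta> + real n - 1) * exp (- (1 + c) * t)) * indicator {0<..} t)) \<partial>lborel) =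
        ?E n * (\<integral>\<^sup>+t. ennreal (1 / (Gamma \<theta> * fact n)) * (ennreal (t powr (\<theta> + real n - 1) * exp (- (1 + c) * t)) * indicator {0<..} t) \<partial>lborel)"
        by (rule nn_integral_cmult) measurable
      also have "(\<integral>\<^sup>+t. ennreal (1 / (Gamma \<theta> * fact n)) * (ennreal (t powr (\<theta> + real n - 1) * exp (- (1 + c) * t)) * indicator {0<..} t) \<partial>lborel) =
        ennreal (1 / (Gamma \<theta> * fact n)) * (\<integral>\<^sup>+t. ennreal (t powr (\<theta> + real n - 1) * exp (- (1 + c) * t)) * indicator {0<..} t \<partial>lborel)"
        by (rule nn_integral_cmult) measurable
      finally show "(\<integral>\<^sup>+t. ?E n * (ennreal (1 / (Gamma \<theta> * fact n)) * (ennreal (t powr (\<theta> + real n - 1) * exp (- (1 + c) * t)) * indicator {0<..} t)) \<partial>lborel) =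
        ?E n * (ennreal (1 / (Gamma \<theta> * fact n)) * ennreal (Gamma (\<theta> + real n) * (1 + c) powr (- (\<theta> + real n))))"
        unfolding I .
    qed
    finally show "(\<integral>\<^sup>+t. (\<Sum>n. ?E n * (ennreal (1 / (Gamma \<theta> * fact n)) * (ennreal (t powr (\<theta> + real n - 1) * exp (- (1 + c) * t)) * indicator {0<..} t))) \<partial>lborel) =
      (\<Sum>n. ?E n * (ennreal (1 / (Gamma \<theta> * fact n)) * ennreal (Gamma (\<theta> + real n) * (1 + c) powr (- (\<theta> + real n)))))" .
  qed
  also have "\<dots> = (\<Sum>n. ennreal (neg_binomial \<theta> c n) * ?E n)"
  proof (subst ennreal_suminf_cmult[symmetric], intro arg_cong[where f = suminf] ext)
    fix n
    have "neg_binomial \<theta> c n = c powr \<theta> * (1 / (Gamma \<theta> * fact n) * (Gamma (\<theta> + real n) * (1 + c) powr (- (\<theta> + real n))))"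
      by (simp add: neg_binomial_def)
    then have "ennreal (neg_binomial \<theta> c n) = ennreal (c powr \<theta>) * (ennreal (1 / (Gamma \<theta> * fact n)) * ennreal (Gamma (\<theta> + real n) * (1 + c) powr (- (\<theta> + real n))))"
      using G by (simp only: ennreal_mult'[OF powr_ge_zero] ennreal_mult'[of "1 / (Gamma \<theta> * fact n)"] divide_nonneg_pos mult_pos_pos fact_gt_zero zero_le_one)
    then show "ennreal (c powr \<theta>) * (?E n * (ennreal (1 / (Gamma \<theta> * fact n)) * ennreal (Gamma (\<theta> + real n) * (1 + c) powr (- (\<theta> + real n))))) =
      ennreal (neg_binomial \<theta> c n) * ?E n"
      by (simp only: mult_ac)
  qed
  finally show ?thesis
    using s \<alpha> \<theta> c by (simp add: GEM_transform_eq ennreal_mult')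
qed

text \<open>Writes a series over counts as the integral of a step function in the rescaled variable,
  so that the scaling limit can be studied pointwise in \<open>y\<close>.\<close>

lemma nn_integral_floor:
  fixes f :: "nat \<Rightarrow> ennreal"
  assumes k: "0 < (k::real)"
  shows "(\<integral>\<^sup>+y. f (nat \<lfloor>k * y\<rfloor>) * indicator {0<..} y \<partial>lborel) = ennreal (1 / k) * (\<Sum>n. f n)"
proof -
  have [measurable]: "(\<lambda>y::real. f (nat \<lfloor>y\<rfloor>)) \<in> borel_measurable borel"
    by (rule measurable_compose[of _ _ "count_space UNIV"]) measurable
  have "(\<integral>\<^sup>+y. f (nat \<lfloor>y\<rfloor>) * indicator {0::real<..} y \<partial>lborel) = (\<integral>\<^sup>+y. (\<Sum>n. f n * indicator {real n..<real n + 1} y) \<partial>lborel)"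
  proof (rule nn_integral_cong_AE)
    show "AE y::real in lborel. f (nat \<lfloor>y\<rfloor>) * indicator {0<..} y = (\<Sum>n. f n * indicator {real n..<real n + 1} y)"
      using AE_lborel_singleton[of 0]
    proof eventually_elim
      case (elim y)
      show ?case
      proof (cases "0 < y")
        case True
        have iff: "y \<in> {real n..<real n + 1} \<longleftrightarrow> n = nat \<lfloor>y\<rfloor>" for n using True by (auto simp: floor_eq_iff) linarith+
        have "(\<Sum>n. f n * indicator {real n..<real n + 1} y) = (\<Sum>n\<in>{nat \<lfloor>y\<rfloor>}. f n * indicator {real n..<real n + 1} y)"
          using iff by (intro suminf_finite) auto
        also have "\<dots> = f (nat \<lfloor>y\<rfloor>)" using iff[of "nat \<lfloor>y\<rfloor>"] by simp
        finally show ?thesis using True by simp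
      next
        case False
        then have z: "f n * indicator {real n..<real n + 1} y = 0" for n using elim by (auto simp: indicator_def)
        show ?thesis unfolding z using False by simp
      qed
    qed
  qed
  also have "\<dots> = (\<Sum>n. f n)" by (simp add: nn_integral_suminf nn_integral_cmult_indicator)
  finally have 1: "(\<integral>\<^sup>+y. f (nat \<lfloor>y\<rfloor>) * indicator {0::real<..} y \<partial>lborel) = (\<Sum>n. f n)" .
  have "(\<integral>\<^sup>+y. f (nat \<lfloor>y\<rfloor>) * indicator {0::real<..} y \<partial>lborel) = ennreal k * (\<integral>\<^sup>+y. f (nat \<lfloor>k * y\<rfloor>) * indicator {0<..} y \<partial>lborel)"
    by (rule nn_integral_scale_subst[OF _ k]) measurable
  then have "ennreal (1 / k) * (\<Sum>n. f n) = (ennreal (1 / k) * ennreal k) * (\<integral>\<^sup>+y. f (nat \<lfloor>k * y\<rfloor>) * indicator {0<..} y \<partial>lborel)"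
    unfolding 1 by (simp add: mult.assoc)
  then show ?thesis using k by (simp add: ennreal_mult'[symmetric])
qed

lemma floor_scaled_tendsto:
  assumes "0 < y"
  shows "(\<lambda>k. real (nat \<lfloor>real k * y\<rfloor>) / real k) \<longlonglongrightarrow> y"
    and "filterlim (\<lambda>k. nat \<lfloor>real k * y\<rfloor>) at_top sequentially"
proof -
  have eq: "real (nat \<lfloor>real k * y\<rfloor>) = of_int \<lfloor>real k * y\<rfloor>" for k using assms by simp
  show lim: "(\<lambda>k. real (nat \<lfloor>real k * y\<rfloor>) / real k) \<longlonglongrightarrow> y"
  proof (rule tendsto_sandwich[of "\<lambda>k. y - 1 / real k" _ _ "\<lambda>_. y"])
    show "\<forall>\<^sub>F k in sequentially. y - 1 / real k \<le> real (nat \<lfloor>real k * y\<rfloor>) / real k"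
      using eventually_gt_at_top[of 0]
    proof eventually_elim
      case (elim k)
      have "real k * y - 1 \<le> real (nat \<lfloor>real k * y\<rfloor>)" unfolding eq by linarith
      then have "(real k * y - 1) / real k \<le> real (nat \<lfloor>real k * y\<rfloor>) / real k" by (rule divide_right_mono) simp
      then show ?case using elim by (simp add: diff_divide_distrib)
    qed
    show "\<forall>\<^sub>F k in sequentially. real (nat \<lfloor>real k * y\<rfloor>) / real k \<le> y"
      using eventually_gt_at_top[of 0]
    proof eventually_elim
      case (elim k)
      have "real (nat \<lfloor>real k * y\<rfloor>) \<le> real k * y" unfolding eq by linarith
      then show ?case using elim by (simp add: divide_le_eq mult.commute)
    qed
    show "(\<lambda>k. y - 1 / real k) \<longlonglongrightarrow> y" by real_asymp
  qed simp
  have "filterlim (\<lambda>k. real (nat \<lfloor>real k * y\<rfloor>) / real k * real k) at_top sequentially"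
    by (rule filterlim_tendsto_pos_mult_at_top[OF lim assms filterlim_real_sequentially])
  then have "filterlim (\<lambda>k. real (nat \<lfloor>real k * y\<rfloor>)) at_top sequentially"
    by (rule filterlim_mono_eventually[OF _ order_refl order_refl]) (use eventually_gt_at_top[of 0] in \<open>auto elim!: eventually_mono\<close>)
  then show "filterlim (\<lambda>k. nat \<lfloor>real k * y\<rfloor>) at_top sequentially"
    unfolding filterlim_at_top by (metis (mono_tags, lifting) eventually_mono of_nat_le_iff)
qed

text \<open>A local limit theorem. A Gamma time of rate \<open>1 / k\<close> is \<open>k\<close>
  times one of rate 1, and the Poisson fluctuations are of smaller order, so the rescaled counts
  approach the Gamma density.\<close>

lemma neg_binomial_tendsto:
  assumes \<theta>: "0 < \<theta>" and y: "0 < y"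
  shows "(\<lambda>k. real k * neg_binomial \<theta> (1 / real k) (nat \<lfloor>real k * y\<rfloor>)) \<longlonglongrightarrow> y powr (\<theta> - 1) * exp (- 1 * y) / Gamma \<theta>"
proof -
  define n where "n k = nat \<lfloor>real k * y\<rfloor>" for k
  note nlim = floor_scaled_tendsto[OF y, folded n_def]
  have Gpos: "Gamma \<theta> \<noteq> 0" using Gamma_real_pos[OF \<theta>] by simp
  \<comment> \<open>The weight, regrouped into factors with separate limits: ratios
    \<open>n k / k\<close> tending to \<open>y\<close>, the product formula for Gamma, and the power
    of \<open>1 + 1 / k\<close> that tends to \<open>exp (- y)\<close>.\<close>
  have kn: "(\<lambda>k. (real (n k) / real k) powr \<theta> * (1 / (\<theta> / real k + real (n k) / real k)) * (1 / Gamma_series \<theta> (n k)) *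
    ((1 + 1 / real k) powr (- \<theta>) * exp (- (real (n k) / real k * (real k * ln (1 + 1 / real k)))))) \<longlonglongrightarrow>
    y powr \<theta> * (1 / (0 + y)) * (1 / Gamma \<theta>) * (1 * exp (- (y * 1)))"
  proof -
    have T1: "(\<lambda>k. Gamma_series \<theta> (n k)) \<longlonglongrightarrow> Gamma \<theta>"
      by (rule filterlim_compose[OF Gamma_series_LIMSEQ nlim(2)])
    have T2: "(\<lambda>k. \<theta> / real k) \<longlonglongrightarrow> 0" by real_asymp
    have T3: "(\<lambda>k. (1 + 1 / real k) powr (- \<theta>)) \<longlonglongrightarrow> 1" by real_asymp
    have T4: "(\<lambda>k. real k * ln (1 + 1 / real k)) \<longlonglongrightarrow> 1" by real_asymp
    have A: "(\<lambda>k. (real (n k) / real k) powr \<theta>) \<longlonglongrightarrow> y powr \<theta>"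
      using y by (intro tendsto_powr nlim(1) tendsto_const) auto
    have B: "(\<lambda>k. 1 / (\<theta> / real k + real (n k) / real k)) \<longlonglongrightarrow> 1 / (0 + y)"
      using y by (intro tendsto_divide tendsto_const tendsto_add[OF T2 nlim(1)]) auto
    have C: "(\<lambda>k. 1 / Gamma_series \<theta> (n k)) \<longlonglongrightarrow> 1 / Gamma \<theta>"
      by (intro tendsto_divide tendsto_const T1 Gpos)
    show ?thesis
      by (rule tendsto_mult[OF tendsto_mult[OF tendsto_mult[OF A B] C]
        tendsto_mult[OF T3 tendsto_exp[OF tendsto_minus[OF tendsto_mult[OF nlim(1) T4]]]]])
  qed
  have "\<forall>\<^sub>F k in sequentially. (real (n k) / real k) powr \<theta> * (1 / (\<theta> / real k + real (n k) / real k)) * (1 / Gamma_series \<theta> (n k)) *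
    ((1 + 1 / real k) powr (- \<theta>) * exp (- (real (n k) / real k * (real k * ln (1 + 1 / real k))))) =
    real k * neg_binomial \<theta> (1 / real k) (n k)"
    using eventually_gt_at_top[of 0] nlim(2)[THEN filterlim_at_top[THEN iffD1], rule_format, of 1]
  proof eventually_elim
    case (elim k)
    let ?n = "n k"
    have "\<theta> \<notin> \<int>\<^sub>\<le>\<^sub>0" using \<theta> nonpos_Ints_nonpos[of \<theta>] by force
    then have G: "Gamma (\<theta> + real ?n) / (Gamma \<theta> * fact ?n) = pochhammer \<theta> ?n / fact ?n"
      by (simp add: pochhammer_Gamma)
    have GS: "1 / Gamma_series \<theta> ?n = pochhammer \<theta> ?n * (\<theta> + real ?n) / (fact ?n * real ?n powr \<theta>)"
      using elim by (simp add: Gamma_series_def pochhammer_Suc powr_def)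
    have e: "exp (- (real ?n / real k * (real k * ln (1 + 1 / real k)))) = (1 + 1 / real k) powr (- real ?n)"
    proof -
      have "0 < 1 + 1 / real k" using elim by (intro add_pos_nonneg) auto
      then have "1 + 1 / real k \<noteq> 0" by linarith
      then show ?thesis using elim by (simp add: powr_def)
    qed
    have d: "\<theta> / real k + real ?n / real k = (\<theta> + real ?n) / real k" by (simp add: add_divide_distrib)
    have p: "(real ?n / real k) powr \<theta> = real ?n powr \<theta> * (1 / real k) powr \<theta>"
      using elim by (simp add: powr_mult[symmetric])
    have q: "(1 + 1 / real k) powr (- (\<theta> + real ?n)) = (1 + 1 / real k) powr (- \<theta>) * (1 + 1 / real k) powr (- real ?n)"
      by (simp add: powr_add[symmetric])
    have nz: "real ?n powr \<theta> \<noteq> 0" "\<theta> + real ?n \<noteq> 0" using elim \<theta> by auto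
    show ?case
    proof -
      have alg: "(x * r) * (1 / (w / j)) * (P * w / (F * x)) * AB = j * (P / F * r * AB)"
        if "x \<noteq> 0" "w \<noteq> 0" for x r w j P F AB :: real
        using that by simp
      show ?thesis unfolding neg_binomial_def G GS e d p q using nz by (intro alg)
    qed
  qed
  from Lim_transform_eventually[OF kn this]
  have "(\<lambda>k. real k * neg_binomial \<theta> (1 / real k) (n k)) \<longlonglongrightarrow> y powr \<theta> * (1 / (0 + y)) * (1 / Gamma \<theta>) * (1 * exp (- (y * 1)))" .
  also have "y powr \<theta> * (1 / (0 + y)) * (1 / Gamma \<theta>) * (1 * exp (- (y * 1))) = y powr (\<theta> - 1) * exp (- 1 * y) / Gamma \<theta>"
    using y by (simp add: powr_diff)
  finally show ?thesis by (simp add: n_def)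
qed

text \<open>The limit of \<open>neg_binomial_sampled\<close> at rate \<open>1 / k\<close> and
  marking probability \<open>l * k powr (- \<alpha>)\<close>. The integrands converge pointwise;
  Fatou's lemma gives one inequality for the probability of seeing no mark and one for its
  complement, and since both integrals and both bounds add up to 1, equality holds.\<close>

lemma diversity_Gamma_mix:
  assumes N: "prob_space N" and \<alpha>: "0 < \<alpha>" "\<alpha> < 1" and \<theta>: "0 < \<theta>" and l: "0 \<le> l"
    and Q: "has_seq_law N Q (PD \<alpha> \<theta>)" and samp: "iid_sampled N Q I"
    and D [measurable]: "D \<in> borel_measurable N"
    and lim: "AE \<omega> in N. (\<lambda>n. real n powr (- \<alpha>) * real (num_distinct I n \<omega>)) \<longlonglongrightarrow> D \<omega>"
  shows "(\<integral>\<^sup>+y. ennreal (y powr (\<theta> - 1) * exp (- 1 * y) / Gamma \<theta>) * indicator {0<..} y *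
      (\<integral>\<^sup>+\<omega>. ennreal (exp (- l * (y powr \<alpha> * D \<omega>))) \<partial>N) \<partial>lborel) = ennreal ((1 + l) powr (- (\<theta> / \<alpha>)))"
proof -
  interpret prob_space N by fact
  note [measurable] = measurable_num_distinct[OF N samp AE_sampled_sub_mass[OF \<alpha> \<theta> Q]]
  have D0: "AE \<omega> in N. 0 \<le> D \<omega>"
    using lim
  proof eventually_elim
    case (elim \<omega>)
    then show ?case by (rule tendsto_lowerbound) auto
  qed
  \<comment> \<open>The cap \<open>1 / 2\<close> keeps the marking probability below 1 for every
    \<open>k\<close>; for large \<open>k\<close> it is inactive.\<close>
  define \<sigma> where "\<sigma> k = min (1 / 2) (l * real k powr (- \<alpha>))" for k :: nat
  define n where "n k y = nat \<lfloor>real k * y\<rfloor>" for k :: nat and y :: real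
  define a where "a k y = expectation (\<lambda>\<omega>. (1 - \<sigma> k) ^ num_distinct I (n k y) \<omega>)" for k y
  define b where "b y = expectation (\<lambda>\<omega>. exp (- l * (y powr \<alpha> * D \<omega>)))" for y
  define u where "u k y = real k * neg_binomial \<theta> (1 / real k) (n k y)" for k y
  define g where "g y = y powr (\<theta> - 1) * exp (- 1 * y) / Gamma \<theta>" for y
  have \<sigma>: "0 \<le> \<sigma> k" "\<sigma> k < 1" for k using l by (auto simp: \<sigma>_def)
  have \<sigma>_ev: "\<forall>\<^sub>F k in sequentially. \<sigma> k = l * real k powr (- \<alpha>)"
  proof -
    have "(\<lambda>k. l * real k powr (- \<alpha>)) \<longlonglongrightarrow> 0" using \<alpha> by real_asymp
    from order_tendstoD(2)[OF this, of "1 / 2"] show ?thesis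
      by (auto elim!: eventually_mono simp: \<sigma>_def)
  qed
  have pw: "0 \<le> (1 - \<sigma> k) ^ m \<and> (1 - \<sigma> k) ^ m \<le> 1" for k m
    using \<sigma>[of k] by (auto intro!: power_le_one)
  have a_int: "integrable N (\<lambda>\<omega>. (1 - \<sigma> k) ^ num_distinct I m \<omega>)" for k m
    by (rule integrable_const_bound[of _ 1]) (use pw in auto)
  have nn_a: "(\<integral>\<^sup>+\<omega>. ennreal ((1 - \<sigma> k) ^ num_distinct I m \<omega>) \<partial>N) = ennreal (expectation (\<lambda>\<omega>. (1 - \<sigma> k) ^ num_distinct I m \<omega>))"
    for k m by (rule nn_integral_eq_integral[OF a_int]) (use pw in auto)
  have a01: "0 \<le> a k y" "a k y \<le> 1" for k y
  proof -
    show "0 \<le> a k y" unfolding a_def by (rule integral_nonneg_AE) (use pw in auto)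
    show "a k y \<le> 1" unfolding a_def by (rule integral_le_const[OF a_int]) (use pw in auto)
  qed
  have b_int: "integrable N (\<lambda>\<omega>. exp (- l * (y powr \<alpha> * D \<omega>)))" for y
    by (rule integrable_const_bound[of _ 1], rule eventually_mono[OF D0]) (use l in auto)
  have nn_b: "(\<integral>\<^sup>+\<omega>. ennreal (exp (- l * (y powr \<alpha> * D \<omega>))) \<partial>N) = ennreal (b y)" for y
    unfolding b_def using b_int by (intro nn_integral_eq_integral) auto
  have b01: "0 \<le> b y" "b y \<le> 1" for y
  proof -
    show "0 \<le> b y" unfolding b_def by (intro integral_nonneg_AE) auto
    show "b y \<le> 1" unfolding b_def by (rule integral_le_const[OF b_int], rule eventually_mono[OF D0]) (use l in auto)
  qed
  have u0: "0 \<le> u k y" for k y unfolding u_def using \<theta> by (intro mult_nonneg_nonneg neg_binomial_nonneg) auto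
  have g0: "0 \<le> g y" for y unfolding g_def using Gamma_real_pos[OF \<theta>] by (intro divide_nonneg_nonneg mult_nonneg_nonneg) auto
  have u_lim: "(\<lambda>k. u k y) \<longlonglongrightarrow> g y" if "0 < y" for y
    unfolding u_def n_def g_def by (rule neg_binomial_tendsto[OF \<theta> that])
  have a_lim: "(\<lambda>k. a k y) \<longlonglongrightarrow> b y" if y: "0 < y" for y
    unfolding a_def b_def
  proof (rule integral_dominated_convergence[where w = "\<lambda>_. 1"])
    show "AE \<omega> in N. norm ((1 - \<sigma> k) ^ num_distinct I (n k y) \<omega>) \<le> 1" for k using pw by auto
    show "AE \<omega> in N. (\<lambda>k. (1 - \<sigma> k) ^ num_distinct I (n k y) \<omega>) \<longlonglongrightarrow> exp (- l * (y powr \<alpha> * D \<omega>))"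
      using lim
    proof eventually_elim
      case (elim \<omega>)
      note nl = floor_scaled_tendsto[OF y, folded n_def]
      let ?K = "\<lambda>k. real (num_distinct I (n k y) \<omega>)"
      have K: "(\<lambda>k. real (n k y) powr (- \<alpha>) * ?K k) \<longlonglongrightarrow> D \<omega>"
        by (rule filterlim_compose[OF elim nl(2)])
      \<comment> \<open>The origin of the exponent: each distinct value contributes about
        \<open>- l * k powr (- \<alpha>)\<close> to the logarithm, and there are about
        \<open>D \<omega> * (k * y) powr \<alpha>\<close> of them.\<close>
      have L: "(\<lambda>k. real k powr \<alpha> * ln (1 - \<sigma> k)) \<longlonglongrightarrow> - l"
      proof (rule Lim_transform_eventually)
        show "(\<lambda>k. real k powr \<alpha> * ln (1 - l * real k powr (- \<alpha>))) \<longlonglongrightarrow> - l" using \<alpha> by real_asymp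
        show "\<forall>\<^sub>F k in sequentially. real k powr \<alpha> * ln (1 - l * real k powr (- \<alpha>)) = real k powr \<alpha> * ln (1 - \<sigma> k)"
          using \<sigma>_ev by eventually_elim simp
      qed
      have "(\<lambda>k. exp ((real (n k y) powr (- \<alpha>) * ?K k) * ((real (n k y) / real k) powr \<alpha> * (real k powr \<alpha> * ln (1 - \<sigma> k))))) \<longlonglongrightarrow>
        exp (D \<omega> * (y powr \<alpha> * - l))"
        using y by (intro tendsto_exp tendsto_mult[OF K] tendsto_mult[OF _ L] tendsto_powr nl(1) tendsto_const) auto
      moreover have "\<forall>\<^sub>F k in sequentially. exp ((real (n k y) powr (- \<alpha>) * ?K k) * ((real (n k y) / real k) powr \<alpha> * (real k powr \<alpha> * ln (1 - \<sigma> k)))) =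
        (1 - \<sigma> k) ^ num_distinct I (n k y) \<omega>"
        using eventually_gt_at_top[of 0] nl(2)[THEN filterlim_at_top[THEN iffD1], rule_format, of 1]
      proof eventually_elim
        case (elim k)
        have "(real (n k y) / real k) powr \<alpha> * real k powr \<alpha> = real (n k y) powr \<alpha>"
          using elim by (simp add: powr_mult[symmetric])
        moreover have "real (n k y) powr (- \<alpha>) * real (n k y) powr \<alpha> = 1"
          using elim by (simp add: powr_add[symmetric])
        moreover have "(p * K) * (r * (q * L)) = (p * (r * q)) * (K * L)" for p K r q L :: real
          by (simp only: mult_ac)
        ultimately have e: "(real (n k y) powr (- \<alpha>) * ?K k) * ((real (n k y) / real k) powr \<alpha> * (real k powr \<alpha> * ln (1 - \<sigma> k))) =
          ?K k * ln (1 - \<sigma> k)"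
          by (simp only: mult_1)
        show ?case
          unfolding e using \<sigma>(2)[of k] by (simp add: exp_of_nat_mult)
      qed
      ultimately have "(\<lambda>k. (1 - \<sigma> k) ^ num_distinct I (n k y) \<omega>) \<longlonglongrightarrow> exp (D \<omega> * (y powr \<alpha> * - l))"
        by (rule Lim_transform_eventually)
      then show ?case by (simp add: mult_ac)
    qed
  qed auto
  have meas_n: "(\<lambda>y. h (n k y)) \<in> borel_measurable borel" for k and h :: "nat \<Rightarrow> real"
    unfolding n_def by (rule measurable_compose[of _ _ "count_space UNIV"]) measurable
  have [measurable]: "u k \<in> borel_measurable borel" "a k \<in> borel_measurable borel" for k
    unfolding u_def[abs_def] a_def[abs_def]
    using meas_n[of "\<lambda>m. real k * neg_binomial \<theta> (1 / real k) m" k]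
      meas_n[of "\<lambda>m. expectation (\<lambda>\<omega>. (1 - \<sigma> k) ^ num_distinct I m \<omega>)" k] by auto
  have [measurable]: "g \<in> borel_measurable borel" unfolding g_def[abs_def] by measurable
  have [measurable]: "b \<in> borel_measurable borel"
    unfolding b_def[abs_def] by measurable
  \<comment> \<open>\<open>X k\<close> and \<open>Y k\<close> split the total mass 1 of the counts
    into the probabilities of seeing no mark and of seeing one.\<close>
  define X where "X k = (\<integral>\<^sup>+y. ennreal (u k y) * ennreal (a k y) * indicator {0<..} y \<partial>lborel)" for k
  define Y where "Y k = (\<integral>\<^sup>+y. ennreal (u k y) * ennreal (1 - a k y) * indicator {0<..} y \<partial>lborel)" for k
  let ?c = "\<lambda>k. 1 / real k"
  let ?L = "\<lambda>k. ?c k powr \<theta> * tilt (\<sigma> k) \<alpha> (?c k) powr (- (\<theta> / \<alpha>))"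
  have sum_floor: "(\<integral>\<^sup>+y. ennreal (u k y) * h (n k y) * indicator {0<..} y \<partial>lborel) = (\<Sum>m. ennreal (neg_binomial \<theta> (?c k) m) * h m)"
    if k: "0 < k" for k :: nat and h
  proof -
    have "(\<integral>\<^sup>+y. ennreal (u k y) * h (n k y) * indicator {0<..} y \<partial>lborel) =
      ennreal (1 / real k) * (\<Sum>m. ennreal (real k * neg_binomial \<theta> (?c k) m) * h m)"
      unfolding u_def n_def using nn_integral_floor[of "real k" "\<lambda>m. ennreal (real k * neg_binomial \<theta> (?c k) m) * h m"] k by simp
    also have "(\<Sum>m. ennreal (real k * neg_binomial \<theta> (?c k) m) * h m) = ennreal (real k) * (\<Sum>m. ennreal (neg_binomial \<theta> (?c k) m) * h m)"
      by (simp add: ennreal_mult' mult.assoc)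
    finally show ?thesis using k by (simp add: mult.assoc[symmetric] ennreal_mult'[symmetric])
  qed
  have X_eq: "X k = ennreal (?L k)" if k: "0 < k" for k
  proof -
    have "X k = (\<Sum>m. ennreal (neg_binomial \<theta> (?c k) m) * (\<integral>\<^sup>+\<omega>. ennreal ((1 - \<sigma> k) ^ num_distinct I m \<omega>) \<partial>N))"
      unfolding X_def a_def nn_a
      using sum_floor[OF k, of "\<lambda>m. ennreal (expectation (\<lambda>\<omega>. (1 - \<sigma> k) ^ num_distinct I m \<omega>))"] by simp
    then show ?thesis using neg_binomial_sampled[OF N \<alpha> \<theta> _ \<sigma> Q samp, of "?c k"] k by simp
  qed
  have XY: "X k + Y k = 1" if k: "0 < k" for k
  proof -
    have "X k + Y k = (\<integral>\<^sup>+y. ennreal (u k y) * ennreal (a k y) * indicator {0<..} y + ennreal (u k y) * ennreal (1 - a k y) * indicator {0<..} y \<partial>lborel)"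
      unfolding X_def Y_def by (rule nn_integral_add[symmetric]) measurable
    also have "\<dots> = (\<integral>\<^sup>+y. ennreal (u k y) * 1 * indicator {0<..} y \<partial>lborel)"
    proof (rule nn_integral_cong)
      fix y
      have "ennreal (a k y) + ennreal (1 - a k y) = 1" using a01[of k y] by (simp add: ennreal_plus[symmetric] del: ennreal_plus)
      then show "ennreal (u k y) * ennreal (a k y) * indicator {0<..} y + ennreal (u k y) * ennreal (1 - a k y) * indicator {0<..} y =
        ennreal (u k y) * 1 * indicator {0<..} y"
        by (simp add: distrib_left[symmetric] distrib_right[symmetric])
    qed
    also have "\<dots> = (\<Sum>m. ennreal (neg_binomial \<theta> (?c k) m) * 1)"
      using sum_floor[OF k, of "\<lambda>_. 1"] by simp
    \<comment> \<open>Marking probability 0 gives the total mass of the negative binomial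
      weights.\<close>
    also have "\<dots> = ennreal (?c k powr \<theta> * tilt 0 \<alpha> (?c k) powr (- (\<theta> / \<alpha>)))"
      using neg_binomial_sampled[OF N \<alpha> \<theta> _ _ _ Q samp, of "?c k" 0] k by (simp add: emeasure_space_1)
    also have "?c k powr \<theta> * tilt 0 \<alpha> (?c k) powr (- (\<theta> / \<alpha>)) = 1"
      using k \<alpha> by (simp add: tilt_def powr_powr powr_add[symmetric])
    finally show ?thesis by simp
  qed
  \<comment> \<open>For \<open>c = 1 / k\<close> and \<open>s = l * c powr \<alpha>\<close> the term
    \<open>s * (1 + 1 / c) powr \<alpha>\<close> equals \<open>l * (1 + c) powr \<alpha>\<close>,
    which tends to \<open>l\<close>, while \<open>s\<close> itself vanishes.\<close>
  have L_lim: "?L \<longlonglongrightarrow> (1 + l) powr (- (\<theta> / \<alpha>))"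
  proof (rule Lim_transform_eventually)
    show "(\<lambda>k. (1 - l * real k powr (- \<alpha>) + l * (1 + 1 / real k) powr \<alpha>) powr (- (\<theta> / \<alpha>))) \<longlonglongrightarrow> (1 + l) powr (- (\<theta> / \<alpha>))"
    proof (rule tendsto_powr)
      have "(\<lambda>k. 1 - l * real k powr (- \<alpha>) + l * (1 + 1 / real k) powr \<alpha>) \<longlonglongrightarrow> 1 - l * 0 + l * 1"
      proof (intro tendsto_intros)
        show "(\<lambda>k. real k powr (- \<alpha>)) \<longlonglongrightarrow> 0" using \<alpha> by real_asymp
        show "(\<lambda>k. (1 + 1 / real k) powr \<alpha>) \<longlonglongrightarrow> 1" by real_asymp
      qed
      then show "(\<lambda>k. 1 - l * real k powr (- \<alpha>) + l * (1 + 1 / real k) powr \<alpha>) \<longlonglongrightarrow> 1 + l" by simp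
    qed (use l in auto)
    show "\<forall>\<^sub>F k in sequentially. (1 - l * real k powr (- \<alpha>) + l * (1 + 1 / real k) powr \<alpha>) powr (- (\<theta> / \<alpha>)) = ?L k"
      using \<sigma>_ev eventually_gt_at_top[of 0]
    proof eventually_elim
      case (elim k)
      let ?x = "?c k powr \<alpha>"
      have x: "0 < ?x" using elim by simp
      have kx: "real k powr (- \<alpha>) = ?x" using elim by (simp add: powr_minus powr_divide inverse_eq_divide)
      have c1: "(?c k + 1) powr \<alpha> = (1 + 1 / real k) powr \<alpha>" by (simp add: add.commute)
      have t: "tilt (\<sigma> k) \<alpha> (?c k) = ?x * (1 - l * real k powr (- \<alpha>) + l * (1 + 1 / real k) powr \<alpha>)"
        unfolding tilt_def[OF \<sigma>[of k] \<alpha>] unfolding elim(1) kx c1 by (simp add: algebra_simps)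
      have pos: "0 \<le> 1 - l * real k powr (- \<alpha>) + l * (1 + 1 / real k) powr \<alpha>"
        using \<sigma>(2)[of k] l unfolding elim(1) by (intro add_nonneg_nonneg) auto
      have "?c k powr \<theta> * ?x powr (- (\<theta> / \<alpha>)) = 1"
        using elim \<alpha> by (simp add: powr_powr powr_add[symmetric])
      then show ?case unfolding t using x pos by (simp add: powr_mult mult.assoc[symmetric])
    qed
  qed
  let ?R = "(1 + l) powr (- (\<theta> / \<alpha>))"
  have R: "0 \<le> ?R" "?R \<le> 1"
  proof -
    have "?R \<le> (1 + l) powr 0" using l \<alpha> \<theta> by (intro powr_mono) auto
    then show "?R \<le> 1" using l by simp
  qed simp
  have X_lim: "X \<longlonglongrightarrow> ennreal ?R"
    by (rule Lim_transform_eventually[OF tendsto_ennrealI[OF L_lim]],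
        rule eventually_mono[OF eventually_gt_at_top[of "0::nat"]]) (simp add: X_eq)
  have Y_lim: "Y \<longlonglongrightarrow> ennreal (1 - ?R)"
  proof (rule Lim_transform_eventually)
    show "(\<lambda>k. ennreal (1 - ?L k)) \<longlonglongrightarrow> ennreal (1 - ?R)"
      by (intro tendsto_ennrealI tendsto_intros L_lim)
    show "\<forall>\<^sub>F k in sequentially. ennreal (1 - ?L k) = Y k"
      using eventually_gt_at_top[of 0]
    proof eventually_elim
      case (elim k)
      have e: "ennreal (?L k) + Y k = 1" using XY[OF elim] X_eq[OF elim] by simp
      have L0: "0 \<le> ?L k" by simp
      from e have "Y k = 1 - ennreal (?L k)" by (metis ennreal_add_diff_cancel_left ennreal_neq_top)
      then show ?case using L0 by (simp add: ennreal_minus ennreal_1[symmetric] del: ennreal_1)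
    qed
  qed
  let ?A = "\<integral>\<^sup>+y. ennreal (g y) * ennreal (b y) * indicator {0<..} y \<partial>lborel"
  let ?B = "\<integral>\<^sup>+y. ennreal (g y) * ennreal (1 - b y) * indicator {0<..} y \<partial>lborel"
  have A: "?A \<le> ennreal ?R"
  proof -
    have "?A = (\<integral>\<^sup>+y. liminf (\<lambda>k. ennreal (u k y) * ennreal (a k y) * indicator {0<..} y) \<partial>lborel)"
    proof (rule nn_integral_cong)
      fix y :: real
      show "ennreal (g y) * ennreal (b y) * indicator {0<..} y = liminf (\<lambda>k. ennreal (u k y) * ennreal (a k y) * indicator {0<..} y)"
      proof (cases "0 < y")
        case True
        have "(\<lambda>k. ennreal (u k y * a k y)) \<longlonglongrightarrow> ennreal (g y * b y)"
          by (intro tendsto_ennrealI tendsto_mult u_lim a_lim True)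
        from lim_imp_Liminf[OF _ this] show ?thesis using True u0 a01 g0 b01 by (simp add: ennreal_mult)
      qed (simp add: Liminf_const)
    qed
    also have "\<dots> \<le> liminf X" unfolding X_def by (rule nn_integral_liminf) measurable
    also have "\<dots> = ennreal ?R" by (rule lim_imp_Liminf[OF _ X_lim]) simp
    finally show ?thesis .
  qed
  have B: "?B \<le> ennreal (1 - ?R)"
  proof -
    have "?B = (\<integral>\<^sup>+y. liminf (\<lambda>k. ennreal (u k y) * ennreal (1 - a k y) * indicator {0<..} y) \<partial>lborel)"
    proof (rule nn_integral_cong)
      fix y :: real
      show "ennreal (g y) * ennreal (1 - b y) * indicator {0<..} y = liminf (\<lambda>k. ennreal (u k y) * ennreal (1 - a k y) * indicator {0<..} y)"
      proof (cases "0 < y")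
        case True
        have "(\<lambda>k. ennreal (u k y * (1 - a k y))) \<longlonglongrightarrow> ennreal (g y * (1 - b y))"
          by (intro tendsto_ennrealI tendsto_intros u_lim a_lim True)
        from lim_imp_Liminf[OF _ this] show ?thesis using True u0 a01 g0 b01 by (simp add: ennreal_mult)
      qed (simp add: Liminf_const)
    qed
    also have "\<dots> \<le> liminf Y" unfolding Y_def by (rule nn_integral_liminf) measurable
    also have "\<dots> = ennreal (1 - ?R)" by (rule lim_imp_Liminf[OF _ Y_lim]) simp
    finally show ?thesis .
  qed
  have AB: "?A + ?B = 1"
  proof -
    have "?A + ?B = (\<integral>\<^sup>+y. ennreal (g y) * ennreal (b y) * indicator {0<..} y + ennreal (g y) * ennreal (1 - b y) * indicator {0<..} y \<partial>lborel)"
      by (rule nn_integral_add[symmetric]) measurable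
    also have "\<dots> = (\<integral>\<^sup>+y. ennreal (g y) * indicator {0<..} y \<partial>lborel)"
    proof (rule nn_integral_cong)
      fix y
      have "ennreal (b y) + ennreal (1 - b y) = 1" using b01[of y] by (simp add: ennreal_plus[symmetric] del: ennreal_plus)
      then show "ennreal (g y) * ennreal (b y) * indicator {0<..} y + ennreal (g y) * ennreal (1 - b y) * indicator {0<..} y =
        ennreal (g y) * indicator {0<..} y"
        by (simp add: distrib_left[symmetric] distrib_right[symmetric])
    qed
    also have "\<dots> = 1"
      unfolding g_def using Gamma_density_integral[OF \<theta>, of 1] by simp
    finally show ?thesis .
  qed
  \<comment> \<open>Any gap in the bound for \<open>?A\<close> would have to be made up by
    \<open>?B\<close>, which its own bound forbids.\<close>
  have "?A = ennreal ?R"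
  proof (rule antisym[OF A])
    have "ennreal ?R + ennreal (1 - ?R) = ?A + ?B" unfolding AB using R by (simp add: ennreal_plus[symmetric] del: ennreal_plus)
    also have "\<dots> \<le> ?A + ennreal (1 - ?R)" using B by (rule add_left_mono)
    finally show "ennreal ?R \<le> ?A"
      by (simp add: ennreal_add_left_cancel_le add.commute[of _ "ennreal (1 - ?R)"])
  qed
  then show ?thesis unfolding nn_b g_def by (simp add: mult_ac)
qed


section \<open>Removing an independent Gamma factor\<close>

definition Gamma_law :: "real \<Rightarrow> real measure" where
  "Gamma_law \<theta> = density lborel (\<lambda>y. ennreal (y powr (\<theta> - 1) * exp (- 1 * y) / Gamma \<theta>) * indicator {0<..} y)"

lemma sets_Gamma_law [simp, measurable_cong]: "sets (Gamma_law \<theta>) = sets borel"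
  by (simp add: Gamma_law_def)

lemma nn_integral_Gamma_law:
  assumes [measurable]: "h \<in> borel_measurable borel"
  shows "(\<integral>\<^sup>+y. h y \<partial>Gamma_law \<theta>) =
    (\<integral>\<^sup>+y. ennreal (y powr (\<theta> - 1) * exp (- 1 * y) / Gamma \<theta>) * indicator {0<..} y * h y \<partial>lborel)"
  unfolding Gamma_law_def by (rule nn_integral_density) measurable

lemma prob_space_Gamma_law: "0 < \<theta> \<Longrightarrow> prob_space (Gamma_law \<theta>)"
  using Gamma_density_integral[of \<theta> 1] by (intro prob_spaceI) (simp add: Gamma_law_def emeasure_density)

lemma Gamma_law_moment:
  assumes \<theta>: "0 < \<theta>" and a: "0 < \<alpha>"
  shows "(\<integral>\<^sup>+y. ennreal ((y powr \<alpha>) ^ r) \<partial>Gamma_law \<theta>) = ennreal (Gamma (\<theta> + real r * \<alpha>) / Gamma \<theta>)"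
proof -
  have G: "0 < Gamma \<theta>" "0 < \<theta> + real r * \<alpha>" using \<theta> a by (auto intro!: Gamma_real_pos add_pos_nonneg)
  have "(\<integral>\<^sup>+y. ennreal ((y powr \<alpha>) ^ r) \<partial>Gamma_law \<theta>) =
    (\<integral>\<^sup>+y. ennreal (1 / Gamma \<theta>) * (ennreal (y powr (\<theta> + real r * \<alpha> - 1) * exp (- 1 * y)) * indicator {0<..} y) \<partial>lborel)"
  proof (subst nn_integral_Gamma_law, simp, rule nn_integral_cong)
    fix y :: real
    have "y powr (\<theta> - 1) * exp (- 1 * y) / Gamma \<theta> * (y powr \<alpha>) ^ r = 1 / Gamma \<theta> * (y powr (\<theta> + real r * \<alpha> - 1) * exp (- 1 * y))" if "0 < y"
    proof -
      have "(y powr \<alpha>) ^ r = y powr (real r * \<alpha>)" using that by (simp add: powr_power mult.commute)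
      moreover have "y powr (\<theta> + real r * \<alpha> - 1) = y powr (\<theta> - 1) * y powr (real r * \<alpha>)"
        by (simp add: powr_add[symmetric] algebra_simps)
      ultimately show ?thesis by simp
    qed
    then show "ennreal (y powr (\<theta> - 1) * exp (- 1 * y) / Gamma \<theta>) * indicator {0<..} y * ennreal ((y powr \<alpha>) ^ r) =
      ennreal (1 / Gamma \<theta>) * (ennreal (y powr (\<theta> + real r * \<alpha> - 1) * exp (- 1 * y)) * indicator {0<..} y)"
      using G by (cases "0 < y") (auto simp: ennreal_mult'[symmetric] ennreal_mult''[symmetric])
  qed
  also have "\<dots> = ennreal (1 / Gamma \<theta>) * ennreal (Gamma (\<theta> + real r * \<alpha>) * 1 powr (- (\<theta> + real r * \<alpha>)))"
    using nn_integral_Gamma_scaled[OF G(2), of 1] by (subst nn_integral_cmult) simp_all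
  finally show ?thesis using G by (simp add: ennreal_mult'[symmetric])
qed

text \<open>With \<open>W = exp (- (Y powr \<alpha> * D))\<close> the hypothesis lists the moments
  of \<open>W\<close>, and a law on the unit interval is determined by its moments. Then all powers
  of \<open>- ln W = Y powr \<alpha> * D\<close> have equal means, and by independence the finite
  positive moments of \<open>Y powr \<alpha>\<close> can be divided out.\<close>

lemma Gamma_mixture_moments:
  assumes \<theta>: "0 < \<theta>" and a: "0 < \<alpha>"
    and \<mu>: "prob_space \<mu>" "sets \<mu> = sets borel" "AE d in \<mu>. 0 \<le> d"
    and \<nu>: "prob_space \<nu>" "sets \<nu> = sets borel" "AE d in \<nu>. 0 \<le> d"
    and mix: "\<And>n::nat. (\<integral>\<^sup>+y. \<integral>\<^sup>+d. ennreal (exp (- real n * (y powr \<alpha> * d))) \<partial>\<mu> \<partial>Gamma_law \<theta>) =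
      (\<integral>\<^sup>+y. \<integral>\<^sup>+d. ennreal (exp (- real n * (y powr \<alpha> * d))) \<partial>\<nu> \<partial>Gamma_law \<theta>)"
  shows "(\<integral>\<^sup>+d. ennreal (d ^ r) \<partial>\<mu>) = (\<integral>\<^sup>+d. ennreal (d ^ r) \<partial>\<nu>)"
proof -
  interpret G: prob_space "Gamma_law \<theta>" by (rule prob_space_Gamma_law[OF \<theta>])
  let ?F = "\<lambda>(y, d). exp (- (y powr \<alpha> * d))"
  define W where "W \<mu> = distr (Gamma_law \<theta> \<Otimes>\<^sub>M \<mu>) borel ?F" for \<mu>
  have Wnn: "(\<integral>\<^sup>+w. h w \<partial>W \<mu>) = (\<integral>\<^sup>+y. \<integral>\<^sup>+d. h (exp (- (y powr \<alpha> * d))) \<partial>\<mu> \<partial>Gamma_law \<theta>)"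
    if "prob_space \<mu>" and [measurable_cong]: "sets \<mu> = sets borel" and [measurable]: "h \<in> borel_measurable borel" for h \<mu>
  proof -
    interpret prob_space \<mu> by fact
    have F: "?F \<in> borel_measurable (Gamma_law \<theta> \<Otimes>\<^sub>M \<mu>)" by measurable
    have "(\<integral>\<^sup>+w. h w \<partial>W \<mu>) = (\<integral>\<^sup>+x. h (?F x) \<partial>(Gamma_law \<theta> \<Otimes>\<^sub>M \<mu>))"
      unfolding W_def by (rule nn_integral_distr[OF F]) simp
    also have "\<dots> = (\<integral>\<^sup>+y. \<integral>\<^sup>+d. h (?F (y, d)) \<partial>\<mu> \<partial>Gamma_law \<theta>)"
      by (rule nn_integral_fst[symmetric]) measurable
    finally show ?thesis by simp
  qed
  have Wreal: "real_distribution (W \<mu>)" "AE w in W \<mu>. 0 \<le> w \<and> w \<le> 1"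
    if \<mu>: "prob_space \<mu>" and s [measurable_cong]: "sets \<mu> = sets borel" and p: "AE d in \<mu>. 0 \<le> d" for \<mu>
  proof -
    interpret M: prob_space \<mu> by fact
    interpret GM: pair_prob_space "Gamma_law \<theta>" \<mu> ..
    have F: "?F \<in> borel_measurable (Gamma_law \<theta> \<Otimes>\<^sub>M \<mu>)" by measurable
    show "real_distribution (W \<mu>)" unfolding W_def by (rule GM.real_distribution_distr[OF F])
    have "AE x in Gamma_law \<theta> \<Otimes>\<^sub>M \<mu>. 0 \<le> snd x"
    proof (rule GM.AE_pair_measure)
      show "{x \<in> space (Gamma_law \<theta> \<Otimes>\<^sub>M \<mu>). 0 \<le> snd x} \<in> sets (Gamma_law \<theta> \<Otimes>\<^sub>M \<mu>)" by measurable
    qed (use p in simp)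
    then show "AE w in W \<mu>. 0 \<le> w \<and> w \<le> 1"
      unfolding W_def by (subst AE_distr_iff[OF F]) (auto elim!: eventually_mono simp: split_beta')
  qed
  have Wint: "integrable (W \<mu>) (\<lambda>w. w ^ n)" "(\<integral>\<^sup>+w. ennreal (w ^ n) \<partial>W \<mu>) = ennreal (\<integral>w. w ^ n \<partial>W \<mu>)"
    "0 \<le> (\<integral>w. w ^ n \<partial>W \<mu>)" "(\<integral>w. w ^ n \<partial>W \<mu>) \<le> 1"
    if \<mu>: "prob_space \<mu>" "sets \<mu> = sets borel" "AE d in \<mu>. 0 \<le> d" for \<mu> n
  proof -
    interpret R: real_distribution "W \<mu>" by (rule Wreal[OF \<mu>])
    have AE: "AE w in W \<mu>. 0 \<le> w ^ n \<and> w ^ n \<le> 1"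
      using Wreal(2)[OF \<mu>] by eventually_elim (auto intro: power_le_one)
    show I: "integrable (W \<mu>) (\<lambda>w. w ^ n)"
      by (rule R.integrable_const_bound[of _ 1], rule eventually_mono[OF AE]) auto
    show "(\<integral>\<^sup>+w. ennreal (w ^ n) \<partial>W \<mu>) = ennreal (\<integral>w. w ^ n \<partial>W \<mu>)"
      using AE by (intro nn_integral_eq_integral[OF I]) simp
    show "0 \<le> (\<integral>w. w ^ n \<partial>W \<mu>)" using AE by (intro integral_nonneg_AE) simp
    show "(\<integral>w. w ^ n \<partial>W \<mu>) \<le> 1" using AE by (intro R.integral_le_const[OF I]) simp
  qed
  have Wpow: "(\<integral>\<^sup>+w. ennreal (w ^ n) \<partial>W \<mu>) = (\<integral>\<^sup>+y. \<integral>\<^sup>+d. ennreal (exp (- real n * (y powr \<alpha> * d))) \<partial>\<mu> \<partial>Gamma_law \<theta>)"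
    if "prob_space \<mu>" "sets \<mu> = sets borel" for \<mu> n
    using Wnn[OF that, of "\<lambda>w. ennreal (w ^ n)"] by (simp add: exp_of_nat_mult[symmetric])
  have "W \<mu> = W \<nu>"
  proof (rule moment_determinacy[OF Wreal(1)[OF \<mu>] Wreal(1)[OF \<nu>] Wint(1)[OF \<mu>] Wint(1)[OF \<nu>]])
    show "(\<integral>w. w ^ n \<partial>W \<mu>) = (\<integral>w. w ^ n \<partial>W \<nu>)" for n
    proof -
      have "ennreal (\<integral>w. w ^ n \<partial>W \<mu>) = ennreal (\<integral>w. w ^ n \<partial>W \<nu>)"
        by (simp only: Wint(2)[OF \<mu>, symmetric] Wint(2)[OF \<nu>, symmetric] Wpow[OF \<mu>(1,2)] Wpow[OF \<nu>(1,2)] mix)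
      then show ?thesis using Wint(3)[OF \<mu>] Wint(3)[OF \<nu>] by simp
    qed
    show "AE w in W \<mu>. 0 \<le> w" "AE w in W \<nu>. 0 \<le> w"
      using Wreal(2)[OF \<mu>] Wreal(2)[OF \<nu>] by simp_all
    fix t :: real
    show "(\<lambda>n. t ^ n * (\<integral>w. w ^ n \<partial>W \<nu>) / fact n) \<longlonglongrightarrow> 0"
    proof (rule Lim_null_comparison)
      show "\<forall>\<^sub>F n in sequentially. norm (t ^ n * (\<integral>w. w ^ n \<partial>W \<nu>) / fact n) \<le> norm t ^ n /\<^sub>R fact n"
        using Wint(3,4)[OF \<nu>]
        by (intro always_eventually allI) (auto simp: abs_mult power_abs field_simps intro!: divide_right_mono mult_left_le)
      show "(\<lambda>n. norm t ^ n /\<^sub>R fact n) \<longlonglongrightarrow> 0"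
        by (rule summable_LIMSEQ_zero[OF summable_exp_generic])
    qed
  qed
  \<comment> \<open>\<open>W\<close> is positive, so the logarithm recovers the product
    \<open>Y powr \<alpha> * D\<close> exactly.\<close>
  then have "(\<integral>\<^sup>+w. ennreal ((- ln w) ^ r) \<partial>W \<mu>) = (\<integral>\<^sup>+w. ennreal ((- ln w) ^ r) \<partial>W \<nu>)" by simp
  moreover have "(\<integral>\<^sup>+w. ennreal ((- ln w) ^ r) \<partial>W \<mu>) = ennreal (Gamma (\<theta> + real r * \<alpha>) / Gamma \<theta>) * (\<integral>\<^sup>+d. ennreal (d ^ r) \<partial>\<mu>)"
    if "prob_space \<mu>" and s [measurable_cong]: "sets \<mu> = sets borel" for \<mu>
  proof -
    interpret prob_space \<mu> by fact
    have "(\<integral>\<^sup>+w. ennreal ((- ln w) ^ r) \<partial>W \<mu>) = (\<integral>\<^sup>+y. \<integral>\<^sup>+d. ennreal ((y powr \<alpha>) ^ r) * ennreal (d ^ r) \<partial>\<mu> \<partial>Gamma_law \<theta>)"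
      using Wnn[OF that, of "\<lambda>w. ennreal ((- ln w) ^ r)"] by (simp add: power_mult_distrib ennreal_mult')
    also have "\<dots> = (\<integral>\<^sup>+y. ennreal ((y powr \<alpha>) ^ r) * (\<integral>\<^sup>+d. ennreal (d ^ r) \<partial>\<mu>) \<partial>Gamma_law \<theta>)"
      by (intro nn_integral_cong nn_integral_cmult) measurable
    also have "\<dots> = (\<integral>\<^sup>+y. ennreal ((y powr \<alpha>) ^ r) \<partial>Gamma_law \<theta>) * (\<integral>\<^sup>+d. ennreal (d ^ r) \<partial>\<mu>)"
      by (rule nn_integral_multc) measurable
    finally show ?thesis by (simp add: Gamma_law_moment[OF \<theta> a])
  qed
  ultimately have eq: "ennreal (Gamma (\<theta> + real r * \<alpha>) / Gamma \<theta>) * (\<integral>\<^sup>+d. ennreal (d ^ r) \<partial>\<mu>) =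
    ennreal (Gamma (\<theta> + real r * \<alpha>) / Gamma \<theta>) * (\<integral>\<^sup>+d. ennreal (d ^ r) \<partial>\<nu>)"
    using \<mu> \<nu> by simp
  have "0 < Gamma (\<theta> + real r * \<alpha>) / Gamma \<theta>"
    using \<theta> a by (intro divide_pos_pos Gamma_real_pos add_pos_nonneg) auto
  then show ?thesis using eq by (auto simp: ennreal_mult_cancel_left)
qed

text \<open>After mixing with a Gamma variable, the diversity and the Mittag-Leffler variable share
  the transform \<open>(1 + n) powr (- (\<theta> / \<alpha>))\<close> at every natural
  \<open>n\<close>. Hence they share all moments, and these determine the law.\<close>

lemma diversity_law:
  assumes N: "prob_space N" and \<alpha>: "0 < \<alpha>" "\<alpha> < 1" and f: "stable_density \<alpha> f" and \<theta>: "0 < \<theta>"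
    and Q: "has_seq_law N Q (PD \<alpha> \<theta>)" and AD: "alpha_diversity N \<alpha> Q D"
  shows "distr N borel D = mittag_leffler_law f \<alpha> \<theta>"
proof -
  interpret prob_space N by fact
  interpret G: prob_space "Gamma_law \<theta>" by (rule prob_space_Gamma_law[OF \<theta>])
  interpret mlaw: prob_space "mittag_leffler_law f \<alpha> \<theta>" by (rule prob_space_mittag_leffler[OF \<alpha> f \<theta>])
  from AD obtain I where D [measurable]: "D \<in> borel_measurable N" and samp: "iid_sampled N Q I"
    and lim: "AE \<omega> in N. (\<lambda>n. real n powr (- \<alpha>) * real (num_distinct I n \<omega>)) \<longlonglongrightarrow> D \<omega>"
    by (auto simp: alpha_diversity_def num_distinct_def)
  have D0: "AE \<omega> in N. 0 \<le> D \<omega>"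
    using lim
  proof eventually_elim
    case (elim \<omega>)
    then show ?case by (rule tendsto_lowerbound) auto
  qed
  have posML: "AE d in mittag_leffler_law f \<alpha> \<theta>. 0 \<le> d"
    using AE_mittag_leffler_pos[OF \<alpha> f \<theta>] by (auto elim!: eventually_mono)
  have mom: "(\<integral>\<^sup>+d. ennreal (d ^ r) \<partial>distr N borel D) = (\<integral>\<^sup>+d. ennreal (d ^ r) \<partial>mittag_leffler_law f \<alpha> \<theta>)" for r
  proof (rule Gamma_mixture_moments[OF \<theta> \<alpha>(1)])
    show "prob_space (distr N borel D)" by (rule prob_space_distr) simp
    show "AE d in distr N borel D. 0 \<le> d" using D0 by (subst AE_distr_iff) auto
    fix n :: nat
    have "(\<integral>\<^sup>+y. \<integral>\<^sup>+d. ennreal (exp (- real n * (y powr \<alpha> * d))) \<partial>distr N borel D \<partial>Gamma_law \<theta>) =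
      (\<integral>\<^sup>+y. \<integral>\<^sup>+\<omega>. ennreal (exp (- real n * (y powr \<alpha> * D \<omega>))) \<partial>N \<partial>Gamma_law \<theta>)"
      by (intro nn_integral_cong nn_integral_distr) measurable
    also have "\<dots> = ennreal ((1 + real n) powr (- (\<theta> / \<alpha>)))"
      using diversity_Gamma_mix[OF N \<alpha> \<theta> _ Q samp D lim, of "real n"]
      by (subst nn_integral_Gamma_law) simp_all
    also have "\<dots> = ennreal (1 / Gamma \<theta>) * ennreal (Gamma \<theta> * (1 + real n) powr (- (\<theta> / \<alpha>)))"
      using Gamma_real_pos[OF \<theta>] by (simp add: ennreal_mult'[symmetric] less_imp_neq[symmetric])
    also have "\<dots> = ennreal (1 / Gamma \<theta>) * (\<integral>\<^sup>+s. \<integral>\<^sup>+y. ennreal (y powr (\<theta> - 1) * exp (- y) * exp (- real n * (y powr \<alpha> * s))) * indicator {0<..} y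
      \<partial>lborel \<partial>mittag_leffler_law f \<alpha> \<theta>)"
      using mittag_leffler_Gamma_mix[OF \<alpha> f \<theta>, of "real n"] by simp
    also have "\<dots> = (\<integral>\<^sup>+s. \<integral>\<^sup>+y. ennreal (exp (- real n * (y powr \<alpha> * s))) \<partial>Gamma_law \<theta> \<partial>mittag_leffler_law f \<alpha> \<theta>)"
    proof (subst nn_integral_cmult[symmetric])
      show "(\<integral>\<^sup>+s. ennreal (1 / Gamma \<theta>) * (\<integral>\<^sup>+y. ennreal (y powr (\<theta> - 1) * exp (- y) * exp (- real n * (y powr \<alpha> * s))) * indicator {0<..} y \<partial>lborel) \<partial>mittag_leffler_law f \<alpha> \<theta>) =
        (\<integral>\<^sup>+s. \<integral>\<^sup>+y. ennreal (exp (- real n * (y powr \<alpha> * s))) \<partial>Gamma_law \<theta> \<partial>mittag_leffler_law f \<alpha> \<theta>)"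
      proof (rule nn_integral_cong)
        fix s :: real
        have "ennreal (1 / Gamma \<theta>) * (\<integral>\<^sup>+y. ennreal (y powr (\<theta> - 1) * exp (- y) * exp (- real n * (y powr \<alpha> * s))) * indicator {0<..} y \<partial>lborel) =
          (\<integral>\<^sup>+y. ennreal (1 / Gamma \<theta>) * (ennreal (y powr (\<theta> - 1) * exp (- y) * exp (- real n * (y powr \<alpha> * s))) * indicator {0<..} y) \<partial>lborel)"
          by (rule nn_integral_cmult[symmetric]) measurable
        also have "\<dots> = (\<integral>\<^sup>+y. ennreal (exp (- real n * (y powr \<alpha> * s))) \<partial>Gamma_law \<theta>)"
          using Gamma_real_pos[OF \<theta>]
          by (subst nn_integral_Gamma_law, simp, intro nn_integral_cong)
            (simp add: indicator_def ennreal_mult'[symmetric] ennreal_mult''[symmetric])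
        finally show "ennreal (1 / Gamma \<theta>) * (\<integral>\<^sup>+y. ennreal (y powr (\<theta> - 1) * exp (- y) * exp (- real n * (y powr \<alpha> * s))) * indicator {0<..} y \<partial>lborel) =
          (\<integral>\<^sup>+y. ennreal (exp (- real n * (y powr \<alpha> * s))) \<partial>Gamma_law \<theta>)" .
      qed
    qed measurable
    also have "\<dots> = (\<integral>\<^sup>+y. \<integral>\<^sup>+s. ennreal (exp (- real n * (y powr \<alpha> * s))) \<partial>mittag_leffler_law f \<alpha> \<theta> \<partial>Gamma_law \<theta>)"
    proof -
      interpret P: pair_sigma_finite "Gamma_law \<theta>" "mittag_leffler_law f \<alpha> \<theta>" ..
      show ?thesis by (rule P.Fubini') measurable
    qed
    finally show "(\<integral>\<^sup>+y. \<integral>\<^sup>+d. ennreal (exp (- real n * (y powr \<alpha> * d))) \<partial>distr N borel D \<partial>Gamma_law \<theta>) =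
      (\<integral>\<^sup>+y. \<integral>\<^sup>+s. ennreal (exp (- real n * (y powr \<alpha> * s))) \<partial>mittag_leffler_law f \<alpha> \<theta> \<partial>Gamma_law \<theta>)" .
  qed (use posML mlaw.prob_space_axioms in auto)
  have hb: "has_bochner_integral N (\<lambda>\<omega>. D \<omega> ^ r) (ml_moment \<alpha> \<theta> r)" for r
  proof (rule has_bochner_integral_nn_integral)
    show "AE \<omega> in N. 0 \<le> D \<omega> ^ r" using D0 by eventually_elim simp
    show "0 \<le> ml_moment \<alpha> \<theta> r" using \<alpha> \<theta> by (intro less_imp_le[OF ml_moment_pos]) auto
    have "(\<integral>\<^sup>+\<omega>. ennreal (D \<omega> ^ r) \<partial>N) = (\<integral>\<^sup>+d. ennreal (d ^ r) \<partial>distr N borel D)"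
      by (subst nn_integral_distr) simp_all
    then show "(\<integral>\<^sup>+\<omega>. ennreal (D \<omega> ^ r) \<partial>N) = ennreal (ml_moment \<alpha> \<theta> r)"
      by (simp add: mom mittag_leffler_moment[OF \<alpha> f \<theta>])
  qed simp
  show ?thesis
    by (rule mittag_leffler_moment_determinacy[OF \<alpha> f \<theta> N D D0]) (use hb in \<open>auto simp: has_bochner_integral_iff\<close>)
qed

theorem proposition4p3:
  fixes \<alpha> \<beta> :: real and l :: nat and f :: "real \<Rightarrow> real"
    and M :: "'a measure" and N :: "'b measure"
    and W B :: "nat \<Rightarrow> 'a \<Rightarrow> real"
    and W' B' :: "nat \<Rightarrow> nat \<Rightarrow> 'a \<Rightarrow> real"
    and P1 P2 Z1s Z2s :: "nat \<Rightarrow> 'a \<Rightarrow> real"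
    and Z1 Z2 :: "'a \<Rightarrow> real"
  assumes "0 \<le> \<beta>" and "\<beta> < \<alpha>" and "\<alpha> < 1" and "1 \<le> l"
    and f: "stable_density \<alpha> f"
    and M: "prob_space M" and N: "prob_space N"
    and W_indep: "prob_space.indep_vars M (\<lambda>_. borel) W {1..l}"
    and W_law: "\<And>i. i \<in> {1..l} \<Longrightarrow> has_law M (W i) (beta_law (real i * \<alpha> - \<beta>) (1 - \<alpha>))"
    and B_indep: "prob_space.indep_vars M (\<lambda>_. borel) B {1..l}"
    and B_law: "\<And>i. i \<in> {1..l} \<Longrightarrow>
      has_law M (B i) (beta_law ((\<alpha> - \<beta> + real i - 1) / \<alpha>) ((1 - \<alpha>) / \<alpha>))"
    and W'_iid: "iid_with_law M (\<lambda>k \<omega>. \<Prod>i=1..l. W' i k \<omega> powr \<alpha>)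
      (distr M borel (\<lambda>\<omega>. \<Prod>i=1..l. W i \<omega> powr \<alpha>))"
    and B'_iid: "iid_with_law M (\<lambda>k \<omega>. \<Prod>i=1..l. B' i k \<omega>)
      (distr M borel (\<lambda>\<omega>. \<Prod>i=1..l. B i \<omega>))"
    and Z1s_iid: "iid_with_law M Z1s (mittag_leffler_law f \<alpha> (real l * \<alpha> - \<beta>))"
    and Z2s_iid: "iid_with_law M Z2s (mittag_leffler_law f \<alpha> (real l - \<beta>))"
    and P1: "has_seq_law M P1 (GEM \<beta> (real l * \<alpha> - \<beta>))"
    and P2: "has_seq_law M P2 (GEM \<beta> (real l - \<beta>))"
    and indep1: "indep_seqs M [P1, \<lambda>k \<omega>. \<Prod>i=1..l. W' i k \<omega> powr \<alpha>, Z1s]"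
    and indep2: "indep_seqs M [P2, \<lambda>k \<omega>. \<Prod>i=1..l. B' i k \<omega>, Z2s]"
    and Z1: "has_law M Z1 (mittag_leffler_law f \<alpha> (real l * \<alpha> - \<beta>))"
    and Z2: "has_law M Z2 (mittag_leffler_law f \<alpha> (real l - \<beta>))"
  shows
    "((\<forall>(Q :: nat \<Rightarrow> 'b \<Rightarrow> real) D.
         has_seq_law N Q (PD \<alpha> (real l * \<alpha> - \<beta>)) \<and> alpha_diversity N \<alpha> Q D \<longrightarrow>
         distr N borel D = distr M borel Z1) \<and>
      (AE \<omega> in M. summable
         (\<lambda>k. P1 k \<omega> powr \<alpha> * (\<Prod>i=1..l. W' i k \<omega> powr \<alpha>) * Z1s k \<omega>)) \<and>
      distr M borel Z1 = distr M borel
         (\<lambda>\<omega>. \<Sum>k. P1 k \<omega> powr \<alpha> * (\<Prod>i=1..l. W' i k \<omega> powr \<alpha>) * Z1s k \<omega>) \<and>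
      (AE \<omega> in M. summable (\<lambda>k. P1 k \<omega> powr \<alpha> * (\<Prod>i=1..l. W' i k \<omega> powr \<alpha>))) \<and>
      (\<integral>\<omega>. (\<Sum>k. P1 k \<omega> powr \<alpha> * (\<Prod>i=1..l. W' i k \<omega> powr \<alpha>)) \<partial>M) = 1)
     \<and>
     ((\<forall>(Q :: nat \<Rightarrow> 'b \<Rightarrow> real) D.
         has_seq_law N Q (PD \<alpha> (real l - \<beta>)) \<and> alpha_diversity N \<alpha> Q D \<longrightarrow>
         distr N borel D = distr M borel Z2) \<and>
      (AE \<omega> in M. summable
         (\<lambda>k. P2 k \<omega> powr \<alpha> * (\<Prod>i=1..l. B' i k \<omega>) * Z2s k \<omega>)) \<and>
      distr M borel Z2 = distr M borel
         (\<lambda>\<omega>. \<Sum>k. P2 k \<omega> powr \<alpha> * (\<Prod>i=1..l. B' i k \<omega>) * Z2s k \<omega>) \<and>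
      (AE \<omega> in M. summable (\<lambda>k. P2 k \<omega> powr \<alpha> * (\<Prod>i=1..l. B' i k \<omega>))) \<and>
      (\<integral>\<omega>. (\<Sum>k. P2 k \<omega> powr \<alpha> * (\<Prod>i=1..l. B' i k \<omega>)) \<partial>M) = 1)"
proof -
  note b = \<open>0 \<le> \<beta>\<close> \<open>\<beta> < \<alpha>\<close> \<open>\<alpha> < 1\<close>
  have \<alpha>: "0 < \<alpha>" using b by simp
  \<comment> \<open>\<open>1 \<le> l\<close> makes both parameters positive, the range in which the
    Mittag-Leffler laws are treated above.\<close>
  have "1 * \<alpha> \<le> real l * \<alpha>" using \<open>1 \<le> l\<close> \<alpha> by (intro mult_right_mono) auto
  then have \<theta>1: "0 < real l * \<alpha> - \<beta>" using b by linarith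
  have \<theta>2: "0 < real l - \<beta>" using b \<open>1 \<le> l\<close> by linarith
  have diversity: "\<forall>(Q :: nat \<Rightarrow> 'b \<Rightarrow> real) D. has_seq_law N Q (PD \<alpha> \<theta>) \<and> alpha_diversity N \<alpha> Q D \<longrightarrow>
      distr N borel D = distr M borel Z"
    if "0 < \<theta>" "has_law M Z (mittag_leffler_law f \<alpha> \<theta>)" for \<theta> Z
    using that(2) by (auto simp: has_law_def diversity_law[OF N \<alpha> b(3) f that(1)])
  have "\<forall>(Q :: nat \<Rightarrow> 'b \<Rightarrow> real) D. has_seq_law N Q (PD \<alpha> (real l * \<alpha> - \<beta>)) \<and> alpha_diversity N \<alpha> Q D \<longrightarrow>
      distr N borel D = distr M borel Z1"
    by (rule diversity[OF \<theta>1 Z1])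
  moreover have "\<forall>(Q :: nat \<Rightarrow> 'b \<Rightarrow> real) D. has_seq_law N Q (PD \<alpha> (real l - \<beta>)) \<and> alpha_diversity N \<alpha> Q D \<longrightarrow>
      distr N borel D = distr M borel Z2"
    by (rule diversity[OF \<theta>2 Z2])
  moreover note mittag_leffler_fixed_point[OF M b f \<theta>1 P1 W'_iid Z1s_iid indep1
      W_product_moments(2)[OF M b W_indep W_law] W_product_moments(1)[OF M b W_indep W_law] Z1]
    mittag_leffler_fixed_point[OF M b f \<theta>2 P2 B'_iid Z2s_iid indep2
      B_product_moments(2)[OF M b B_indep B_law] B_product_moments(1)[OF M b B_indep B_law] Z2]
  ultimately show ?thesis by (intro conjI) blast+
qed

end
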